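(* There is an algorithm that, given a fixed-topology binary tree $T$ on $N$ nodes (and not given any block size), computes in $O(N \lg N)$ time a single layout of $T$ (a linear order of its nodes) such that, for every block size $B \geq 1$ and every $D$, the number of memory transfers with block size $B$ incurred along any root-to-node path of length $D$ in $T$ is $$ O\left( \begin{cases} \dfrac{D}{\lg (1+B)} & \text{when } D = O(\lg N), \\[2ex] \dfrac{\lg N}{\lg \left(1+\frac{B \lg N}{D}\right)} & \text{when } D = \Omega(\lg N) \text{ and } D = O(B \lg N), \\[2ex] \dfrac{D}{B} & \text{when } D = \Omega(B \lg N) \end{cases} \right), $$ where the constants hidden in the $O$-notation do not depend on $B$.
   Context: A fixed-topology tree is a rooted tree whose shape (parent/child structure, including which child is left and which is right) is given and may not be changed. A layout of a tree with $N$ nodes stores each node exactly once in a linear array. For a block size $B$, the array is partitioned into consecutive aligned blocks of $B$ positions each, and the number of memory transfers incurred along a root-to-node path (visiting the nodes from the root downward in order) is the number of blocks containing nodes of that path. A cache-oblivious layout is one computed without knowledge of $B$; its cost is then evaluated for every $B$. The length $D$ of a root-to-node path is the depth of its final node. $\lg$ denotes the base-2 logarithm. Running time is measured on a RAM.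
   Formalization: Each of the three bounds is read as O(max(1, ·)), since any root-to-node path incurs at least one memory transfer while, for example, D/lg(1+B) tends to 0 as B grows with D fixed, so the bounds without the 1 fail for every layout. *)

theory Defs
  imports Complex_Main "HOL-Library.Tree" "HOL-Library.Landau_Symbols"
begin

subsection \<open>Trees, layouts and memory transfers\<close>

text \<open>
  The nodes of a tree are its \<^const>\<open>Node\<close>s (a \<^const>\<open>Leaf\<close> is an absent child), so
  a tree \<^term>\<open>t\<close> has \<^term>\<open>size t\<close> nodes and either child of a node may be missing.
  Labels serve as node identities: they are \<open>0, \<dots>, N - 1\<close>, assigned to the nodes in an
  arbitrary order.
\<close>

definition node_numbered :: "nat tree \<Rightarrow> bool" where
  "node_numbered t \<longleftrightarrow> distinct (inorder t) \<and> set_tree t = {..<size t}"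

fun root_paths :: "'a tree \<Rightarrow> 'a list set" where
  "root_paths Leaf = {}"
| "root_paths (Node l x r) = insert [x] ((#) x ` (root_paths l \<union> root_paths r))"

text \<open>The root has depth \<open>0\<close>.\<close>

definition path_length :: "'a list \<Rightarrow> nat" where
  "path_length p = length p - 1"

definition is_layout :: "'a tree \<Rightarrow> 'a list \<Rightarrow> bool" where
  "is_layout t xs \<longleftrightarrow> distinct xs \<and> set xs = set_tree t"

text \<open>Array position \<open>i\<close> belongs to the aligned block with index \<open>i div B\<close>.\<close>

definition transfers :: "nat \<Rightarrow> 'a list \<Rightarrow> 'a list \<Rightarrow> nat" where
  "transfers B xs p = card ((\<lambda>i. i div B) ` {i. i < length xs \<and> xs ! i \<in> set p})"

subsection \<open>Word RAM\<close>

text \<open>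
  Structured programs over registers and an indirectly addressed memory, both holding
  natural numbers below the word bound \<open>W\<close>. Every arithmetic operation, memory access and
  test takes one time step. An operation whose result would not fit into a word has no
  transition, so a terminating execution never overflows. Subtraction is truncated.
\<close>

datatype arith_op = Add | Sub | Mul | Div

fun arith :: "arith_op \<Rightarrow> nat \<Rightarrow> nat \<Rightarrow> nat" where
  "arith Add a b = a + b"
| "arith Sub a b = a - b"
| "arith Mul a b = a * b"
| "arith Div a b = a div b"

type_synonym reg = nat

datatype ram_prog =
    Skip
  | Const reg nat
  | Arith arith_op reg reg reg
  | Load reg reg
  | Store reg reg
  | Seq ram_prog ram_prog
  | IfLess reg reg ram_prog ram_prog
  | WhileLess reg reg ram_prog

type_synonym ram_state = "(reg \<Rightarrow> nat) \<times> (nat \<Rightarrow> nat)"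

text \<open>\<open>exec W c s n s'\<close>: with word bound \<open>W\<close>, program \<open>c\<close> started in state \<open>s\<close>
  terminates in state \<open>s'\<close> after exactly \<open>n\<close> time steps.\<close>

inductive exec :: "nat \<Rightarrow> ram_prog \<Rightarrow> ram_state \<Rightarrow> nat \<Rightarrow> ram_state \<Rightarrow> bool" for W :: nat where
  Skip: "exec W Skip s 1 s"
| Const: "v < W \<Longrightarrow> exec W (Const x v) (r, m) 1 (r(x := v), m)"
| Arith: "arith f (r y) (r z) < W \<Longrightarrow>
    exec W (Arith f x y z) (r, m) 1 (r(x := arith f (r y) (r z)), m)"
| Load: "exec W (Load x y) (r, m) 1 (r(x := m (r y)), m)"
| Store: "exec W (Store x y) (r, m) 1 (r, m(r x := r y))"
| Seq: "exec W c1 s n1 s' \<Longrightarrow> exec W c2 s' n2 s'' \<Longrightarrow> exec W (Seq c1 c2) s (n1 + n2) s''"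
| IfTrue: "r x < r y \<Longrightarrow> exec W c1 (r, m) n s' \<Longrightarrow>
    exec W (IfLess x y c1 c2) (r, m) (1 + n) s'"
| IfFalse: "\<not> r x < r y \<Longrightarrow> exec W c2 (r, m) n s' \<Longrightarrow>
    exec W (IfLess x y c1 c2) (r, m) (1 + n) s'"
| WhileFalse: "\<not> r x < r y \<Longrightarrow> exec W (WhileLess x y c) (r, m) 1 (r, m)"
| WhileTrue: "r x < r y \<Longrightarrow> exec W c (r, m) n1 s' \<Longrightarrow> exec W (WhileLess x y c) s' n2 s'' \<Longrightarrow>
    exec W (WhileLess x y c) (r, m) (1 + n1 + n2) s''"

text \<open>
  A tree is input as a linked structure: cells \<open>2 * v\<close> and \<open>2 * v + 1\<close> point to the left
  and right child of node \<open>v\<close>, register \<open>0\<close> holds the number of nodes and register \<open>1\<close>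
  points to the root. The pointer to node \<open>v\<close> is \<open>v + 1\<close> and the null pointer is \<open>0\<close>.
  All other cells and registers are \<open>0\<close>.
\<close>

fun tree_ptr :: "nat tree \<Rightarrow> nat" where
  "tree_ptr Leaf = 0"
| "tree_ptr (Node l x r) = x + 1"

fun store_tree :: "nat tree \<Rightarrow> (nat \<Rightarrow> nat) \<Rightarrow> (nat \<Rightarrow> nat)" where
  "store_tree Leaf m = m"
| "store_tree (Node l x r) m =
     (store_tree r (store_tree l m))(2 * x := tree_ptr l, 2 * x + 1 := tree_ptr r)"

definition input_state :: "nat tree \<Rightarrow> ram_state" where
  "input_state t = ((\<lambda>_. 0)(0 := size t, 1 := tree_ptr t), store_tree t (\<lambda>_. 0))"

text \<open>
  The output is the array in memory cells \<open>0, \<dots>, N - 1\<close>. The bound \<open>(N + 2) ^ k\<close>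
  means words of \<open>O(lg N)\<close> bits, the usual proviso for unit-cost running times.
\<close>

definition ram_computes ::
    "ram_prog \<Rightarrow> nat \<Rightarrow> (nat tree \<Rightarrow> nat list) \<Rightarrow> (nat \<Rightarrow> nat) \<Rightarrow> bool" where
  "ram_computes P k L T \<longleftrightarrow>
     (\<forall>t. node_numbered t \<longrightarrow>
        (\<exists>n r m. exec ((size t + 2) ^ k) P (input_state t) n (r, m) \<and>
           n \<le> T (size t) \<and> map m [0..<size t] = L t))"

end

theory Submission
  imports Defs "HOL-Library.Discrete_Functions"
begin

text \<open>
  Let \<open>L = lg N\<close>. A node at depth at most \<open>L\<close> gets the weight \<open>2 ^ (2L + 1 - depth)\<close>, a deeper one its
  subtree size, so the weights of siblings add up to at most the weight of their parent. The
  potential of a node is the number of halvings of the weight above it plus \<open>lg (depth / L)\<close>; it is at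
  most \<open>3 * min depth L\<close>. For every scale \<open>2 ^ j\<close> the tree is cut into chunks: the edge into a node is
  cut if the potential passes a multiple of \<open>s\<close>, or if the depth is a multiple of \<open>t\<close>, where
  \<open>s = \<Theta>(lg (1 + 2 ^ j L / depth))\<close> is a power of two and \<open>t = 2 ^ s * depth / L\<close>. By the superadditivity
  of the weights a chunk has at most \<open>2 ^ s\<close> nodes on every level, hence \<open>O(2 ^ j)\<close> nodes in total. A path
  meets \<open>O(L / s)\<close> potential cuts, and the numbers of its depth cuts form a rapidly convergent sum of
  the same order. Both widths divide those of the next scale, so the chunks are nested, and a radix sort
  of the nodes by their chunk roots makes all chunks of all scales contiguous at once. An aligned block of
  size \<open>B\<close> is compared with the chunks of scale \<open>j = \<lfloor>lg B\<rfloor>\<close>.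
\<close>

subsection \<open>Cut widths\<close>

text \<open>One order has to serve every B, so the partitions of all scales must be nested. For this
  reason cuts sit at absolute multiples of widths, not at distances from the root of a chunk: a cut
  then depends on the node alone, and nesting reduces to divisibility of powers of two. Real subtree
  sizes near the root could spend lg N halvings on very few edges, and a path of length D < lg N
  could then not be charged with only O(D / s) cuts. The artificial weights make the potential equal
  to the depth there. Narrow levels alone would still allow long thin chunks, whence the depth cuts.
  Their widths grow with the depth, and a chunk may cross several regions (intervals of depth with
  the same rounded lg (depth / L)). The region summand of the potential confines it to the
  \<open>s\<close> regions from its own region q on. The numbers of its levels there form a
  geometric sum of at most 2^(q + 2s), so the chunk has at most 2^(q + 3s) nodes; the division by 4
  in \<open>cell_width\<close> makes this at most 2^j, apart from a constant factor when few scales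
  remain.\<close>

lemma floor_log_less_self: "0 < n \<Longrightarrow> floor_log n < n"
  using floor_log_exp2_le[of n] less_exp[of "floor_log n"] by linarith

text \<open>The argument \<open>q\<close> is \<open>lg (depth / L)\<close>; the truncated difference makes the width 1 beyond depth \<open>2 ^ j L\<close>.\<close>

definition cell_width :: "nat \<Rightarrow> nat \<Rightarrow> nat" where
  "cell_width j q = 2 ^ floor_log ((j - q) div 4)"

text \<open>For \<open>q\<close> up to \<open>j\<close> the relative depth 2^q is multiplied by 2^s,
  with s the cell width, so region \<open>q\<close> contains only O(lg N / 2^s) multiples. The cap
  freezes the width at 2^(j + 1) in all deeper regions, which is where the term D / B
  originates.\<close>

definition depth_width :: "nat \<Rightarrow> nat \<Rightarrow> nat" where
  "depth_width j q = 2 ^ (min j q + cell_width j q)"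

lemma cell_width_pos [simp]: "0 < cell_width j q"
  by (simp add: cell_width_def)

lemma cell_width_dvd_scale: "j \<le> j' \<Longrightarrow> cell_width j q dvd cell_width j' q"
  unfolding cell_width_def by (intro le_imp_power_dvd floor_log_le_iff div_le_mono) simp

text \<open>Because widths are rounded to powers of two, the width at a deep node divides the width
  at each of its ancestors. Equality of cells at the deep node thus passes to the coarser cells
  above.\<close>

lemma cell_width_dvd_region: "q \<le> q' \<Longrightarrow> cell_width j q' dvd cell_width j q"
  unfolding cell_width_def by (intro le_imp_power_dvd floor_log_le_iff div_le_mono) simp

lemma cell_width_antimono: "q \<le> q' \<Longrightarrow> cell_width j q' \<le> cell_width j q"
  by (rule dvd_imp_le[OF cell_width_dvd_region]) simp_all

lemma depth_width_dvd_scale: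
  assumes "j \<le> j'"
  shows "depth_width j q dvd depth_width j' q"
proof -
  have "cell_width j q \<le> cell_width j' q"
    by (rule dvd_imp_le[OF cell_width_dvd_scale[OF assms]]) simp
  with assms show ?thesis
    unfolding depth_width_def by (intro le_imp_power_dvd) linarith
qed

lemma cell_width_upper: "4 * cell_width j q \<le> max 4 (j - q)"
proof (cases "(j - q) div 4 = 0")
  case False
  then have "cell_width j q \<le> (j - q) div 4"
    unfolding cell_width_def by (intro floor_log_exp2_le) simp
  then show ?thesis by linarith
qed (simp add: cell_width_def)

text \<open>The factor 8 is 4 from the division times 2 from rounding down to a power of
  two.\<close>

lemma cell_width_lower: "j - q + 1 \<le> 8 * cell_width j q"
  using floor_log_exp2_gt[of "(j - q) div 4"] unfolding cell_width_def by linarith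

text \<open>Cells of width \<open>d\<close> refine those of width \<open>e\<close>. Comparisons of
  potential cells between scales and between regions rest on this.\<close>

lemma div_eq_dvd_coarser:
  fixes a b d e :: nat
  assumes "a div d = b div d" "d dvd e"
  shows "a div e = b div e"
proof -
  obtain k where "e = d * k" using assms(2) by (elim dvdE)
  then show ?thesis using assms(1) by (simp add: div_mult2_eq)
qed

text \<open>The machine has no remainder operation; its program recognises a multiple by the
  quotient having just increased.\<close>

lemma div_pred_less_iff:
  fixes d t :: nat
  assumes "0 < d" "0 < t"
  shows "(d - 1) div t < d div t \<longleftrightarrow> t dvd d"
proof -
  obtain e where e: "d = Suc e" using assms(1) by (cases d) auto
  show ?thesis unfolding e using assms(2) by (simp add: div_Suc dvd_eq_mod_eq_0)
qed

subsection \<open>Nested chunks\<close>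

text \<open>The combinatorics sees a tree only through parents, depths and subtree sizes, the same
  arrays that the machine computes later. The strict inequality in \<open>sz_children\<close>
  accounts for the node itself.\<close>

locale rooted_tree =
  fixes N rt :: nat and par dep sz :: "nat \<Rightarrow> nat"
  assumes rt_less: "rt < N"
    and dep_rt: "dep rt = 0"
    and sz_rt: "sz rt = N"
    and par_less: "\<And>v. v < N \<Longrightarrow> v \<noteq> rt \<Longrightarrow> par v < N"
    and dep_par: "\<And>v. v < N \<Longrightarrow> v \<noteq> rt \<Longrightarrow> dep v = Suc (dep (par v))"
    and sz_pos: "\<And>v. v < N \<Longrightarrow> 0 < sz v"
    and sz_children: "\<And>u. u < N \<Longrightarrow> (\<Sum>c | c < N \<and> c \<noteq> rt \<and> par c = u. sz c) < sz u"
    and binary: "\<And>u. u < N \<Longrightarrow> card {c. c < N \<and> c \<noteq> rt \<and> par c = u} \<le> 2"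
begin

abbreviation children :: "nat \<Rightarrow> nat set" where
  "children u \<equiv> {c. c < N \<and> c \<noteq> rt \<and> par c = u}"

text \<open>Despite its name this is the floor of lg N, the height of a balanced tree with N nodes,
  and not the height of the given tree.\<close>

definition height :: nat where "height = floor_log N"

text \<open>The rounded value of lg (depth / lg N). Region 0 reaches down to depth
  \<open>2 * height + 1\<close>, since \<open>floor_log\<close> is 0 at both 0 and 1.\<close>

definition region :: "nat \<Rightarrow> nat" where
  "region d = floor_log (d div (height + 1))"

text \<open>The exponent is chosen so that the last artificial weight, at depth
  \<open>height\<close>, is 2^(height + 1) > N and dominates the real sizes that follow.\<close>

definition weight :: "nat \<Rightarrow> nat" where
  "weight v = (if dep v \<le> height then 2 ^ (2 * height + 1 - dep v) else sz v)"

definition potential :: "nat \<Rightarrow> nat" where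
  "potential v = 2 * height + 1 - floor_log (weight v) + region (dep v)"

text \<open>Both widths are read at the lower end \<open>v\<close> of the edge. Cell widths only get
  finer on the way down, so the tests along a path can all be compared with a single width.\<close>

definition is_cut :: "nat \<Rightarrow> nat \<Rightarrow> bool" where
  "is_cut j v \<longleftrightarrow> v \<noteq> rt \<and>
     (let q = region (dep v) in
      potential (par v) div cell_width j q < potential v div cell_width j q \<or>
      depth_width j q dvd dep v)"

text \<open>The depth serves as fuel for the ascent; fuel 0 means that the root of the tree has been
  reached.\<close>

primrec chunk_root_aux :: "nat \<Rightarrow> nat \<Rightarrow> nat \<Rightarrow> nat" where
  "chunk_root_aux j 0 v = v"
| "chunk_root_aux j (Suc d) v = (if is_cut j v then v else chunk_root_aux j d (par v))"

definition chunk_root :: "nat \<Rightarrow> nat \<Rightarrow> nat" where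
  "chunk_root j v = chunk_root_aux j (dep v) v"

definition chunk :: "nat \<Rightarrow> nat \<Rightarrow> nat set" where
  "chunk j r = {v. v < N \<and> chunk_root j v = r}"

lemma chunk_root_rt: "chunk_root j rt = rt"
  by (simp add: chunk_root_def dep_rt)

lemma chunk_root_cut: "is_cut j v \<Longrightarrow> chunk_root j v = v"
  by (cases "dep v") (simp_all add: chunk_root_def)

lemma chunk_root_par: "v < N \<Longrightarrow> v \<noteq> rt \<Longrightarrow> \<not> is_cut j v \<Longrightarrow> chunk_root j v = chunk_root j (par v)"
  by (simp add: chunk_root_def dep_par)

lemma chunk_root_rec:
  "v < N \<Longrightarrow> chunk_root j v = (if v = rt \<or> is_cut j v then v else chunk_root j (par v))"
  by (simp add: chunk_root_rt chunk_root_cut chunk_root_par)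

lemma node_induct [consumes 1, case_names root step]:
  assumes "v < N" "P rt"
    and "\<And>v. v < N \<Longrightarrow> v \<noteq> rt \<Longrightarrow> P (par v) \<Longrightarrow> P v"
  shows "P v"
  using assms(1)
proof (induction "dep v" arbitrary: v rule: less_induct)
  case less
  then show ?case
    using assms(2,3) dep_par par_less by (cases "v = rt") fastforce+
qed

section \<open>Sizes, weights and the potential along the tree\<close>

lemma sz_child_less: "v < N \<Longrightarrow> v \<noteq> rt \<Longrightarrow> sz v < sz (par v)"
proof -
  assume v: "v < N" "v \<noteq> rt"
  have "sz v \<le> (\<Sum>c\<in>children (par v). sz c)"
    using v by (intro member_le_sum) auto
  also have "\<dots> < sz (par v)" using sz_children[OF par_less[OF v]] .
  finally show ?thesis .
qed

text \<open>Every step down loses at least the parent itself from the subtree, so the sum cannot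
  grow from its value N at the root.\<close>

lemma sz_dep: "v < N \<Longrightarrow> sz v + dep v \<le> N"
proof (induction v rule: node_induct)
  case (step v)
  then show ?case using sz_child_less[of v] dep_par[of v] by simp
qed (simp add: sz_rt dep_rt)

lemma dep_less: "v < N \<Longrightarrow> dep v < N"
  using sz_dep[of v] sz_pos[of v] by simp

lemma sz_le: "v < N \<Longrightarrow> sz v \<le> N"
  using sz_dep[of v] by simp

lemma N_less: "N < 2 ^ (height + 1)"
  using floor_log_exp2_gt[of N] by (simp add: height_def)

lemma N_ge: "2 ^ height \<le> N"
  unfolding height_def using rt_less by (intro floor_log_exp2_le) simp

lemma weight_pos: "v < N \<Longrightarrow> 0 < weight v"
  using sz_pos by (simp add: weight_def)

text \<open>Superadditivity has three causes: above depth \<open>height\<close> at most two children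
  have half the weight of their parent each; at the seam all sizes together stay below 2^(height +
  1); below it the sizes themselves are superadditive.\<close>

lemma weight_children:
  assumes "u < N"
  shows "(\<Sum>c\<in>children u. weight c) \<le> weight u"
proof -
  have deps: "dep c = Suc (dep u)" if "c \<in> children u" for c
    using that dep_par by auto
  consider "dep u < height" | "dep u = height" | "dep u > height" by linarith
  then show ?thesis
  proof cases
    case 1
    have "(\<Sum>c\<in>children u. weight c) = (\<Sum>c\<in>children u. 2 ^ (2 * height + 1 - Suc (dep u)))"
      using 1 deps by (intro sum.cong) (auto simp: weight_def)
    also have "\<dots> \<le> 2 * 2 ^ (2 * height + 1 - Suc (dep u))"
      using binary[OF assms] by simp
    also have "\<dots> = 2 ^ Suc (2 * height + 1 - Suc (dep u))" by simp
    also have "Suc (2 * height + 1 - Suc (dep u)) = 2 * height + 1 - dep u"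
      using 1 by simp
    finally show ?thesis using 1 by (simp add: weight_def)
  next
    case 2
    have "(\<Sum>c\<in>children u. weight c) = (\<Sum>c\<in>children u. sz c)"
      using 2 deps by (intro sum.cong) (auto simp: weight_def)
    also have "\<dots> < sz u" using sz_children[OF assms] .
    also have "\<dots> \<le> N" using sz_le[OF assms] .
    also have "\<dots> < 2 ^ (height + 1)" by (rule N_less)
    also have "\<dots> = weight u" using 2 by (simp add: weight_def)
    finally show ?thesis by simp
  next
    case 3
    have "(\<Sum>c\<in>children u. weight c) = (\<Sum>c\<in>children u. sz c)"
      using 3 deps by (intro sum.cong) (auto simp: weight_def)
    also have "\<dots> < sz u" using sz_children[OF assms] .
    also have "sz u = weight u" using 3 by (simp add: weight_def)
    finally show ?thesis by simp
  qed
qed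

lemma weight_par: "v < N \<Longrightarrow> v \<noteq> rt \<Longrightarrow> weight v \<le> weight (par v)"
proof -
  assume v: "v < N" "v \<noteq> rt"
  have "weight v \<le> (\<Sum>c\<in>children (par v). weight c)"
    using v by (intro member_le_sum) auto
  also have "\<dots> \<le> weight (par v)" using weight_children[OF par_less[OF v]] .
  finally show ?thesis .
qed

text \<open>Guarantees that the subtraction in \<open>potential\<close> is never truncated, so that
  differences of potentials bound quotients of weights.\<close>

lemma log_weight_le: "v < N \<Longrightarrow> floor_log (weight v) \<le> 2 * height + 1"
proof (induction v rule: node_induct)
  case root
  then show ?case by (simp add: weight_def dep_rt flip: power_Suc)
next
  case (step v)
  then show ?case using floor_log_le_iff[OF weight_par[of v]] by simp
qed

lemma region_mono: "d \<le> d' \<Longrightarrow> region d \<le> region d'"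
  unfolding region_def by (intro floor_log_le_iff div_le_mono)

lemma potential_par: "v < N \<Longrightarrow> v \<noteq> rt \<Longrightarrow> potential (par v) \<le> potential v"
proof -
  assume v: "v < N" "v \<noteq> rt"
  have "floor_log (weight v) \<le> floor_log (weight (par v))"
    by (intro floor_log_le_iff weight_par v)
  moreover have "region (dep (par v)) \<le> region (dep v)"
    using dep_par[OF v] by (intro region_mono) simp
  ultimately show ?thesis unfolding potential_def by linarith
qed

text \<open>This is the purpose of the artificial weights: a shallow path pays for its length only,
  whatever the shape of the tree.\<close>

lemma potential_shallow: "dep v \<le> height \<Longrightarrow> potential v = dep v"
proof -
  assume a: "dep v \<le> height"
  have "floor_log (weight v) = 2 * height + 1 - dep v"
    using a by (simp only: weight_def if_True floor_log_power)
  moreover have "region (dep v) = 0"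
    using a by (simp add: region_def)
  ultimately show ?thesis using a by (simp add: potential_def)
qed

lemma potential_deep:
  "height < dep v \<Longrightarrow> potential v = 2 * height + 1 - floor_log (sz v) + region (dep v)"
  by (simp add: potential_def weight_def)

lemma region_le_height: "d \<le> N \<Longrightarrow> region d \<le> height"
  unfolding region_def height_def by (intro floor_log_le_iff) (rule le_trans[OF div_le_dividend])

text \<open>The factor 3 collects up to \<open>2 * height + 1\<close> halvings and a region of at
  most \<open>height\<close>.\<close>

lemma potential_le: "v < N \<Longrightarrow> potential v \<le> 3 * min (dep v) (height + 1)"
proof (cases "dep v \<le> height")
  case True
  then show ?thesis by (simp add: potential_shallow)
next
  case False
  assume "v < N"
  then have "region (dep v) \<le> height"
    using dep_less by (intro region_le_height) (simp add: less_imp_le)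
  then show ?thesis using False unfolding potential_def by simp
qed

section \<open>Cuts and their nesting across scales\<close>

lemma not_cutD:
  assumes "v < N" "v \<noteq> rt" "\<not> is_cut j v"
  shows "potential (par v) div cell_width j (region (dep v)) = potential v div cell_width j (region (dep v))"
    and "\<not> depth_width j (region (dep v)) dvd dep v"
proof -
  let ?s = "cell_width j (region (dep v))"
  have "\<not> potential (par v) div ?s < potential v div ?s"
    and "\<not> depth_width j (region (dep v)) dvd dep v"
    using assms by (auto simp: is_cut_def Let_def)
  moreover have "potential (par v) div ?s \<le> potential v div ?s"
    by (intro div_le_mono potential_par assms)
  ultimately show "potential (par v) div ?s = potential v div ?s"
    and "\<not> depth_width j (region (dep v)) dvd dep v" by linarith+
qed

text \<open>The widths of scale \<open>j\<close> divide those of \<open>j'\<close>, so a boundary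
  between coarse cells is also a boundary between fine ones, for the potential as well as for the
  depth.\<close>

lemma is_cut_antimono:
  assumes "v < N" "j \<le> j'" "is_cut j' v"
  shows "is_cut j v"
proof (rule ccontr)
  assume n: "\<not> is_cut j v"
  have v: "v \<noteq> rt" using assms by (auto simp: is_cut_def)
  note nc = not_cutD[OF assms(1) v n]
  have "potential (par v) div cell_width j' (region (dep v)) = potential v div cell_width j' (region (dep v))"
    using div_eq_dvd_coarser[OF nc(1)] cell_width_dvd_scale[OF assms(2)] by blast
  moreover have "\<not> depth_width j' (region (dep v)) dvd dep v"
    using nc(2) depth_width_dvd_scale[OF assms(2)] dvd_trans by blast
  ultimately show False using assms(3) by (simp add: is_cut_def Let_def)
qed

lemma chunk_root_less: "v < N \<Longrightarrow> chunk_root j v < N"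
proof (induction v rule: node_induct)
  case (step v)
  then show ?case using chunk_root_rec[of v] by auto
qed (use rt_less in \<open>simp add: chunk_root_rt\<close>)

text \<open>A path without fine cuts has no coarse cuts, so the coarse ascent from \<open>v\<close>
  passes through the fine chunk root. Each coarse chunk is therefore a union of fine ones.\<close>

lemma chunk_root_nested:
  assumes "j \<le> j'" "v < N"
  shows "chunk_root j' (chunk_root j v) = chunk_root j' v"
  using assms(2)
proof (induction v rule: node_induct)
  case (step v)
  show ?case
  proof (cases "is_cut j v")
    case False
    then have "\<not> is_cut j' v" using is_cut_antimono assms(1) step by blast
    with False step show ?thesis by (simp add: chunk_root_par)
  qed (simp add: chunk_root_cut)
qed (simp add: chunk_root_rt)

text \<open>All five facts follow from one induction along the uncut path from \<open>r\<close> down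
  to \<open>v\<close>. In the fourth, each edge preserves the cell of the width in its own region,
  which divides the width in the region of \<open>r\<close>; so the coarser cell of \<open>r\<close>
  never changes.\<close>

lemma chunk_invariants:
  fixes j v
  assumes "v < N"
  defines "r \<equiv> chunk_root j v"
  shows "dep r \<le> dep v"
    and "v = r \<or> dep r < dep v"
    and "weight v \<le> weight r"
    and "potential r div cell_width j (region (dep r)) = potential v div cell_width j (region (dep r))"
    and "\<And>d. dep r < d \<Longrightarrow> d \<le> dep v \<Longrightarrow> \<not> depth_width j (region d) dvd d"
proof -
  have "dep (chunk_root j v) \<le> dep v \<and> (v = chunk_root j v \<or> dep (chunk_root j v) < dep v) \<and>
    weight v \<le> weight (chunk_root j v) \<and>
    potential (chunk_root j v) div cell_width j (region (dep (chunk_root j v))) =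
      potential v div cell_width j (region (dep (chunk_root j v))) \<and>
    (\<forall>d. dep (chunk_root j v) < d \<longrightarrow> d \<le> dep v \<longrightarrow> \<not> depth_width j (region d) dvd d)"
    using assms(1)
  proof (induction v rule: node_induct)
    case (step v)
    show ?case
    proof (cases "is_cut j v")
      case False
      let ?r = "chunk_root j (par v)"
      have r: "chunk_root j v = ?r" using False step by (simp add: chunk_root_par)
      note nc = not_cutD[OF step(1,2) False]
      have "region (dep ?r) \<le> region (dep v)"
        using step dep_par[of v] by (intro region_mono) auto
      then have "potential (par v) div cell_width j (region (dep ?r)) = potential v div cell_width j (region (dep ?r))"
        by (intro div_eq_dvd_coarser[OF nc(1)] cell_width_dvd_region)
      moreover have "\<not> depth_width j (region d) dvd d" if "dep ?r < d" "d \<le> dep v" for d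
        using that step nc(2) dep_par[of v] by (cases "d = dep v") auto
      moreover have "weight v \<le> weight ?r"
        using step weight_par[of v] by auto
      ultimately show ?thesis
        unfolding r using step dep_par[of v] by auto
    qed (simp add: chunk_root_cut)
  qed (simp add: chunk_root_rt)
  note this[folded r_def]
  then show "dep r \<le> dep v" "v = r \<or> dep r < dep v" "weight v \<le> weight r"
    "potential r div cell_width j (region (dep r)) = potential v div cell_width j (region (dep r))"
    "\<And>d. dep r < d \<Longrightarrow> d \<le> dep v \<Longrightarrow> \<not> depth_width j (region d) dvd d"
    by blast+
qed

section \<open>The number of nodes in a chunk\<close>

definition level :: "nat \<Rightarrow> nat \<Rightarrow> nat \<Rightarrow> nat set" where
  "level j r d = {v \<in> chunk j r. dep v = d}"

lemma finite_chunk [simp]: "finite (chunk j r)" by (simp add: chunk_def)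
lemma finite_level [simp]: "finite (level j r d)" by (simp add: level_def)

text \<open>Below the depth of \<open>r\<close>, a node of the chunk has inherited its chunk root
  from its parent. Grouping a level by parents and using superadditivity passes the total weight
  down level by level.\<close>

lemma level_weight:
  assumes "dep r \<le> d"
  shows "(\<Sum>v\<in>level j r d. weight v) \<le> weight r"
  using assms
proof (induction d rule: dec_induct)
  case base
  have "level j r (dep r) \<subseteq> {r}"
    using chunk_invariants(2) by (fastforce simp: level_def chunk_def)
  then have "(\<Sum>v\<in>level j r (dep r). weight v) \<le> (\<Sum>v\<in>{r}. weight v)"
    by (intro sum_mono2) auto
  then show ?case by simp
next
  case (step d)
  have par: "par v \<in> level j r d \<and> v < N \<and> v \<noteq> rt" if "v \<in> level j r (Suc d)" for v
  proof -
    from that have v: "v < N" "chunk_root j v = r" "dep v = Suc d"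
      by (auto simp: level_def chunk_def)
    then have nr: "v \<noteq> rt" using dep_rt by auto
    have "v \<noteq> r" using step v by auto
    then have "chunk_root j (par v) = r" using chunk_root_rec[OF v(1), of j] v(2) nr by (auto split: if_splits)
    then show ?thesis using v nr par_less[OF v(1) nr] dep_par[OF v(1) nr] by (auto simp: level_def chunk_def)
  qed
  have "(\<Sum>v\<in>level j r (Suc d). weight v)
      = (\<Sum>u\<in>level j r d. \<Sum>v\<in>{v \<in> level j r (Suc d). par v = u}. weight v)"
    using par by (intro sum.group[symmetric]) auto
  also have "\<dots> \<le> (\<Sum>u\<in>level j r d. \<Sum>v\<in>children u. weight v)"
    using par by (intro sum_mono sum_mono2) auto
  also have "\<dots> \<le> (\<Sum>u\<in>level j r d. weight u)"
    by (intro sum_mono weight_children) (auto simp: level_def chunk_def)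
  finally show ?case using step by simp
qed

lemma chunk_potential_gap:
  assumes "v \<in> chunk j r"
  shows "potential v < potential r + cell_width j (region (dep r))"
proof -
  let ?s = "cell_width j (region (dep r))"
  have v: "v < N" "chunk_root j v = r" using assms by (auto simp: chunk_def)
  have "potential r div ?s = potential v div ?s"
    using chunk_invariants(4)[OF v(1), of j] v(2) by simp
  then have "potential v = (potential r div ?s) * ?s + potential v mod ?s"
    by (metis div_mult_mod_eq)
  also have "\<dots> < potential r + ?s"
    by (intro add_le_less_mono) simp_all
  finally show ?thesis .
qed

text \<open>The potential rises by at most s - 1 inside the chunk, so each node keeps nearly a 2^(s
  - 1) th part of the weight of \<open>r\<close>, while a level has no more than that weight in
  total. The remaining factor 2 pays for rounding the logarithm.\<close>

lemma card_level_less: "card (level j r d) < 2 ^ cell_width j (region (dep r))"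
proof (cases "level j r d = {}")
  case False
  let ?s = "cell_width j (region (dep r))"
  let ?k = "floor_log (weight r)"
  obtain v0 where v0: "v0 \<in> level j r d" using False by blast
  then have d: "dep r \<le> d" and r: "r < N"
    using chunk_invariants(1) chunk_root_less by (auto simp: level_def chunk_def)
  have low: "2 ^ ?k \<le> 2 ^ (?s - 1) * weight v" if "v \<in> level j r d" for v
  proof -
    have v: "v < N" "chunk_root j v = r" "v \<in> chunk j r" using that by (auto simp: level_def chunk_def)
    have "region (dep r) \<le> region (dep v)"
      using chunk_invariants(1)[OF v(1), of j] v(2) by (intro region_mono) simp
    with chunk_potential_gap[OF v(3)] log_weight_le[OF r] log_weight_le[OF v(1)]
    have "?k \<le> ?s - 1 + floor_log (weight v)"
      unfolding potential_def by linarith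
    then have "(2::nat) ^ ?k \<le> 2 ^ (?s - 1 + floor_log (weight v))" by simp
    also have "\<dots> = 2 ^ (?s - 1) * 2 ^ floor_log (weight v)" by (simp add: power_add)
    also have "\<dots> \<le> 2 ^ (?s - 1) * weight v"
      using floor_log_exp2_le[OF weight_pos[OF v(1)]] by simp
    finally show ?thesis .
  qed
  have "card (level j r d) * 2 ^ ?k = (\<Sum>v\<in>level j r d. 2 ^ ?k)" by simp
  also have "\<dots> \<le> (\<Sum>v\<in>level j r d. 2 ^ (?s - 1) * weight v)" using low by (rule sum_mono)
  also have "\<dots> = 2 ^ (?s - 1) * (\<Sum>v\<in>level j r d. weight v)" by (simp add: sum_distrib_left)
  also have "\<dots> \<le> 2 ^ (?s - 1) * weight r" using level_weight[OF d] by simp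
  also have "\<dots> < 2 ^ (?s - 1) * (2 * 2 ^ ?k)" using floor_log_exp2_gt[of "weight r"] by simp
  also have "\<dots> = 2 ^ ?s * 2 ^ ?k" using cell_width_pos[of j "region (dep r)"]
    by (cases ?s) simp_all
  finally show ?thesis by simp
qed simp

text \<open>Two depths of the chunk that lie in one region at distance at least the depth width
  would enclose a multiple of that width, hence a cut between them.\<close>

lemma card_chunk_region_depths:
  "card {d. level j r d \<noteq> {} \<and> region d = q} \<le> depth_width j q"
proof (cases "{d. level j r d \<noteq> {} \<and> region d = q} = {}")
  case False
  let ?S = "{d. level j r d \<noteq> {} \<and> region d = q}"
  let ?t = "depth_width j q"
  define d1 where "d1 = (LEAST d. d \<in> ?S)"
  obtain d0 where "d0 \<in> ?S" using False by blast
  then have d1: "d1 \<in> ?S" unfolding d1_def by (rule LeastI)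
  have min: "d1 \<le> d" if "d \<in> ?S" for d unfolding d1_def using that by (rule Least_le)
  have t: "0 < ?t" by (simp add: depth_width_def)
  have "d < d1 + ?t" if d: "d \<in> ?S" for d
  proof (rule ccontr)
    assume far: "\<not> d < d1 + ?t"
    \<comment> \<open>The first multiple of the width after \<open>d1\<close>. It stays in region
      \<open>q\<close> since regions are monotone and both \<open>d1\<close> and \<open>d\<close>
      are in \<open>q\<close>.\<close>
    define e where "e = (d1 div ?t + 1) * ?t"
    have e: "d1 < e" "e \<le> d1 + ?t" "?t dvd e"
      using dividend_less_div_times[OF t, of d1] div_times_less_eq_dividend[of d1 ?t]
      by (simp_all add: e_def algebra_simps)
    obtain v where v: "v < N" "chunk_root j v = r" "dep v = d"
      using d by (auto simp: level_def chunk_def)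
    obtain u where u: "u < N" "chunk_root j u = r" "dep u = d1"
      using d1 by (auto simp: level_def chunk_def)
    have "region e = q"
      using region_mono[of d1 e] region_mono[of e d] e far d d1 by auto
    moreover have "dep r < e" "e \<le> dep v"
      using chunk_invariants(1)[OF u(1), of j] u e far v by auto
    ultimately show False using chunk_invariants(5)[OF v(1), of j e] v e by simp
  qed
  with min have "?S \<subseteq> {d1..<d1 + ?t}" by (meson atLeastLessThan_iff subsetI)
  then have "card ?S \<le> card {d1..<d1 + ?t}" by (intro card_mono) auto
  then show ?thesis by simp
qed (simp only: card.empty)

lemma card_chunk: "card (chunk j r) \<le> 4 * 2 ^ j"
proof (cases "chunk j r = {}")
  case False
  define q0 where "q0 = region (dep r)"
  define s where "s = cell_width j q0"
  let ?D = "{d. level j r d \<noteq> {}}"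
  have D: "?D = dep ` chunk j r" by (auto simp: level_def)
  then have fin: "finite ?D" by simp
  have r: "r < N" using False chunk_root_less by (auto simp: chunk_def)
  have reg: "region d \<in> {q0..<q0 + s}" if "d \<in> ?D" for d
  proof -
    obtain v where v: "v < N" "chunk_root j v = r" "v \<in> chunk j r" "dep v = d"
      using \<open>d \<in> ?D\<close> by (auto simp: level_def chunk_def)
    have "q0 \<le> region d"
      using chunk_invariants(1)[OF v(1), of j] v unfolding q0_def by (intro region_mono) simp
    moreover have "floor_log (weight v) \<le> floor_log (weight r)"
      using chunk_invariants(3)[OF v(1), of j] v by (intro floor_log_le_iff) simp
    \<comment> \<open>Weights do not grow on the way down, so an increase of the region must fit
      into the potential gap on its own.\<close>
    moreover have "region (dep v) < q0 + s"
      using chunk_potential_gap[OF v(3)] calculation(2) log_weight_le[OF r]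
      unfolding potential_def q0_def s_def by linarith
    ultimately show ?thesis using v(4) by simp
  qed
  have "chunk j r = (\<Union>d\<in>?D. level j r d)" by (auto simp: level_def)
  then have "card (chunk j r) \<le> (\<Sum>d\<in>?D. card (level j r d))"
    using card_UN_le[OF fin, of "level j r"] by simp
  also have "\<dots> \<le> (\<Sum>d\<in>?D. 2 ^ s)"
    using card_level_less unfolding s_def q0_def by (intro sum_mono) (simp add: less_imp_le)
  also have "\<dots> = card ?D * 2 ^ s" by simp
  finally have 1: "card (chunk j r) \<le> card ?D * 2 ^ s" .
  have "card ?D = (\<Sum>q\<in>{q0..<q0 + s}. card {d \<in> ?D. region d = q})"
  proof -
    have "(\<Sum>q\<in>{q0..<q0 + s}. \<Sum>d\<in>{d \<in> ?D. region d = q}. 1) = (\<Sum>d\<in>?D. 1::nat)"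
      using reg by (intro sum.group fin) blast+
    then show ?thesis by simp
  qed
  also have "\<dots> \<le> (\<Sum>q\<in>{q0..<q0 + s}. 2 ^ (min j q + s))"
  proof (rule sum_mono)
    fix q assume q: "q \<in> {q0..<q0 + s}"
    have "card {d \<in> ?D. region d = q} \<le> depth_width j q"
      using card_chunk_region_depths[of j r q] by simp
    also have "\<dots> \<le> 2 ^ (min j q + s)"
      using cell_width_antimono[of q0 q j] q by (simp add: depth_width_def s_def)
    finally show "card {d \<in> ?D. region d = q} \<le> 2 ^ (min j q + s)" .
  qed
  finally have 2: "card ?D \<le> (\<Sum>q\<in>{q0..<q0 + s}. 2 ^ (min j q + s))" .
  show ?thesis
  proof (cases "4 \<le> j - q0")
    case False
    \<comment> \<open>Fewer than four scales remain. The chunk stays in one region, and 2 nodes on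
      each of 2^(j + 1) levels give the factor 4 of the claim.\<close>
    then have s: "s = 1"
      by (simp add: s_def cell_width_def)
    have "card ?D \<le> 2 ^ (min j q0 + 1)" using 2 s by simp
    also have "\<dots> \<le> 2 ^ (j + 1)" by (intro power_increasing) auto
    finally show ?thesis using 1 s by simp
  next
    case True
    then have s: "4 * s \<le> j - q0" using cell_width_upper[of j q0] by (simp add: s_def)
    have "(\<Sum>q\<in>{q0..<q0 + s}. 2 ^ (min j q + s)) \<le> (\<Sum>q\<in>{q0..<q0 + s}. (2::nat) ^ (q + s))"
      by (intro sum_mono power_increasing) auto
    also have "\<dots> = 2 ^ s * (\<Sum>q\<in>{q0..<q0 + s}. (2::nat) ^ q)"
      by (simp add: power_add sum_distrib_left mult.commute)
    also have "\<dots> \<le> 2 ^ s * 2 ^ (q0 + s)"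
    proof -
      have "(\<Sum>q\<in>{q0..<q0 + s}. (2::nat) ^ q) \<le> (\<Sum>q\<in>{..<q0 + s}. (2::nat) ^ q)"
        by (intro sum_mono2) auto
      also have "\<dots> \<le> 2 ^ (q0 + s)" by (simp add: lessThan_atLeast0 sum_power2)
      finally show ?thesis by simp
    qed
    finally have "card (chunk j r) \<le> 2 ^ s * 2 ^ (q0 + s) * 2 ^ s"
      using 1 2 by (meson mult_le_mono1 le_trans)
    also have "\<dots> = 2 ^ (s + (q0 + s) + s)" by (simp add: power_add)
    \<comment> \<open>Four widths fit between \<open>q0\<close> and \<open>j\<close>. Three are
      spent: one on the size of a level and two on the number of levels.\<close>
    also have "\<dots> \<le> 2 ^ j" using s True by (intro power_increasing) auto
    finally show ?thesis by simp
  qed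
qed simp

end

subsection \<open>Contiguous layouts\<close>

lemma card_multiples_le:
  fixes n t :: nat
  assumes "0 < t"
  shows "card {d \<in> {1..n}. t dvd d} \<le> n div t"
proof -
  have "{d \<in> {1..n}. t dvd d} \<subseteq> (\<lambda>k. t * k) ` {1..n div t}"
  proof
    fix d assume d: "d \<in> {d \<in> {1..n}. t dvd d}"
    then obtain k where k: "d = t * k" by auto
    with d assms have "1 \<le> k" "k \<le> n div t" by (auto simp: less_eq_div_iff_mult_less_eq mult.commute)
    with k show "d \<in> (\<lambda>k. t * k) ` {1..n div t}" by auto
  qed
  then have "card {d \<in> {1..n}. t dvd d} \<le> card ((\<lambda>k. t * k) ` {1..n div t})" by (intro card_mono) auto
  also have "\<dots> \<le> card {1..n div t}" by (intro card_image_le) simp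
  finally show ?thesis by simp
qed

text \<open>Every jump of a monotone sequence of natural numbers raises it by at least 1.\<close>

lemma card_jumps_le:
  fixes f :: "nat \<Rightarrow> nat"
  assumes "\<And>i. i < n \<Longrightarrow> f i \<le> f (Suc i)"
  shows "card {i \<in> {1..n}. f (i - 1) < f i} \<le> f n"
  using assms
proof (induction n)
  case (Suc n)
  have "{i \<in> {1..Suc n}. f (i - 1) < f i} =
    {i \<in> {1..n}. f (i - 1) < f i} \<union> (if f n < f (Suc n) then {Suc n} else {})"
    by (auto simp: le_Suc_eq)
  then have "card {i \<in> {1..Suc n}. f (i - 1) < f i} \<le>
    card {i \<in> {1..n}. f (i - 1) < f i} + (if f n < f (Suc n) then 1 else 0)"
    by (auto intro: order.trans[OF card_Un_le])
  with Suc.IH Suc.prems Suc.prems[of n] show ?case by (fastforce split: if_splits)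
qed simp

text \<open>The factor 2 is forced by s = 3, where 9 exceeds 8.\<close>

lemma square_le_twice_power: "(s::nat)\<^sup>2 \<le> 2 * 2 ^ s"
proof (induction s rule: nat_less_induct)
  case (1 s)
  show ?case
  proof (cases "s \<le> 4")
    case True
    then have "s = 0 \<or> s = 1 \<or> s = 2 \<or> s = 3 \<or> s = 4" by linarith
    then show ?thesis by auto
  next
    case False
    then obtain n where n: "s = Suc n" "4 \<le> n" by (cases s) auto
    then have "n\<^sup>2 \<le> 2 * 2 ^ n" using 1 by simp
    moreover have "(Suc n)\<^sup>2 \<le> 2 * n\<^sup>2"
    proof -
      have "4 * n \<le> n * n" by (rule mult_le_mono1[OF n(2)])
      then have "n * n + 2 * n + 1 \<le> 2 * (n * n)" using n(2) by linarith
      then show ?thesis by (simp add: power2_eq_square)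
    qed
    ultimately show ?thesis using n by simp
  qed
qed

text \<open>The right-hand side telescopes when summed over \<open>q\<close>.\<close>

lemma inverse_power_cell_width:
  "1 / 2 ^ cell_width j q \<le> 144 * (1 / real (j - q + 1) - 1 / real (j - q + 2))"
proof -
  define s where "s = cell_width j q"
  define z where "z = j - q"
  have s: "z + 1 \<le> 8 * s" "1 \<le> s"
    using cell_width_lower[of j q] cell_width_pos[of j q] by (simp_all add: s_def z_def Suc_leI del: cell_width_pos)
  \<comment> \<open>Here z + 2 is at most 8s + 1, hence at most 9s. The constant 144 is 8 * 9
    doubled by the preceding lemma.\<close>
  have "(z + 1) * (z + 2) \<le> (8 * s) * (9 * s)"
    using s by (intro mult_le_mono) linarith+
  also have "\<dots> = 72 * s\<^sup>2" by (simp add: power2_eq_square)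
  also have "\<dots> \<le> 144 * 2 ^ s" using square_le_twice_power[of s] by simp
  finally have "real ((z + 1) * (z + 2)) \<le> real (144 * 2 ^ s)" by (rule of_nat_mono)
  then have "real (z + 1) * real (z + 2) \<le> 144 * 2 ^ s"
    by (simp only: of_nat_mult of_nat_numeral of_nat_power)
  moreover have "0 < real (z + 1) * real (z + 2)" by simp
  ultimately have "1 / 2 ^ s \<le> 144 / (real (z + 1) * real (z + 2))"
    by (simp only: pos_le_divide_eq pos_divide_le_eq zero_less_power zero_less_numeral
      mult_1 times_divide_eq_left)
  also have "\<dots> = 144 * (1 / real (z + 1) - 1 / real (z + 2))"
    by (simp add: field_simps)
  finally show ?thesis by (simp add: s_def z_def)
qed

text \<open>The telescoped sum is governed by its last term, so depth cuts in all regions up to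
  \<open>m\<close> cost no more, up to a constant, than a bound for the deepest one.\<close>

lemma sum_inverse_power_cell_width:
  assumes "m \<le> j"
  shows "(\<Sum>q\<le>m. 1 / 2 ^ cell_width j q) \<le> 144 / real (j - m + 1)"
proof -
  have "(\<Sum>q\<le>m. 1 / 2 ^ cell_width j q) \<le> (\<Sum>q\<le>m. 144 * (1 / real (j - q + 1) - 1 / real (j - q + 2)))"
    by (intro sum_mono inverse_power_cell_width)
  also have "\<dots> = 144 * (1 / real (j - m + 1) - 1 / real (j + 2))"
    using assms
  proof (induction m)
    case (Suc m)
    then have "j - Suc m + 2 = j - m + 1" by simp
    with Suc show ?case by (simp add: algebra_simps)
  qed simp
  also have "\<dots> \<le> 144 / real (j - m + 1)" by simp
  finally show ?thesis .
qed

section \<open>Stable sorting and contiguous blocks\<close>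

definition bucket_sort :: "nat \<Rightarrow> ('a \<Rightarrow> nat) \<Rightarrow> 'a list \<Rightarrow> 'a list" where
  "bucket_sort n key xs = concat (map (\<lambda>k. filter (\<lambda>v. key v = k) xs) [0..<n])"

lemma set_bucket_sort: "(\<And>v. v \<in> set xs \<Longrightarrow> key v < n) \<Longrightarrow> set (bucket_sort n key xs) = set xs"
  by (auto simp: bucket_sort_def)

lemma distinct_bucket_sort:
  assumes "distinct xs"
  shows "distinct (bucket_sort n key xs)"
proof (induction n)
  case (Suc n)
  then show ?case using assms by (auto simp: bucket_sort_def)
qed (simp add: bucket_sort_def)

definition contiguous :: "'a set \<Rightarrow> 'a list \<Rightarrow> bool" where
  "contiguous S xs \<longleftrightarrow> (\<exists>ys zs ws. xs = ys @ zs @ ws \<and> set zs = S)"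

lemma bucket_sort_split:
  assumes "k < n"
  shows "\<exists>ys ws. bucket_sort n key xs = ys @ filter (\<lambda>v. key v = k) xs @ ws"
proof -
  have "[0..<n] = [0..<k] @ k # [Suc k..<n]"
    using assms by (metis less_imp_add_positive upt_add_eq_append upt_conv_Cons zero_le less_imp_le le_add1)
  then show ?thesis unfolding bucket_sort_def by auto
qed

lemma contiguous_bucket:
  "k < n \<Longrightarrow> contiguous {v \<in> set xs. key v = k} (bucket_sort n key xs)"
  using bucket_sort_split[of k n key xs] unfolding contiguous_def
  by (metis set_filter)

text \<open>Stability of the sort: a block whose elements share one key enters a single bucket
  unbroken.\<close>

lemma contiguous_bucket_sort:
  assumes "contiguous S xs" "\<And>v. v \<in> S \<Longrightarrow> key v = k" "k < n"
  shows "contiguous S (bucket_sort n key xs)"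
proof -
  obtain ys zs ws where xs: "xs = ys @ zs @ ws" "set zs = S"
    using assms(1) by (auto simp: contiguous_def)
  obtain as bs where "bucket_sort n key xs = as @ filter (\<lambda>v. key v = k) xs @ bs"
    using bucket_sort_split[OF assms(3)] by blast
  moreover have "filter (\<lambda>v. key v = k) zs = zs"
    using xs(2) assms(2) by (simp add: filter_id_conv)
  ultimately have "bucket_sort n key xs =
      (as @ filter (\<lambda>v. key v = k) ys) @ zs @ (filter (\<lambda>v. key v = k) ws @ bs)"
    by (simp add: xs(1))
  then show ?thesis using xs(2) unfolding contiguous_def by blast
qed

text \<open>The surplus 2 pays for partial blocks at the two ends, as a chunk need not be
  aligned.\<close>

lemma card_blocks_interval:
  assumes "0 < (B::nat)"
  shows "card ((\<lambda>i. i div B) ` {a..<a + l}) \<le> l div B + 2"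
proof -
  have "(\<lambda>i. i div B) ` {a..<a + l} \<subseteq> {a div B..(a + l) div B}"
    by (intro image_subsetI) (simp add: div_le_mono)
  then have "card ((\<lambda>i. i div B) ` {a..<a + l}) \<le> card {a div B..(a + l) div B}"
    by (intro card_mono) auto
  also have "\<dots> = Suc ((a + l) div B) - a div B" by simp
  also have "\<dots> \<le> l div B + 2"
  proof -
    have "a mod B + l mod B < 2 * B"
      using mod_less_divisor[OF assms, of a] mod_less_divisor[OF assms, of l] by linarith
    then have "(a mod B + l mod B) div B < 2"
      using assms by (simp add: div_less_iff_less_mult)
    then show ?thesis using div_add1_eq[of a l B] by linarith
  qed
  finally show ?thesis .
qed

lemma transfers_contiguous:
  assumes "distinct xs" "contiguous S xs" "0 < B"
  shows "card ((\<lambda>i. i div B) ` {i. i < length xs \<and> xs ! i \<in> S}) \<le> card S div B + 2"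
proof -
  obtain ys zs ws where xs: "xs = ys @ zs @ ws" "set zs = S"
    using assms(2) by (auto simp: contiguous_def)
  have "{i. i < length xs \<and> xs ! i \<in> S} \<subseteq> {length ys..<length ys + length zs}"
  proof
    fix i assume "i \<in> {i. i < length xs \<and> xs ! i \<in> S}"
    then have i: "i < length xs" "xs ! i \<in> set zs" using xs by auto
    then obtain k where k: "k < length zs" "zs ! k = xs ! i" by (auto simp: in_set_conv_nth)
    then have "xs ! (length ys + k) = xs ! i" by (simp add: xs(1) nth_append)
    moreover have "length ys + k < length xs" using k(1) by (simp add: xs(1))
    ultimately have "length ys + k = i"
      using i(1) nth_eq_iff_index_eq[OF assms(1)] by blast
    then show "i \<in> {length ys..<length ys + length zs}" using k by simp
  qed
  then have "card ((\<lambda>i. i div B) ` {i. i < length xs \<and> xs ! i \<in> S})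
      \<le> card ((\<lambda>i. i div B) ` {length ys..<length ys + length zs})"
    by (intro card_mono image_mono) auto
  also have "\<dots> \<le> length zs div B + 2" by (rule card_blocks_interval[OF assms(3)])
  also have "length zs = card S" using xs assms(1) by (simp add: distinct_card[symmetric])
  finally show ?thesis .
qed

context rooted_tree
begin

section \<open>Cuts along a root path\<close>

definition node_path :: "nat list \<Rightarrow> bool" where
  "node_path p \<longleftrightarrow> p \<noteq> [] \<and> p ! 0 = rt \<and>
     (\<forall>i. Suc i < length p \<longrightarrow> p ! Suc i < N \<and> p ! Suc i \<noteq> rt \<and> par (p ! Suc i) = p ! i)"

lemma node_path_nth:
  assumes "node_path p" "i < length p"
  shows "p ! i < N \<and> dep (p ! i) = i"
  using assms(2)
proof (induction i)
  case (Suc i)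
  have "p ! Suc i < N \<and> p ! Suc i \<noteq> rt \<and> par (p ! Suc i) = p ! i"
    using assms(1) Suc.prems by (auto simp: node_path_def)
  then show ?case
    using dep_par[of "p ! Suc i"] Suc by auto
qed (use assms(1) rt_less dep_rt in \<open>auto simp: node_path_def\<close>)

lemma node_path_length: "node_path p \<Longrightarrow> path_length p < N"
  using node_path_nth[of p "length p - 1"] dep_less[of "p ! (length p - 1)"]
  by (auto simp: node_path_def path_length_def)

definition cut_indices :: "nat \<Rightarrow> nat list \<Rightarrow> nat set" where
  "cut_indices j p = {i \<in> {1..path_length p}. is_cut j (p ! i)}"

lemma finite_cut_indices [simp]: "finite (cut_indices j p)"
  by (simp add: cut_indices_def)

text \<open>Going down a path, the chunk root changes only at a cut, and then to the cut node; the
  extra 1 is the chunk of the root.\<close>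

lemma chunk_roots_path:
  assumes "node_path p"
  shows "card (chunk_root j ` set p) \<le> Suc (card (cut_indices j p))"
proof -
  let ?A = "insert rt ((!) p ` cut_indices j p)"
  have "chunk_root j (p ! i) \<in> ?A" if "i < length p" for i
    using that
  proof (induction i)
    case 0
    then show ?case using assms by (simp add: node_path_def chunk_root_rt)
  next
    case (Suc i)
    note v = node_path_nth[OF assms Suc.prems]
    have par: "p ! Suc i \<noteq> rt" "par (p ! Suc i) = p ! i"
      using assms Suc.prems by (auto simp: node_path_def)
    show ?case
    proof (cases "is_cut j (p ! Suc i)")
      case True
      then have "Suc i \<in> cut_indices j p"
        using Suc.prems by (simp add: cut_indices_def path_length_def)
      with True show ?thesis by (simp add: chunk_root_cut)
    next
      case False
      then show ?thesis using Suc v par by (simp add: chunk_root_par)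
    qed
  qed
  then have "chunk_root j ` set p \<subseteq> ?A" by (metis image_subsetI in_set_conv_nth)
  then have "card (chunk_root j ` set p) \<le> card ?A" by (intro card_mono) auto
  also have "\<dots> \<le> Suc (card ((!) p ` cut_indices j p))" by (rule card_insert_le_m1) simp_all
  also have "\<dots> \<le> Suc (card (cut_indices j p))" by (simp add: card_image_le)
  finally show ?thesis .
qed

text \<open>The integer form of lg (1 + 2^j lg N / d), up to constants. Truncation makes it 1 beyond
  depth 2^j lg N.\<close>

definition spread :: "nat \<Rightarrow> nat \<Rightarrow> nat" where
  "spread j d = j - region d + 1"

text \<open>The width at the end of the path divides all widths met before, so every potential cut
  is a jump of one quotient with that fixed width. Such jumps number at most its final value. The
  constant is 3 from \<open>potential_le\<close> times 8 from
  \<open>cell_width_lower\<close>.\<close>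

lemma potential_cuts:
  assumes "node_path p"
  defines "D \<equiv> path_length p"
  shows "card {i \<in> {1..D}. potential (p ! (i - 1)) div cell_width j (region i) <
      potential (p ! i) div cell_width j (region i)} * spread j D \<le> 24 * min D (height + 1)"
    (is "card ?P * _ \<le> _")
proof -
  let ?s = "cell_width j (region D)"
  let ?f = "\<lambda>i. potential (p ! i) div ?s"
  have len: "length p = Suc D" using assms by (simp add: node_path_def path_length_def)
  have mono: "potential (p ! i) \<le> potential (p ! Suc i)" if "i < D" for i
    using potential_par[of "p ! Suc i"] that assms(1) len by (auto simp: node_path_def)
  have "?P \<subseteq> {i \<in> {1..D}. ?f (i - 1) < ?f i}"
  proof
    fix i assume i: "i \<in> ?P"
    then have "?f (i - 1) \<le> ?f i" using mono[of "i - 1"] by (intro div_le_mono) auto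
    moreover have "?f (i - 1) \<noteq> ?f i"
    proof
      have "cell_width j (region D) dvd cell_width j (region i)"
        using i by (intro cell_width_dvd_region region_mono) simp
      moreover assume "?f (i - 1) = ?f i"
      ultimately have "potential (p ! (i - 1)) div cell_width j (region i) =
          potential (p ! i) div cell_width j (region i)"
        by (rule div_eq_dvd_coarser[rotated])
      with i show False by simp
    qed
    ultimately have "?f (i - 1) < ?f i" by linarith
    with i show "i \<in> {i \<in> {1..D}. ?f (i - 1) < ?f i}" by simp
  qed
  then have "card ?P \<le> card {i \<in> {1..D}. ?f (i - 1) < ?f i}" by (intro card_mono) auto
  also have "\<dots> \<le> ?f D" using mono by (intro card_jumps_le div_le_mono)
  finally have "card ?P * ?s \<le> potential (p ! D)"
    using cell_width_pos by (simp add: less_eq_div_iff_mult_less_eq)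
  also have "\<dots> \<le> 3 * min D (height + 1)"
    using potential_le[of "p ! D"] node_path_nth[OF assms(1), of D] len by simp
  finally have *: "card ?P * ?s \<le> 3 * min D (height + 1)" .
  have "c * k \<le> 24 * m" if "c * s \<le> 3 * m" "k \<le> 8 * s" for c k m s :: nat
    using mult_le_mono2[OF that(2), of c] that(1) by linarith
  from this[OF *, of "spread j D"] show ?thesis
    using cell_width_lower[of j "region D"] by (simp add: spread_def)
qed

lemma less_region_bound: "0 < d \<Longrightarrow> d < (height + 1) * 2 ^ Suc (region d)"
proof -
  have "d div (height + 1) < 2 ^ Suc (region d)"
    unfolding region_def using floor_log_exp2_gt by simp
  then show ?thesis by (metis add_gr_0 div_less_iff_less_mult mult.commute zero_less_one)
qed

text \<open>Paths no longer than \<open>height\<close> stay in region 0 and are charged to their own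
  length. On longer ones region q up to j contributes at most \<open>2 * (height + 1) / 2^s\<close>,
  and these terms sum to the order of the last one. Beyond region j each depth width is a multiple
  of 2^j, which gives D / 2^j. The constant is 2 * 144.\<close>

lemma depth_cuts:
  fixes j D
  defines "E \<equiv> {d \<in> {1..D}. depth_width j (region d) dvd d}"
  shows "real (card E) \<le> 288 * real (min D (height + 1)) / real (spread j D) + real D / 2 ^ j"
proof (cases "D \<le> height")
  case True
  let ?s = "cell_width j 0"
  have r: "region d = 0" if "d \<le> D" for d using True that by (simp add: region_def)
  have "E \<subseteq> {d \<in> {1..D}. 2 ^ ?s dvd d}" using r by (auto simp: E_def depth_width_def)
  then have "card E \<le> card {d \<in> {1..D}. 2 ^ ?s dvd d}" by (intro card_mono) auto
  also have "\<dots> \<le> D div 2 ^ ?s" by (rule card_multiples_le) simp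
  finally have "card E * 2 ^ ?s \<le> D" by (simp add: less_eq_div_iff_mult_less_eq)
  have "card E * spread j D \<le> card E * (8 * 2 ^ ?s)"
  proof (rule mult_le_mono2)
    have "spread j D \<le> 8 * ?s" using cell_width_lower[of j 0] r[of D] by (simp add: spread_def)
    also have "\<dots> \<le> 8 * 2 ^ ?s" by (simp add: less_imp_le)
    finally show "spread j D \<le> 8 * 2 ^ ?s" .
  qed
  also have "\<dots> \<le> 8 * D" using \<open>card E * 2 ^ ?s \<le> D\<close> by simp
  finally have "real (card E * spread j D) \<le> real (288 * min D (height + 1))"
    using True by (intro of_nat_mono) simp
  then have "real (card E) \<le> 288 * real (min D (height + 1)) / real (spread j D)"
    by (simp add: field_simps spread_def)
  then show ?thesis by (rule order_trans) simp
next
  case False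
  let ?H = "height + 1"
  \<comment> \<open>If the path ends beyond region \<open>j\<close>, the series stops at
    \<open>j\<close>, where \<open>j - m + 1\<close> and \<open>spread j D\<close> are both
    1.\<close>
  define m where "m = min j (region D)"
  let ?E = "\<lambda>q. {d \<in> E. region d = q}"
  have "real (card (?E q)) \<le> 2 * real ?H * (1 / 2 ^ cell_width j q)" if "q \<le> m" for q
  proof -
    have q: "q \<le> j" using that by (simp add: m_def)
    have "?E q \<subseteq> {d \<in> {1..?H * 2 ^ Suc q}. depth_width j q dvd d}"
      using less_region_bound by (fastforce simp: E_def less_imp_le)
    then have "card (?E q) \<le> card {d \<in> {1..?H * 2 ^ Suc q}. depth_width j q dvd d}"
      by (intro card_mono) auto
    also have "\<dots> \<le> ?H * 2 ^ Suc q div depth_width j q"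
      by (rule card_multiples_le) (simp add: depth_width_def)
    finally have "card (?E q) * depth_width j q \<le> ?H * 2 ^ Suc q"
      by (simp add: less_eq_div_iff_mult_less_eq depth_width_def)
    moreover have "depth_width j q = 2 ^ q * 2 ^ cell_width j q"
      using q by (simp add: depth_width_def power_add min_absorb2)
    ultimately have "2 ^ q * (card (?E q) * 2 ^ cell_width j q) \<le> 2 ^ q * (2 * ?H)"
      by (simp add: algebra_simps)
    then have "card (?E q) * 2 ^ cell_width j q \<le> 2 * ?H"
      by (subst (asm) nat_mult_le_cancel1) simp_all
    then have "real (card (?E q) * 2 ^ cell_width j q) \<le> real (2 * ?H)" by (rule of_nat_mono)
    then show ?thesis by (simp add: field_simps)
  qed
  then have "(\<Sum>q\<le>m. real (card (?E q))) \<le> (\<Sum>q\<le>m. 2 * real ?H * (1 / 2 ^ cell_width j q))"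
    by (intro sum_mono) simp
  also have "\<dots> = 2 * real ?H * (\<Sum>q\<le>m. 1 / 2 ^ cell_width j q)"
    by (simp add: sum_distrib_left)
  also have "\<dots> \<le> 2 * real ?H * (144 / real (j - m + 1))"
    by (intro mult_left_mono sum_inverse_power_cell_width) (simp_all add: m_def)
  also have "\<dots> = 288 * real (min D ?H) / real (spread j D)"
  proof -
    have "j - m + 1 = spread j D" "min D ?H = ?H" using False by (simp_all add: m_def spread_def)
    then show ?thesis by simp
  qed
  finally have small: "(\<Sum>q\<le>m. real (card (?E q))) \<le> 288 * real (min D ?H) / real (spread j D)" .
  have "{d \<in> E. j < region d} \<subseteq> {d \<in> {1..D}. 2 ^ j dvd d}"
  proof
    fix d assume "d \<in> {d \<in> E. j < region d}"
    then have d: "d \<in> {1..D}" "depth_width j (region d) dvd d" "j < region d" by (auto simp: E_def)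
    have "2 ^ j dvd depth_width j (region d)"
      using d(3) unfolding depth_width_def by (intro le_imp_power_dvd) simp
    with d show "d \<in> {d \<in> {1..D}. 2 ^ j dvd d}" using dvd_trans by blast
  qed
  then have "card {d \<in> E. j < region d} \<le> card {d \<in> {1..D}. 2 ^ j dvd d}" by (intro card_mono) auto
  also have "\<dots> \<le> D div 2 ^ j" by (rule card_multiples_le) simp
  finally have "real (card {d \<in> E. j < region d}) \<le> real (D div 2 ^ j)" by (rule of_nat_mono)
  also have "\<dots> \<le> real D / 2 ^ j" using of_nat_div_le_of_nat[of D "2 ^ j"]
    by (simp only: of_nat_power of_nat_numeral)
  finally have large: "real (card {d \<in> E. j < region d}) \<le> real D / 2 ^ j" .
  have "E \<subseteq> (\<Union>q\<in>{..m}. ?E q) \<union> {d \<in> E. j < region d}"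
  proof
    fix d assume d: "d \<in> E"
    then have "region d \<le> region D" by (intro region_mono) (simp add: E_def)
    then show "d \<in> (\<Union>q\<in>{..m}. ?E q) \<union> {d \<in> E. j < region d}"
      using d by (cases "j < region d") (simp_all add: m_def)
  qed
  then have "card E \<le> card ((\<Union>q\<in>{..m}. ?E q) \<union> {d \<in> E. j < region d})"
    by (intro card_mono) (auto simp: E_def)
  also have "\<dots> \<le> (\<Sum>q\<le>m. card (?E q)) + card {d \<in> E. j < region d}"
    by (intro order.trans[OF card_Un_le] add_mono card_UN_le) simp_all
  finally have "real (card E) \<le> real ((\<Sum>q\<le>m. card (?E q)) + card {d \<in> E. j < region d})"
    by (rule of_nat_mono)
  with small large show ?thesis by simp
qed

lemma card_cut_indices:
  assumes "node_path p"
  defines "D \<equiv> path_length p"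
  shows "real (card (cut_indices j p))
    \<le> 312 * real (min D (height + 1)) / real (spread j D) + real D / 2 ^ j"
proof -
  let ?P = "{i \<in> {1..D}. potential (p ! (i - 1)) div cell_width j (region i) <
      potential (p ! i) div cell_width j (region i)}"
  let ?E = "{d \<in> {1..D}. depth_width j (region d) dvd d}"
  have len: "length p = Suc D" using assms by (simp add: node_path_def path_length_def)
  have "cut_indices j p \<subseteq> ?P \<union> ?E"
  proof
    fix i assume i: "i \<in> cut_indices j p"
    then have "i \<in> {1..D}" "is_cut j (p ! i)" by (auto simp: cut_indices_def D_def)
    moreover have "dep (p ! i) = i"
      using calculation len by (intro node_path_nth[OF assms(1), THEN conjunct2]) auto
    moreover have "par (p ! i) = p ! (i - 1)"
      using calculation(1) len assms(1) by (cases i) (auto simp: node_path_def)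
    ultimately show "i \<in> ?P \<union> ?E" by (auto simp: is_cut_def Let_def)
  qed
  then have "card (cut_indices j p) \<le> card (?P \<union> ?E)" by (intro card_mono) auto
  also have "\<dots> \<le> card ?P + card ?E" by (rule card_Un_le)
  finally have "real (card (cut_indices j p)) \<le> real (card ?P) + real (card ?E)" by linarith
  moreover have "real (card ?P * spread j D) \<le> real (24 * min D (height + 1))"
    unfolding D_def by (intro of_nat_mono potential_cuts assms(1))
  then have "real (card ?P) \<le> 24 * real (min D (height + 1)) / real (spread j D)"
    by (simp add: field_simps spread_def)
  moreover have "312 * real (min D (height + 1)) / real (spread j D) =
      24 * real (min D (height + 1)) / real (spread j D) + 288 * real (min D (height + 1)) / real (spread j D)"
    by (simp add: add_divide_distrib[symmetric])
  ultimately show ?thesis using depth_cuts[of D j] by linarith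
qed

text \<open>A least-significant-digit radix sort: the coarsest scale is sorted last.\<close>

primrec layout_pass :: "nat \<Rightarrow> nat list" where
  "layout_pass 0 = [0..<N]"
| "layout_pass (Suc j) = bucket_sort N (chunk_root j) (layout_pass j)"

text \<open>Sorting the scales 0 to \<open>height\<close> covers \<open>floor_log B\<close> for
  every B up to N. A larger block holds the whole layout.\<close>

definition layout :: "nat list" where
  "layout = layout_pass (Suc height)"

lemma layout_pass_permutes: "distinct (layout_pass j) \<and> set (layout_pass j) = {..<N}"
proof (induction j)
  case (Suc j)
  then show ?case
    using set_bucket_sort[of "layout_pass j" "chunk_root j" N] chunk_root_less
    by (auto simp: distinct_bucket_sort)
qed auto

text \<open>Pass \<open>j\<close> creates the block. By nesting, its nodes share one chunk root at
  every later scale, so the stable passes move it as a whole.\<close>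

lemma chunk_contiguous:
  assumes "r < N" "j < k"
  shows "contiguous (chunk j r) (layout_pass k)"
proof -
  from assms(2) have "Suc j \<le> k" by simp
  then show ?thesis
  proof (induction k rule: dec_induct)
    case base
    have "chunk j r = {v \<in> set (layout_pass j). chunk_root j v = r}"
      using layout_pass_permutes[of j] by (auto simp: chunk_def)
    then show ?case using contiguous_bucket[OF assms(1)] by simp
  next
    case (step k)
    have "chunk_root k v = chunk_root k r" if "v \<in> chunk j r" for v
      using that chunk_root_nested[of j k v] step by (auto simp: chunk_def)
    then show ?case
      using step contiguous_bucket_sort[OF step.IH] chunk_root_less[OF assms(1)] by simp
  qed
qed

lemma length_layout: "length layout = N"
  using layout_pass_permutes[of "Suc height"] distinct_card[of layout] by (simp add: layout_def)

text \<open>A chunk at scale \<open>floor_log B\<close> has at most 4B nodes and thus touches at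
  most 4 + 2 blocks.\<close>

lemma transfers_le_cuts:
  assumes "node_path p" "1 \<le> B" "B \<le> N"
  shows "transfers B layout p \<le> 6 * Suc (card (cut_indices (floor_log B) p))"
proof -
  let ?j = "floor_log B"
  let ?R = "chunk_root ?j ` set p"
  let ?I = "\<lambda>S. {i. i < length layout \<and> layout ! i \<in> S}"
  have j: "?j < Suc height" using assms by (simp add: height_def floor_log_le_iff less_Suc_eq_le)
  have nodes: "v < N" if "v \<in> set p" for v
    using that node_path_nth[OF assms(1)] by (auto simp: in_set_conv_nth)
  have "?I (set p) \<subseteq> (\<Union>r\<in>?R. ?I (chunk ?j r))"
    using nodes by (auto simp: chunk_def)
  then have "(\<lambda>i. i div B) ` ?I (set p) \<subseteq> (\<Union>r\<in>?R. (\<lambda>i. i div B) ` ?I (chunk ?j r))"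
    by blast
  then have "transfers B layout p \<le> card (\<Union>r\<in>?R. (\<lambda>i. i div B) ` ?I (chunk ?j r))"
    unfolding transfers_def by (intro card_mono) auto
  also have "\<dots> \<le> (\<Sum>r\<in>?R. card ((\<lambda>i. i div B) ` ?I (chunk ?j r)))"
    by (intro card_UN_le) simp
  also have "\<dots> \<le> (\<Sum>r\<in>?R. 6)"
  proof (rule sum_mono)
    fix r assume "r \<in> ?R"
    then have r: "r < N" using nodes chunk_root_less by auto
    have "card ((\<lambda>i. i div B) ` ?I (chunk ?j r)) \<le> card (chunk ?j r) div B + 2"
      using chunk_contiguous[OF r j, folded layout_def] layout_pass_permutes[of "Suc height", folded layout_def]
        assms(2) by (intro transfers_contiguous) simp_all
    also have "card (chunk ?j r) \<le> 4 * B"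
      using card_chunk[of ?j r] floor_log_exp2_le[of B] assms by simp
    then have "card (chunk ?j r) div B \<le> (4 * B) div B" by (rule div_le_mono)
    finally show "card ((\<lambda>i. i div B) ` ?I (chunk ?j r)) \<le> 6" using assms by simp
  qed
  also have "\<dots> \<le> 6 * Suc (card (cut_indices ?j p))"
    using chunk_roots_path[OF assms(1), of ?j] by simp
  finally show ?thesis .
qed

theorem transfers_bound:
  assumes "node_path p" "1 \<le> B"
  defines "D \<equiv> path_length p"
  shows "real (transfers B layout p) \<le>
    6 + 1872 * real (min D (height + 1)) / real (spread (floor_log B) D) + 6 * (real D / 2 ^ floor_log B)"
proof (cases "B \<le> N")
  case True
  have "real (transfers B layout p) \<le> real (6 * Suc (card (cut_indices (floor_log B) p)))"
    by (intro of_nat_mono transfers_le_cuts assms True)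
  also have "\<dots> = 6 + 6 * real (card (cut_indices (floor_log B) p))" by simp
  also have "\<dots> \<le> 6 + 6 * (312 * real (min D (height + 1)) / real (spread (floor_log B) D) + real D / 2 ^ floor_log B)"
    unfolding D_def by (intro add_left_mono mult_left_mono card_cut_indices assms) simp
  finally show ?thesis by (simp add: field_simps)
next
  case False
  \<comment> \<open>All positions are below \<open>N < B\<close>, so only block 0 is ever
    read.\<close>
  have "(\<lambda>i. i div B) ` {i. i < length layout \<and> layout ! i \<in> set p} \<subseteq> {0}"
    using False by (auto simp: length_layout)
  then have "transfers B layout p \<le> card {0::nat}"
    unfolding transfers_def by (intro card_mono) auto
  then have "real (transfers B layout p) \<le> 6" by simp
  also have "\<dots> \<le> 6 + 1872 * real (min D (height + 1)) / real (spread (floor_log B) D) + 6 * (real D / 2 ^ floor_log B)"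
    by simp
  finally show ?thesis .
qed

end

subsection \<open>The three depth regimes\<close>

lemma log_le_floor_log:
  assumes "1 \<le> B"
  shows "log 2 (1 + real B) \<le> real (floor_log B) + 1"
proof -
  have "1 + B \<le> 2 ^ (floor_log B + 1)" using floor_log_exp2_gt[of B] by simp
  then have "real (1 + B) \<le> real (2 ^ (floor_log B + 1))" by (rule of_nat_mono)
  then have "1 + real B \<le> 2 powr real (floor_log B + 1)"
    by (simp add: powr_realpow powr_add)
  then have "log 2 (1 + real B) \<le> real (floor_log B + 1)"
    using assms by (simp add: log_le_iff)
  then show ?thesis by simp
qed

lemma Suc_le_power2: "j + 1 \<le> (2::nat) ^ j"
  using less_exp[of j] by (simp add: Suc_le_eq)

lemma log_one_plus_inverse_nonneg: "0 < a \<Longrightarrow> 0 \<le> log 2 (1 + 1 / a)"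
  by (subst zero_le_log_cancel_iff) (simp_all add: add_pos_pos)

context rooted_tree
begin

lemma log_N: "real height \<le> log 2 (real N)" "log 2 (real N) \<le> real height + 1"
proof -
  have N: "0 < N" using rt_less by simp
  have "2 powr real height \<le> real N"
    using of_nat_mono[OF N_ge, where 'a = real] by (simp add: powr_realpow)
  then show "real height \<le> log 2 (real N)" using N by (simp add: le_log_iff)
  have "real N \<le> 2 powr real (height + 1)"
    using of_nat_mono[OF less_imp_le[OF N_less], where 'a = real] by (simp add: powr_realpow powr_add)
  then show "log 2 (real N) \<le> real height + 1" using N by (simp add: log_le_iff add.commute)
qed

lemma height_le_log:
  assumes "2 \<le> N"
  shows "real (height + 1) \<le> 2 * log 2 (real N)"
proof -
  have "1 \<le> log 2 (real N)" using assms by (simp add: le_log_iff)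
  with log_N(1) show ?thesis by simp
qed

lemma spread_pos: "1 \<le> real (spread j D)"
  by (simp add: spread_def)

lemma half_power_bound:
  assumes "1 \<le> B"
  shows "real D / 2 ^ floor_log B \<le> 2 * (real D / real B)"
proof -
  have "B \<le> 2 * 2 ^ floor_log B" using floor_log_exp2_ge[of B] .
  then have "real B \<le> real (2 * 2 ^ floor_log B)" by (rule of_nat_mono)
  then have "real D * real B \<le> real D * (2 * 2 ^ floor_log B)" by (intro mult_left_mono) simp_all
  then show ?thesis using assms by (simp add: field_simps)
qed

text \<open>The end of the path lies in a region bounded by a constant depending on
  \<open>a\<close>, so the spread is still a constant fraction of j + 1, hence of lg (1 + B). The
  term D / 2^j is absorbed because lg (1 + B) is at most 2^j.\<close>

lemma transfers_short:
  assumes "node_path p" "1 \<le> B" "0 < a"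
  defines "D \<equiv> path_length p"
  assumes "real D \<le> a * log 2 (real N)"
  shows "real (transfers B layout p) \<le>
    (12 + 1872 * real (nat \<lceil>a\<rceil> + 1)) * max 1 (real D / log 2 (1 + real B))"
proof -
  define j where "j = floor_log B"
  define l where "l = log 2 (1 + real B)"
  define A where "A = nat \<lceil>a\<rceil>"
  define q where "q = region D"
  have l: "0 < l" "l \<le> real (j + 1)"
    using log_le_floor_log[OF assms(2)] assms(2) by (simp_all add: l_def j_def)
  have "real (D div (height + 1)) \<le> real D / real (height + 1)"
    by (rule of_nat_div_le_of_nat)
  also have "\<dots> \<le> a"
  proof -
    have "real D \<le> a * real (height + 1)"
    proof -
      have "a * log 2 (real N) \<le> a * real (height + 1)"
        using log_N(2) assms(3) by (intro mult_left_mono) simp_all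
      with assms(5) show ?thesis by linarith
    qed
    then show ?thesis by (simp add: pos_divide_le_eq)
  qed
  also have "\<dots> \<le> real A" unfolding A_def by (rule real_nat_ceiling_ge)
  finally have "D div (height + 1) \<le> A" by simp
  moreover have "floor_log x \<le> x" for x
    using floor_log_less_self[of x] by (cases "x = 0") auto
  ultimately have q: "q \<le> A" unfolding q_def region_def using order_trans by blast
  \<comment> \<open>Trades the subtraction of a bounded \<open>q\<close> for a bounded
    factor.\<close>
  have "j + 1 \<le> (q + 1) * (j - q + 1)"
  proof (cases "q \<le> j")
    case True
    then obtain k where "j = q + k" using le_Suc_ex by blast
    then show ?thesis by simp
  qed simp
  also have "\<dots> \<le> (A + 1) * spread j D"
    using q by (intro mult_le_mono) (simp_all add: spread_def q_def)
  finally have "real (j + 1) \<le> real ((A + 1) * spread j D)" by (rule of_nat_mono)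
  then have sp: "l \<le> real (A + 1) * real (spread j D)" using l by (simp only: of_nat_mult)
  have "real (min D (height + 1)) * l \<le> real D * (real (A + 1) * real (spread j D))"
    using sp l by (intro mult_mono) auto
  then have 1: "real (min D (height + 1)) / real (spread j D) \<le> real (A + 1) * (real D / l)"
    using l spread_pos[of j D] by (simp add: field_simps)
  have "l \<le> 2 ^ j"
    using l of_nat_mono[OF Suc_le_power2[of j], where 'a = real] by simp
  then have 2: "real D / 2 ^ j \<le> real D / l" using l by (intro divide_left_mono) simp_all
  have "real (transfers B layout p) \<le>
      6 + 1872 * (real (min D (height + 1)) / real (spread j D)) + 6 * (real D / 2 ^ j)"
    using transfers_bound[OF assms(1,2)] by (simp add: D_def j_def)
  also have "\<dots> \<le> 6 + 1872 * (real (A + 1) * (real D / l)) + 6 * (real D / l)"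
    using 1 2 by (intro add_mono mult_left_mono) simp_all
  also have "\<dots> = 6 + (6 + 1872 * real (A + 1)) * (real D / l)"
    by (simp add: algebra_simps add_divide_distrib)
  also have "\<dots> \<le> 6 * max 1 (real D / l) + (6 + 1872 * real (A + 1)) * max 1 (real D / l)"
    by (intro add_mono mult_left_mono) simp_all
  finally show ?thesis by (simp add: l_def A_def algebra_simps)
qed

text \<open>Let x = B lg N / D and l = lg (1 + x). The proof shows that the spread is at least l /
  C. On shallow paths x is at most B / a, which puts lg (1 + 1 / a) into C; on deeper ones
  \<open>x * 2^q\<close> is at most B, so l exceeds j - q by at most a constant. Finally D / B
  equals lg N / x, which is O(lg N / l).\<close>

lemma transfers_medium:
  assumes "node_path p" "1 \<le> B" "0 < a"
  defines "D \<equiv> path_length p"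
  assumes "a * log 2 (real N) \<le> real D"
  shows "real (transfers B layout p) \<le> (30 + 3744 * (2 + log 2 (1 + 1 / a))) *
    max 1 (log 2 (real N) / log 2 (1 + real B * log 2 (real N) / real D))"
proof (cases "2 \<le> N")
  case False
  \<comment> \<open>With a single node lg N vanishes, and the bound rests on the 1 in the
    maximum.\<close>
  then have "D = 0" using node_path_length[OF assms(1)] by (simp add: D_def)
  then have "real (transfers B layout p) \<le> 6"
    using transfers_bound[OF assms(1,2)] by (simp add: D_def)
  note log_pos = log_one_plus_inverse_nonneg[OF assms(3)]
  note \<open>real (transfers B layout p) \<le> 6\<close>
  also have "6 \<le> (30 + 3744 * (2 + log 2 (1 + 1 / a))) * (1::real)"
    using log_pos by simp
  also have "\<dots> \<le> (30 + 3744 * (2 + log 2 (1 + 1 / a))) *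
    max 1 (log 2 (real N) / log 2 (1 + real B * log 2 (real N) / real D))"
    using log_pos by (intro mult_left_mono) simp_all
  finally show ?thesis .
next
  case True
  define j where "j = floor_log B"
  define n where "n = log 2 (real N)"
  define x where "x = real B * n / real D"
  define l where "l = log 2 (1 + x)"
  define q where "q = region D"
  define C where "C = 2 + log 2 (1 + 1 / a)"
  have n: "1 \<le> n" using True by (simp add: n_def le_log_iff)
  have D: "0 < real D"
    using assms(5) mult_pos_pos[OF assms(3), of n] n by (simp add: n_def)
  have x: "0 < x" using n D assms(2) by (simp add: x_def)
  have l: "0 < l" using x by (simp add: l_def)
  have C: "2 \<le> C" using log_one_plus_inverse_nonneg[OF assms(3)] by (simp add: C_def)
  have B: "real B \<le> 2 ^ (j + 1)"
    using of_nat_mono[OF floor_log_exp2_ge[of B], where 'a = real] by (simp add: j_def)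
  have "l \<le> C * real (spread j D)"
  proof (cases "D < height + 1")
    case True
    then have s: "spread j D = j + 1" by (simp add: spread_def region_def)
    have "a * n * real B \<le> real D * real B" using assms(5) by (intro mult_right_mono) (simp_all add: n_def)
    then have "x \<le> real B * (1 / a)" using assms(3) D by (simp add: x_def field_simps)
    then have "1 + x \<le> (1 + real B) * (1 + 1 / a)" using assms(3) by (simp add: algebra_simps add_increasing)
    then have "l \<le> log 2 ((1 + real B) * (1 + 1 / a))"
      unfolding l_def using x by (intro log_mono) simp_all
    also have "\<dots> = log 2 (1 + real B) + log 2 (1 + 1 / a)"
      using assms(3) by (intro log_mult_pos) (simp_all add: add_pos_pos)
    also have "\<dots> \<le> real (spread j D) + log 2 (1 + 1 / a)"
      using log_le_floor_log[OF assms(2)] s by (simp add: j_def)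
    also have "\<dots> \<le> real (spread j D) + log 2 (1 + 1 / a) * real (spread j D)"
      using mult_left_mono[OF spread_pos[of j D] log_one_plus_inverse_nonneg[OF assms(3)]]
      by simp
    also have "\<dots> \<le> C * real (spread j D)"
      using spread_pos[of j D] by (simp add: C_def algebra_simps)
    finally show ?thesis .
  next
    case False
    then have "0 < D div (height + 1)" by (simp add: div_greater_zero_iff)
    then have "2 ^ q \<le> D div (height + 1)" unfolding q_def region_def by (rule floor_log_exp2_le)
    then have "2 ^ q * (height + 1) \<le> D" by (simp add: less_eq_div_iff_mult_less_eq)
    then have "real (2 ^ q * (height + 1)) \<le> real D" by (rule of_nat_mono)
    then have "2 ^ q * n \<le> real D"
      using mult_left_mono[OF log_N(2), of "2 ^ q"] by (simp add: n_def algebra_simps)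
    then have "2 ^ q * n * real B \<le> real D * real B" by (intro mult_right_mono) simp_all
    then have "x * 2 ^ q \<le> real B" using D by (simp add: x_def field_simps)
    then have x2: "x * 2 ^ q \<le> 2 ^ (j + 1)" using B by linarith
    have "l \<le> 2 * real (spread j D)"
    proof (cases "q \<le> j")
      case True
      then have "(2::real) ^ (j + 1) = 2 ^ (j - q + 1) * 2 ^ q"
        by (simp add: power_add[symmetric])
      with x2 have "x \<le> 2 ^ (j - q + 1)" by simp
      then have "1 + x \<le> 2 ^ (j - q + 2)"
        using one_le_power[of "2::real" "j - q + 1"] by simp
      then have "1 + x \<le> 2 powr real (j - q + 2)" by (simp add: powr_realpow powr_add)
      then have "l \<le> real (j - q + 2)" unfolding l_def using x by (simp add: log_le_iff)
      then show ?thesis by (simp add: spread_def q_def)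
    next
      case False
      then have "(2::real) ^ (j + 1) \<le> 2 ^ q" by (intro power_increasing) simp_all
      with x2 have "x * 2 ^ q \<le> 1 * 2 ^ q" by linarith
      then have "x \<le> 1" by (simp only: mult_le_cancel_right_pos zero_less_power zero_less_numeral)
      then have "l \<le> 1" unfolding l_def using x by (simp add: log_le_iff)
      then show ?thesis using spread_pos[of j D] by simp
    qed
    also have "\<dots> \<le> C * real (spread j D)" using C by (intro mult_right_mono) simp_all
    finally show ?thesis .
  qed
  then have "real (height + 1) * l \<le> 2 * n * (C * real (spread j D))"
    using height_le_log[OF True] l n by (intro mult_mono) (simp_all add: n_def)
  moreover have "real (min D (height + 1)) * l \<le> real (height + 1) * l"
    using l by (intro mult_right_mono) simp_all
  ultimately have "real (min D (height + 1)) * l \<le> 2 * n * (C * real (spread j D))"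
    by linarith
  then have 1: "real (min D (height + 1)) / real (spread j D) \<le> 2 * C * (n / l)"
    using l spread_pos[of j D] by (simp add: field_simps)
  \<comment> \<open>The inequality lg (1 + x) <= 2x, obtained from ln 2 >= 1/2, converts lg N / x
    into 2 lg N / l.\<close>
  have "l = ln (1 + x) / ln 2" by (simp add: l_def log_def)
  also have "\<dots> \<le> x / ln 2"
    using x ln_add_one_self_le_self[of x] by (intro divide_right_mono) simp_all
  also have "\<dots> \<le> x / (1 / 2)"
    using x ln_le_minus_one[of "1 / 2 :: real"] by (intro divide_left_mono) (simp_all add: ln_div)
  finally have "l \<le> 2 * x" by simp
  then have "real D / real B * l \<le> real D / real B * (2 * x)" by (intro mult_left_mono) simp_all
  also have "\<dots> = 2 * n" using D assms(2) by (simp add: x_def)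
  finally have "real D / real B \<le> 2 * (n / l)" using l by (simp add: pos_le_divide_eq)
  then have 2: "real D / 2 ^ j \<le> 4 * (n / l)"
    using half_power_bound[OF assms(2), of D] by (simp add: j_def)
  have "real (transfers B layout p) \<le>
      6 + 1872 * (real (min D (height + 1)) / real (spread j D)) + 6 * (real D / 2 ^ j)"
    using transfers_bound[OF assms(1,2)] by (simp add: D_def j_def)
  also have "\<dots> \<le> 6 + 1872 * (2 * C * (n / l)) + 6 * (4 * (n / l))"
    using 1 2 by (intro add_mono mult_left_mono) simp_all
  also have "\<dots> = 6 + (24 + 3744 * C) * (n / l)"
    by (simp add: algebra_simps add_divide_distrib)
  also have "\<dots> \<le> 6 * max 1 (n / l) + (24 + 3744 * C) * max 1 (n / l)"
    using C by (intro add_mono mult_left_mono) simp_all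
  also have "\<dots> = (30 + 3744 * C) * max 1 (n / l)" by (simp add: algebra_simps)
  finally show ?thesis by (simp only: C_def l_def x_def n_def)
qed

text \<open>In this regime lg N is itself O(D / B), so it suffices that the spread is at least
  1.\<close>

lemma transfers_long:
  assumes "node_path p" "1 \<le> B" "0 < a"
  defines "D \<equiv> path_length p"
  assumes "a * (real B * log 2 (real N)) \<le> real D"
  shows "real (transfers B layout p) \<le> (18 + 3744 / a) * max 1 (real D / real B)"
proof -
  define j where "j = floor_log B"
  have "real (min D (height + 1)) / real (spread j D) \<le> real (min D (height + 1)) / 1"
    by (intro divide_left_mono spread_pos) (simp_all add: spread_def)
  also have "real (min D (height + 1)) \<le> 2 / a * (real D / real B)"
  proof (cases "2 \<le> N")
    case False
    then have "D = 0" using node_path_length[OF assms(1)] by (simp add: D_def)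
    then show ?thesis by simp
  next
    case True
    have "real (min D (height + 1)) \<le> 2 * log 2 (real N)"
      using height_le_log[OF True] by linarith
    also have "\<dots> \<le> 2 / a * (real D / real B)"
      using assms by (simp add: field_simps)
    finally show ?thesis .
  qed
  finally have 1: "real (min D (height + 1)) / real (spread j D) \<le> 2 / a * (real D / real B)" by simp
  have "real (transfers B layout p) \<le>
      6 + 1872 * (real (min D (height + 1)) / real (spread j D)) + 6 * (real D / 2 ^ j)"
    using transfers_bound[OF assms(1,2)] by (simp add: D_def j_def)
  also have "\<dots> \<le> 6 + 1872 * (2 / a * (real D / real B)) + 6 * (2 * (real D / real B))"
    unfolding j_def using 1 half_power_bound[OF assms(2), of D]
    by (intro add_mono mult_left_mono) (simp_all add: j_def)
  also have "\<dots> = 6 + (12 + 3744 / a) * (real D / real B)"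
    by (simp add: algebra_simps add_divide_distrib)
  also have "\<dots> \<le> 6 * max 1 (real D / real B) + (12 + 3744 / a) * max 1 (real D / real B)"
    using assms(3) by (intro add_mono mult_left_mono) simp_all
  also have "\<dots> = (18 + 3744 / a) * max 1 (real D / real B)" by (simp add: algebra_simps)
  finally show ?thesis .
qed

end

subsection \<open>Nodes of a numbered tree\<close>

fun subtree_at :: "nat tree \<Rightarrow> nat \<Rightarrow> nat tree" where
  "subtree_at Leaf v = Leaf"
| "subtree_at (Node l x r) v =
     (if v = x then Node l x r else if v \<in> set_tree l then subtree_at l v else subtree_at r v)"

fun depth_at :: "nat tree \<Rightarrow> nat \<Rightarrow> nat" where
  "depth_at Leaf v = 0"
| "depth_at (Node l x r) v =
     (if v = x then 0 else Suc (if v \<in> set_tree l then depth_at l v else depth_at r v))"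

text \<open>The value at the root is arbitrary.\<close>

fun parent_at :: "nat tree \<Rightarrow> nat \<Rightarrow> nat" where
  "parent_at Leaf v = 0"
| "parent_at (Node l x r) v =
     (let s = if v \<in> set_tree l then l else r in if tree_ptr s = Suc v then x else
       (if v \<in> set_tree l then parent_at l v else parent_at r v))"

abbreviation "left_ptr t v \<equiv> tree_ptr (left (subtree_at t v))"
abbreviation "right_ptr t v \<equiv> tree_ptr (right (subtree_at t v))"

lemma tree_ptr_in: "tree_ptr t = Suc v \<Longrightarrow> v \<in> set_tree t"
  by (cases t) auto

lemma store_tree_outside:
  "v \<notin> set_tree t \<Longrightarrow> store_tree t m (2 * v) = m (2 * v)"
  "v \<notin> set_tree t \<Longrightarrow> store_tree t m (Suc (2 * v)) = m (Suc (2 * v))"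
proof (induction t arbitrary: m)
  case (Node l x r)
  {
    case 1
    have "2 * v \<noteq> Suc (2 * x)" by presburger
    with 1 show ?case using Node.IH by simp
  next
    case 2
    have "Suc (2 * v) \<noteq> 2 * x" by presburger
    with 2 show ?case using Node.IH by simp
  }
qed simp_all

lemma store_tree_children:
  assumes "distinct (inorder t)" "v \<in> set_tree t"
  shows "store_tree t m (2 * v) = left_ptr t v \<and> store_tree t m (Suc (2 * v)) = right_ptr t v"
  using assms
proof (induction t arbitrary: m)
  case (Node l x r)
  have odd: "2 * v \<noteq> Suc (2 * x)" "Suc (2 * v) \<noteq> 2 * x" by presburger+
  have disj: "set_tree l \<inter> set_tree r = {}" "x \<notin> set_tree l" "x \<notin> set_tree r"
    using Node.prems by auto
  consider "v = x" | "v \<in> set_tree l" "v \<noteq> x" "v \<notin> set_tree r"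
    | "v \<in> set_tree r" "v \<noteq> x" "v \<notin> set_tree l"
    using Node.prems disj by auto
  then show ?case
    using Node odd by cases (auto simp: store_tree_outside)
qed simp

lemma depth_at_root: "tree_ptr t = Suc v \<Longrightarrow> depth_at t v = 0"
  by (cases t) auto

lemma parent_at_in:
  assumes "distinct (inorder t)" "v \<in> set_tree t" "tree_ptr t \<noteq> Suc v"
  shows "parent_at t v \<in> set_tree t \<and> depth_at t v = Suc (depth_at t (parent_at t v))"
  using assms
proof (induction t)
  case (Node l x r)
  have disj: "set_tree l \<inter> set_tree r = {}" "x \<notin> set_tree l" "x \<notin> set_tree r"
    using Node.prems by auto
  consider "v \<in> set_tree l" "v \<noteq> x" "v \<notin> set_tree r"
    | "v \<in> set_tree r" "v \<noteq> x" "v \<notin> set_tree l"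
    using Node.prems disj by auto
  then show ?case
  proof cases
    case 1
    show ?thesis
    proof (cases "tree_ptr l = Suc v")
      case False
      have "parent_at l v \<in> set_tree l \<and> depth_at l v = Suc (depth_at l (parent_at l v))"
        using Node False 1 by simp
      moreover have "parent_at l v \<noteq> x" using calculation disj by auto
      ultimately show ?thesis using False 1 by simp
    qed (use 1 depth_at_root in simp)
  next
    case 2
    show ?thesis
    proof (cases "tree_ptr r = Suc v")
      case False
      have "parent_at r v \<in> set_tree r \<and> depth_at r v = Suc (depth_at r (parent_at r v))"
        using Node False 2 by simp
      moreover have "parent_at r v \<noteq> x" "parent_at r v \<notin> set_tree l" using calculation disj by auto
      ultimately show ?thesis using False 2 by simp
    qed (use 2 depth_at_root in simp)
  qed
qed simp

lemma subtree_at_subset: "set_tree (subtree_at t v) \<subseteq> set_tree t"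
  by (induction t) auto

lemma subtree_at_nonempty: "v \<in> set_tree t \<Longrightarrow> subtree_at t v \<noteq> Leaf"
  by (induction t) auto

lemma subtree_at_root: "tree_ptr t = Suc v \<Longrightarrow> subtree_at t v = t"
  by (cases t) auto

lemma left_subset: "set_tree (left t) \<subseteq> set_tree t" by (cases t) auto
lemma right_subset: "set_tree (right t) \<subseteq> set_tree t" by (cases t) auto

lemma left_ptr_in: "left_ptr t u = Suc c \<Longrightarrow> c \<in> set_tree t"
  using tree_ptr_in[of "left (subtree_at t u)" c] left_subset[of "subtree_at t u"] subtree_at_subset[of t u]
  by blast

lemma right_ptr_in: "right_ptr t u = Suc c \<Longrightarrow> c \<in> set_tree t"
  using tree_ptr_in[of "right (subtree_at t u)" c] right_subset[of "subtree_at t u"] subtree_at_subset[of t u]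
  by blast

text \<open>Joins the two views of an edge: the parent function of the combinatorics and the child
  pointers that the machine reads. Disjoint label sets keep the two subtrees apart in the
  induction.\<close>

lemma children_iff:
  assumes "distinct (inorder t)" "u \<in> set_tree t"
  shows "c \<in> set_tree t \<and> tree_ptr t \<noteq> Suc c \<and> parent_at t c = u \<longleftrightarrow>
    left_ptr t u = Suc c \<or> right_ptr t u = Suc c"
  using assms
proof (induction t)
  case (Node l x r)
  have disj: "set_tree l \<inter> set_tree r = {}" "x \<notin> set_tree l" "x \<notin> set_tree r"
    and dist: "distinct (inorder l)" "distinct (inorder r)"
    using Node.prems by auto
  note par = parent_at_in[OF dist(1), of c] parent_at_in[OF dist(2), of c]
  note ptr = tree_ptr_in[of l c] tree_ptr_in[of r c]
  note ptrs = left_ptr_in[of l u c] right_ptr_in[of l u c] left_ptr_in[of r u c] right_ptr_in[of r u c]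
  consider "u = x" | "u \<in> set_tree l" "u \<noteq> x" "u \<notin> set_tree r"
    | "u \<in> set_tree r" "u \<noteq> x" "u \<notin> set_tree l"
    using Node.prems disj by auto
  then show ?case
  proof cases
    case 1
    then show ?thesis using disj par ptr by auto
  next
    case 2
    have "c \<in> set_tree l \<and> tree_ptr l \<noteq> Suc c \<and> parent_at l c = u \<longleftrightarrow>
        left_ptr l u = Suc c \<or> right_ptr l u = Suc c"
      using Node.IH(1) dist 2 by simp
    then show ?thesis using 2 disj par ptr ptrs by auto
  next
    case 3
    have "c \<in> set_tree r \<and> tree_ptr r \<noteq> Suc c \<and> parent_at r c = u \<longleftrightarrow>
        left_ptr r u = Suc c \<or> right_ptr r u = Suc c"
      using Node.IH(2) dist 3 by simp
    then show ?thesis using 3 disj par ptr ptrs by auto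
  qed
qed simp

lemma subtree_at_child:
  assumes "distinct (inorder t)" "u \<in> set_tree t"
  shows "(left_ptr t u = Suc c \<longrightarrow> subtree_at t c = left (subtree_at t u)) \<and>
    (right_ptr t u = Suc c \<longrightarrow> subtree_at t c = right (subtree_at t u)) \<and>
    (left_ptr t u = Suc c \<longrightarrow> right_ptr t u \<noteq> Suc c)"
  using assms
proof (induction t)
  case (Node l x r)
  have disj: "set_tree l \<inter> set_tree r = {}" "x \<notin> set_tree l" "x \<notin> set_tree r"
    and dist: "distinct (inorder l)" "distinct (inorder r)"
    using Node.prems by auto
  note ptr = tree_ptr_in[of l c] tree_ptr_in[of r c] subtree_at_root[of l c] subtree_at_root[of r c]
  note ptrs = left_ptr_in[of l u c] right_ptr_in[of l u c] left_ptr_in[of r u c] right_ptr_in[of r u c]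
  consider "u = x" | "u \<in> set_tree l" "u \<noteq> x" "u \<notin> set_tree r"
    | "u \<in> set_tree r" "u \<noteq> x" "u \<notin> set_tree l"
    using Node.prems disj by auto
  then show ?case
    using Node.IH dist disj ptr ptrs by cases auto
qed simp

lemma root_path_in: "p \<in> root_paths t \<Longrightarrow> p \<noteq> [] \<and> tree_ptr t = Suc (p ! 0) \<and> set p \<subseteq> set_tree t"
proof (induction t arbitrary: p)
  case (Node l x r)
  then show ?case by (cases "p = [x]") fastforce+
qed simp

lemma root_path_parent:
  assumes "distinct (inorder t)" "p \<in> root_paths t" "Suc i < length p"
  shows "tree_ptr t \<noteq> Suc (p ! Suc i) \<and> parent_at t (p ! Suc i) = p ! i"
  using assms
proof (induction t arbitrary: p i)
  case (Node l x r)
  have disj: "set_tree l \<inter> set_tree r = {}" "x \<notin> set_tree l" "x \<notin> set_tree r"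
    and dist: "distinct (inorder l)" "distinct (inorder r)"
    using Node.prems by auto
  from Node.prems obtain q where p: "p = x # q" and q: "q \<in> root_paths l \<or> q \<in> root_paths r"
    by auto
  have i: "i < length q" using Node.prems p by simp
  from q show ?case
  proof
    assume q: "q \<in> root_paths l"
    have mem: "q ! i \<in> set_tree l" using root_path_in[OF q] i nth_mem by blast
    show ?case
    proof (cases i)
      case 0
      then show ?thesis using root_path_in[OF q] mem disj p by auto
    next
      case (Suc k)
      then have "tree_ptr l \<noteq> Suc (q ! i) \<and> parent_at l (q ! i) = q ! k"
        using Node.IH(1)[OF dist(1) q, of k] i by simp
      then show ?thesis using mem disj p Suc by auto
    qed
  next
    assume q: "q \<in> root_paths r"
    have mem: "q ! i \<in> set_tree r" using root_path_in[OF q] i nth_mem by blast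
    show ?case
    proof (cases i)
      case 0
      then show ?thesis using root_path_in[OF q] mem disj p by auto
    next
      case (Suc k)
      then have "tree_ptr r \<noteq> Suc (q ! i) \<and> parent_at r (q ! i) = q ! k"
        using Node.IH(2)[OF dist(2) q, of k] i by simp
      then show ?thesis using mem disj p Suc by auto
    qed
  qed
qed simp

abbreviation subtree_size :: "nat tree \<Rightarrow> nat \<Rightarrow> nat" where
  "subtree_size t v \<equiv> size (subtree_at t v)"

locale numbered_tree =
  fixes t :: "nat tree" and root :: nat
  assumes numbered: "node_numbered t" and root: "tree_ptr t = Suc root"
begin

lemma dist: "distinct (inorder t)" and nodes: "set_tree t = {..<size t}"
  using numbered by (simp_all add: node_numbered_def)

lemma node_iff: "v \<in> set_tree t \<longleftrightarrow> v < size t"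
  using nodes by simp

lemma children_set:
  assumes "u < size t"
  shows "{c. c < size t \<and> c \<noteq> root \<and> parent_at t c = u} = {c. left_ptr t u = Suc c} \<union> {c. right_ptr t u = Suc c}"
proof (rule set_eqI)
  fix c
  have u: "u \<in> set_tree t" using assms node_iff by simp
  have "c < size t \<and> c \<noteq> root \<and> parent_at t c = u \<longleftrightarrow>
      c \<in> set_tree t \<and> tree_ptr t \<noteq> Suc c \<and> parent_at t c = u"
    by (simp add: root node_iff eq_commute[of root c])
  also have "\<dots> \<longleftrightarrow> left_ptr t u = Suc c \<or> right_ptr t u = Suc c"
    by (rule children_iff[OF dist u])
  finally show "c \<in> {c. c < size t \<and> c \<noteq> root \<and> parent_at t c = u} \<longleftrightarrow>
      c \<in> {c. left_ptr t u = Suc c} \<union> {c. right_ptr t u = Suc c}"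
    by simp
qed

lemma children_size:
  assumes "u < size t"
  shows "(\<Sum>c | c < size t \<and> c \<noteq> root \<and> parent_at t c = u. subtree_size t c) + 1 = subtree_size t u"
proof -
  \<comment> \<open>The index set has at most one element and is empty for an absent child, so both
    cases are treated uniformly.\<close>
  have one: "(\<Sum>c | tree_ptr s = Suc c. size s) = size s" "finite {c. tree_ptr s = Suc c}" for s
    by (cases s; simp)+
  have u: "u \<in> set_tree t" using assms node_iff by simp
  have child_l: "subtree_at t c = left (subtree_at t u)" if "left_ptr t u = Suc c" for c
    using subtree_at_child[OF dist u, of c] that by blast
  have child_r: "subtree_at t c = right (subtree_at t u)" if "right_ptr t u = Suc c" for c
    using subtree_at_child[OF dist u, of c] that by blast
  have disj: "{c. left_ptr t u = Suc c} \<inter> {c. right_ptr t u = Suc c} = {}"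
    using subtree_at_child[OF dist u] by blast
  have "(\<Sum>c | c < size t \<and> c \<noteq> root \<and> parent_at t c = u. subtree_size t c) =
    (\<Sum>c | left_ptr t u = Suc c. subtree_size t c) + (\<Sum>c | right_ptr t u = Suc c. subtree_size t c)"
    unfolding children_set[OF assms] by (intro sum.union_disjoint disj one(2))
  also have "(\<Sum>c | left_ptr t u = Suc c. subtree_size t c) = (\<Sum>c | left_ptr t u = Suc c. size (left (subtree_at t u)))"
    by (rule sum.cong[OF refl], drule CollectD, drule child_l, erule arg_cong)
  also have "\<dots> = size (left (subtree_at t u))" by (rule one(1))
  also have "(\<Sum>c | right_ptr t u = Suc c. subtree_size t c) = (\<Sum>c | right_ptr t u = Suc c. size (right (subtree_at t u)))"
    by (rule sum.cong[OF refl], drule CollectD, drule child_r, erule arg_cong)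
  also have "\<dots> = size (right (subtree_at t u))" by (rule one(1))
  finally show ?thesis using subtree_at_nonempty[OF u] by (cases "subtree_at t u") simp_all
qed

sublocale rooted_tree "size t" root "parent_at t" "depth_at t" "subtree_size t"
proof
  show "root < size t" using tree_ptr_in[OF root] node_iff by simp
  show "depth_at t root = 0" by (rule depth_at_root[OF root])
  show "subtree_size t root = size t" by (simp add: subtree_at_root[OF root])
  show "parent_at t v < size t" "depth_at t v = Suc (depth_at t (parent_at t v))"
    if "v < size t" "v \<noteq> root" for v
    using parent_at_in[OF dist, of v] that root node_iff by auto
  show "0 < subtree_size t v" if "v < size t" for v
    using subtree_at_nonempty[of v t] that node_iff by (cases "subtree_at t v") auto
next
  fix u assume u: "u < size t"
  show "(\<Sum>c | c < size t \<and> c \<noteq> root \<and> parent_at t c = u. subtree_size t c) < subtree_size t u"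
    using children_size[OF u] by simp
  have "card {c. tree_ptr s = Suc c} \<le> 1" for s by (cases s) simp_all
  then have "card {c. left_ptr t u = Suc c} + card {c. right_ptr t u = Suc c} \<le> 1 + 1"
    by (intro add_mono)
  then show "card {c. c < size t \<and> c \<noteq> root \<and> parent_at t c = u} \<le> 2"
    unfolding children_set[OF u]
    using card_Un_le[of "{c. left_ptr t u = Suc c}" "{c. right_ptr t u = Suc c}"] by linarith
qed

lemma root_path_node_path:
  assumes "p \<in> root_paths t"
  shows "node_path p"
  unfolding node_path_def
proof (intro conjI allI impI)
  show "p \<noteq> []" "p ! 0 = root" using root_path_in[OF assms] root by auto
next
  fix i assume i: "Suc i < length p"
  have "p ! Suc i \<in> set_tree t" using root_path_in[OF assms] nth_mem[OF i] by blast
  then show "p ! Suc i < size t" using node_iff by simp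
  show "p ! Suc i \<noteq> root" "parent_at t (p ! Suc i) = p ! i"
    using root_path_parent[OF dist assms i] root by auto
qed

end

subsection \<open>A language with arrays on top of the RAM\<close>

text \<open>
  Register 2 holds a stride \<open>M\<close>, and array \<open>a\<close> occupies the cells from \<open>a * M\<close> on. Array 0 has
  twice the length of the others, because it contains the interleaved child pointers of the input;
  there is no array 1. The registers from 40 on are temporaries of the compiler.
\<close>

datatype expr = V reg | C nat | Op arith_op expr expr | Get nat expr

datatype cmd =
    Asg reg expr
  | Put nat expr expr
  | Sq cmd cmd (infixr \<open>;;\<close> 60)
  | Cnd expr expr cmd cmd
  | Nop
  | Whl reg reg cmd

type_synonym mach = "(reg \<Rightarrow> nat) \<times> (nat \<Rightarrow> nat \<Rightarrow> nat)"

fun eval :: "expr \<Rightarrow> mach \<Rightarrow> nat" where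
  "eval (V x) s = fst s x"
| "eval (C n) s = n"
| "eval (Op f a b) s = arith f (eval a s) (eval b s)"
| "eval (Get a e) s = snd s a (eval e s)"

text \<open>Code for an expression touches only registers from \<open>d\<close> on, so the
  temporaries of nested operands form a stack. As the machine has no move instruction, a variable is
  copied by adding it to 0.\<close>

fun compile_expr :: "expr \<Rightarrow> reg \<Rightarrow> ram_prog" where
  "compile_expr (V x) d = Seq (Const d 0) (Arith Add d d x)"
| "compile_expr (C n) d = Const d n"
| "compile_expr (Op f a b) d = Seq (compile_expr a d) (Seq (compile_expr b (Suc d)) (Arith f d d (Suc d)))"
| "compile_expr (Get a e) d = Seq (compile_expr e d) (Seq (Const (Suc d) a)
     (Seq (Arith Mul (Suc d) (Suc d) 2) (Seq (Arith Add d d (Suc d)) (Load d d))))"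

fun time_expr :: "expr \<Rightarrow> nat" where
  "time_expr (V x) = 2"
| "time_expr (C n) = 1"
| "time_expr (Op f a b) = time_expr a + time_expr b + 1"
| "time_expr (Get a e) = time_expr e + 4"

fun compile :: "cmd \<Rightarrow> ram_prog" where
  "compile (Asg x e) = Seq (compile_expr e 40) (Seq (Const 41 0) (Arith Add x 40 41))"
| "compile (Put a e e') = Seq (compile_expr e 40) (Seq (compile_expr e' 41) (Seq (Const 42 a)
     (Seq (Arith Mul 42 42 2) (Seq (Arith Add 40 40 42) (Store 40 41)))))"
| "compile (Sq c c') = Seq (compile c) (compile c')"
| "compile (Cnd e e' c c') = Seq (compile_expr e 40) (Seq (compile_expr e' 41) (IfLess 40 41 (compile c) (compile c')))"
| "compile Nop = Skip"
| "compile (Whl x y c) = WhileLess x y (compile c)"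

text \<open>The value at \<open>Whl\<close> is a dummy. Since \<open>wp\<close> is false there, this
  function bounds loop-free commands only; loops get their time from
  \<open>hoare_while\<close>.\<close>

fun time_cmd :: "cmd \<Rightarrow> nat" where
  "time_cmd (Asg x e) = time_expr e + 2"
| "time_cmd (Put a e e') = time_expr e + time_expr e' + 4"
| "time_cmd (Sq c c') = time_cmd c + time_cmd c'"
| "time_cmd (Cnd e e' c c') = time_expr e + time_expr e' + 1 + max (time_cmd c) (time_cmd c')"
| "time_cmd Nop = 1"
| "time_cmd (Whl x y c) = 0"

text \<open>Array numbers stay below 38 and indices below \<open>2 * M\<close>, so every address is
  below \<open>40 * M\<close> and fits into a word.\<close>

locale ram =
  fixes W M :: nat
  assumes W: "40 * M \<le> W" "0 < M"
begin

definition valid :: "nat \<Rightarrow> nat \<Rightarrow> bool" where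
  "valid a i \<longleftrightarrow> (if a = 0 then i < 2 * M else 2 \<le> a \<and> a < 38 \<and> i < M)"

text \<open>Arrays do not alias, so a \<open>Put\<close> changes one abstract cell only. Array 0
  spans two strides, which is why number 1 is left out.\<close>

lemma valid_inj:
  assumes "valid a i" "valid b k"
  shows "a * M + i = b * M + k \<longleftrightarrow> a = b \<and> i = k"
proof -
  have *: "a' = b' \<and> i' = k'" if "a' * M + i' = b' * M + k'" "i' < M" "k' < M" for a' b' i' k'
  proof -
    have "(a' * M + i') div M = a'" "(b' * M + k') div M = b'" using that(2,3) W by simp_all
    with that(1) have "a' = b'" by metis
    with that(1) show ?thesis by simp
  qed
  have zero: "i = b' * M + k' \<longleftrightarrow> b' = 0 \<and> i = k'" if "i < 2 * M" "2 \<le> b' \<or> b' = 0" for i b' k'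
  proof
    assume "i = b' * M + k'"
    moreover from this have "\<not> 2 \<le> b'" using that(1) mult_le_mono1[of 2 b' M] by linarith
    ultimately show "b' = 0 \<and> i = k'" using that(2) by simp
  qed simp
  show ?thesis
  proof (cases "a = 0 \<or> b = 0")
    case True
    have ab: "2 \<le> a \<or> a = 0" "2 \<le> b \<or> b = 0"
      and small: "a = 0 \<Longrightarrow> i < 2 * M" "b = 0 \<Longrightarrow> k < 2 * M"
      using assms by (auto simp: valid_def)
    from True show ?thesis
    proof
      assume a: "a = 0"
      show ?thesis using zero[OF small(1)[OF a] ab(2)] unfolding a by fastforce
    next
      assume b: "b = 0"
      show ?thesis using zero[OF small(2)[OF b] ab(1)] unfolding b by (metis add_0 mult_0)
    qed
  next
    case False
    with assms have "i < M" "k < M" by (simp_all add: valid_def)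
    then show ?thesis using *[of a i b k] by blast
  qed
qed

lemma valid_addr: "valid a i \<Longrightarrow> a * M + i < W \<and> a * M < W \<and> a < W"
proof -
  assume v: "valid a i"
  then have a: "a \<le> 37" "i < 2 * M" using W by (auto simp: valid_def split: if_splits)
  have "a * M \<le> 37 * M" "a * 1 \<le> a * M" using a W by (auto intro: mult_le_mono)
  then show ?thesis using a W by linarith
qed

text \<open>The word bound is demanded for all registers and cells, temporaries included, so that
  whatever is read can be copied without overflow.\<close>

definition represents :: "mach \<Rightarrow> ram_state \<Rightarrow> bool" where
  "represents s q \<longleftrightarrow> (\<forall>x<40. fst q x = fst s x) \<and> fst q 2 = M \<and>
     (\<forall>a i. valid a i \<longrightarrow> snd q (a * M + i) = snd s a i) \<and>
     (\<forall>x. fst q x < W) \<and> (\<forall>x. snd q x < W)"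

fun ok :: "expr \<Rightarrow> mach \<Rightarrow> bool" where
  "ok (V x) s = (x < 40)"
| "ok (C n) s = (n < W)"
| "ok (Op f a b) s = (ok a s \<and> ok b s \<and> arith f (eval a s) (eval b s) < W)"
| "ok (Get a e) s = (ok e s \<and> valid a (eval e s))"

lemma exec_compile_expr:
  assumes "represents s (r, m)" "ok e s" "40 \<le> d"
  shows "\<exists>r'. exec W (compile_expr e d) (r, m) (time_expr e) (r', m) \<and> r' d = eval e s \<and>
    (\<forall>x<d. r' x = r x) \<and> represents s (r', m)"
  using assms
proof (induction e arbitrary: r d)
  case (V x)
  have W0: "0 < W" using W by linarith
  from V have x: "r x = fst s x" "x \<noteq> d" by (auto simp: represents_def)
  have "exec W (Const d 0) (r, m) 1 (r(d := 0), m)" using W0 by (rule exec.Const)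
  moreover have bnd: "fst s x < W" using V x unfolding represents_def by (metis fst_conv)
  then have "exec W (Arith Add d d x) (r(d := 0), m) 1 (r(d := fst s x), m)"
    using exec.Arith[of Add "r(d := 0)" d x W d m] x by simp
  ultimately have "exec W (compile_expr (V x) d) (r, m) (1 + 1) (r(d := fst s x), m)"
    unfolding compile_expr.simps by (rule exec.Seq)
  then have "exec W (compile_expr (V x) d) (r, m) (time_expr (V x)) (r(d := fst s x), m)"
    by (simp add: numeral_2_eq_2)
  moreover have "represents s (r(d := fst s x), m)"
    using V x bnd by (auto simp: represents_def)
  moreover have "(r(d := fst s x)) d = eval (V x) s" "\<forall>y<d. (r(d := fst s x)) y = r y" by simp_all
  ultimately show ?case by blast
next
  case (C n)
  have "exec W (compile_expr (C n) d) (r, m) (time_expr (C n)) (r(d := n), m)"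
    using exec.Const[of n W d r m] C by simp
  moreover have "represents s (r(d := n), m)"
    using C by (auto simp: represents_def)
  moreover have "(r(d := n)) d = eval (C n) s" "\<forall>y<d. (r(d := n)) y = r y" by simp_all
  ultimately show ?case by blast
next
  case (Op f a b)
  obtain r1 where r1: "exec W (compile_expr a d) (r, m) (time_expr a) (r1, m)" "r1 d = eval a s"
    "\<forall>x<d. r1 x = r x" "represents s (r1, m)"
    using Op.IH(1)[OF Op.prems(1), of d] Op.prems by auto
  obtain r2 where r2: "exec W (compile_expr b (Suc d)) (r1, m) (time_expr b) (r2, m)"
    "r2 (Suc d) = eval b s" "\<forall>x<Suc d. r2 x = r1 x" "represents s (r2, m)"
    using Op.IH(2)[OF r1(4), of "Suc d"] Op.prems by auto
  let ?v = "eval (Op f a b) s"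
  have v: "arith f (r2 d) (r2 (Suc d)) = ?v" using r1 r2 by simp
  have "exec W (Arith f d d (Suc d)) (r2, m) 1 (r2(d := ?v), m)"
    using exec.Arith[of f r2 d "Suc d" W d m] Op.prems v by simp
  then have "exec W (compile_expr (Op f a b) d) (r, m) (time_expr a + (time_expr b + 1)) (r2(d := ?v), m)"
    unfolding compile_expr.simps by (intro exec.Seq[OF r1(1)] exec.Seq[OF r2(1)])
  moreover have "represents s (r2(d := ?v), m)"
    using Op.prems r2(4) by (auto simp: represents_def)
  moreover have "(r2(d := ?v)) d = ?v" "\<forall>y<d. (r2(d := ?v)) y = r y" using r1 r2 by simp_all
  ultimately show ?case
    unfolding time_expr.simps add.assoc by blast
next
  case (Get a e)
  obtain r1 where r1: "exec W (compile_expr e d) (r, m) (time_expr e) (r1, m)" "r1 d = eval e s"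
    "\<forall>x<d. r1 x = r x" "represents s (r1, m)"
    using Get.IH[OF Get.prems(1), of d] Get.prems by auto
  let ?i = "eval e s"
  have v: "valid a ?i" using Get.prems by simp
  note va = valid_addr[OF v]
  have M: "r1 2 = M" using r1(4) by (simp add: represents_def)
  define r2 where "r2 = r1(Suc d := a)"
  define r3 where "r3 = r2(Suc d := a * M)"
  define r4 where "r4 = r3(d := a * M + ?i)"
  define r5 where "r5 = r4(d := snd s a ?i)"
  have "exec W (Const (Suc d) a) (r1, m) 1 (r2, m)"
    unfolding r2_def using va by (intro exec.Const) simp
  moreover have "exec W (Arith Mul (Suc d) (Suc d) 2) (r2, m) 1 (r3, m)"
    using exec.Arith[of Mul r2 "Suc d" 2 W "Suc d" m] va M Get.prems by (simp add: r2_def r3_def)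
  moreover have "exec W (Arith Add d d (Suc d)) (r3, m) 1 (r4, m)"
    using exec.Arith[of Add r3 d "Suc d" W d m] va r1(2) by (simp add: r2_def r3_def r4_def add.commute)
  moreover have "exec W (Load d d) (r4, m) 1 (r5, m)"
    using exec.Load[of W d d r4 m] v r1(4) by (simp add: r4_def r5_def represents_def)
  ultimately have "exec W (compile_expr (Get a e) d) (r, m) (time_expr e + (1 + (1 + (1 + 1)))) (r5, m)"
    unfolding compile_expr.simps by (intro exec.Seq[OF r1(1)]) (blast intro: exec.Seq)
  moreover have "\<forall>y. m y < W" "m (a * M + ?i) = snd s a ?i"
    using v r1(4) by (simp_all add: represents_def)
  then have "snd s a ?i < W" by metis
  then have "represents s (r5, m)"
    using Get.prems r1(4) va by (auto simp: represents_def r2_def r3_def r4_def r5_def)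
  moreover have "r5 d = eval (Get a e) s" "\<forall>y<d. r5 y = r y"
    using r1 by (simp_all add: r2_def r3_def r4_def r5_def)
  ultimately show ?case by (auto simp: numeral_eq_Suc)
qed

text \<open>Total correctness within a time budget: as an execution is claimed to exist, termination
  and absence of overflow are part of the meaning.\<close>

definition hoare :: "cmd \<Rightarrow> mach \<Rightarrow> nat \<Rightarrow> (mach \<Rightarrow> bool) \<Rightarrow> bool" where
  "hoare c s n Q \<longleftrightarrow> (\<forall>q. represents s q \<longrightarrow>
     (\<exists>n' q' s'. exec W (compile c) q n' q' \<and> n' \<le> n \<and> represents s' q' \<and> Q s'))"

lemma hoare_conseq:
  assumes "hoare c s n Q" "n \<le> n'" "\<And>s'. Q s' \<Longrightarrow> Q' s'"
  shows "hoare c s n' Q'"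
  unfolding hoare_def
proof (intro allI impI)
  fix q assume "represents s q"
  then obtain k q' s' where "exec W (compile c) q k q'" "k \<le> n" "represents s' q'" "Q s'"
    using assms(1) unfolding hoare_def by blast
  moreover have "k \<le> n'" using calculation(2) assms(2) by simp
  ultimately show "\<exists>k q' s'. exec W (compile c) q k q' \<and> k \<le> n' \<and> represents s' q' \<and> Q' s'"
    using assms(3) by blast
qed

lemma hoare_seq:
  assumes "hoare c s n P" "\<And>s'. P s' \<Longrightarrow> hoare c' s' n' Q"
  shows "hoare (c ;; c') s (n + n') Q"
  unfolding hoare_def
proof (intro allI impI)
  fix q assume "represents s q"
  then obtain n1 q1 s1 where 1: "exec W (compile c) q n1 q1" "n1 \<le> n" "represents s1 q1" "P s1"
    using assms(1) unfolding hoare_def by blast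
  then obtain n2 q2 s2 where 2: "exec W (compile c') q1 n2 q2" "n2 \<le> n'" "represents s2 q2" "Q s2"
    using assms(2) unfolding hoare_def by blast
  have "exec W (compile (c ;; c')) q (n1 + n2) q2" using 1 2 by (auto intro: exec.Seq)
  then show "\<exists>n'' q' s'. exec W (compile (c ;; c')) q n'' q' \<and> n'' \<le> n + n' \<and> represents s' q' \<and> Q s'"
    using 1 2 by (metis add_mono)
qed

text \<open>Preconditions of loop-free code; overflow and array bounds enter through
  \<open>ok\<close> and \<open>valid\<close>. Register 2 is protected since it holds the
  stride.\<close>

fun wp :: "cmd \<Rightarrow> mach \<Rightarrow> (mach \<Rightarrow> bool) \<Rightarrow> bool" where
  "wp (Asg x e) s Q = (x < 40 \<and> x \<noteq> 2 \<and> ok e s \<and> Q ((fst s)(x := eval e s), snd s))"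
| "wp (Put a e e') s Q = (ok e s \<and> ok e' s \<and> valid a (eval e s) \<and>
     Q (fst s, (snd s)(a := (snd s a)(eval e s := eval e' s))))"
| "wp (Sq c c') s Q = wp c s (\<lambda>s'. wp c' s' Q)"
| "wp (Cnd e e' c c') s Q = (ok e s \<and> ok e' s \<and>
     (if eval e s < eval e' s then wp c s Q else wp c' s Q))"
| "wp Nop s Q = Q s"
| "wp (Whl x y c) s Q = False"

lemma hoare_Asg: "wp (Asg x e) s Q \<Longrightarrow> hoare (Asg x e) s (time_cmd (Asg x e)) Q"
  unfolding hoare_def
proof (intro allI impI)
  fix q assume wp: "wp (Asg x e) s Q" and rep: "represents s q"
  obtain r m where q: "q = (r, m)" by (cases q)
  obtain r1 where r1: "exec W (compile_expr e 40) (r, m) (time_expr e) (r1, m)" "r1 40 = eval e s"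
    "represents s (r1, m)"
    using exec_compile_expr[of s r m e 40] wp rep q by auto
  define r2 where "r2 = r1(41 := 0)"
  define r3 where "r3 = r2(x := eval e s)"
  have bnd: "eval e s < W" using r1 unfolding represents_def by (metis fst_conv)
  have "exec W (Const 41 0) (r1, m) 1 (r2, m)" unfolding r2_def using W by (intro exec.Const) linarith
  moreover have "exec W (Arith Add x 40 41) (r2, m) 1 (r3, m)"
    using exec.Arith[of Add r2 40 41 W x m] r1(2) bnd by (simp add: r2_def r3_def)
  ultimately have "exec W (compile (Asg x e)) q (time_expr e + (1 + 1)) (r3, m)"
    unfolding compile.simps q by (intro exec.Seq[OF r1(1)]) (blast intro: exec.Seq)
  moreover have "represents ((fst s)(x := eval e s), snd s) (r3, m)"
    using wp r1(3) bnd by (auto simp: represents_def r2_def r3_def)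
  ultimately show "\<exists>n' q' s'. exec W (compile (Asg x e)) q n' q' \<and> n' \<le> time_cmd (Asg x e) \<and> represents s' q' \<and> Q s'"
    using wp by (intro exI[of _ "time_expr e + (1 + 1)"] exI[of _ "(r3, m)"]
      exI[of _ "((fst s)(x := eval e s), snd s)"]) simp
qed

lemma hoare_Put: "wp (Put a e e') s Q \<Longrightarrow> hoare (Put a e e') s (time_cmd (Put a e e')) Q"
  unfolding hoare_def
proof (intro allI impI)
  fix q assume wp: "wp (Put a e e') s Q" and rep: "represents s q"
  obtain r m where q: "q = (r, m)" by (cases q)
  let ?i = "eval e s" and ?v = "eval e' s"
  obtain r1 where r1: "exec W (compile_expr e 40) (r, m) (time_expr e) (r1, m)" "r1 40 = ?i"
    "represents s (r1, m)"
    using exec_compile_expr[of s r m e 40] wp rep q by auto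
  obtain r2 where r2: "exec W (compile_expr e' 41) (r1, m) (time_expr e') (r2, m)" "r2 41 = ?v"
    "\<forall>x<41. r2 x = r1 x" "represents s (r2, m)"
    using exec_compile_expr[OF r1(3), of e' 41] wp by auto
  have r40: "r2 40 = ?i" using r2(3) r1(2) by simp
  have v: "valid a ?i" using wp by simp
  note va = valid_addr[OF v]
  have M: "r2 2 = M" using r2(4) by (simp add: represents_def)
  define r3 where "r3 = r2(42 := a)"
  define r4 where "r4 = r3(42 := a * M)"
  define r5 where "r5 = r4(40 := a * M + ?i)"
  let ?m = "m(a * M + ?i := ?v)"
  have bnd: "?v < W" using r2 unfolding represents_def by (metis fst_conv)
  have "exec W (Const 42 a) (r2, m) 1 (r3, m)"
    unfolding r3_def using va by (intro exec.Const) simp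
  moreover have "exec W (Arith Mul 42 42 2) (r3, m) 1 (r4, m)"
    using exec.Arith[of Mul r3 42 2 W 42 m] va M by (simp add: r3_def r4_def)
  moreover have "exec W (Arith Add 40 40 42) (r4, m) 1 (r5, m)"
    using exec.Arith[of Add r4 40 42 W 40 m] va r40 by (simp add: r3_def r4_def r5_def add.commute)
  moreover have "exec W (Store 40 41) (r5, m) 1 (r5, ?m)"
    using exec.Store[of W 40 41 r5 m] r2(2) by (simp add: r3_def r4_def r5_def)
  ultimately have "exec W (compile (Put a e e')) q (time_expr e + (time_expr e' + (1 + (1 + (1 + 1))))) (r5, ?m)"
    unfolding compile.simps q by (intro exec.Seq[OF r1(1)] exec.Seq[OF r2(1)]) (blast intro: exec.Seq)
  moreover have "represents (fst s, (snd s)(a := (snd s a)(?i := ?v))) (r5, ?m)"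
    unfolding represents_def
  proof (intro conjI allI impI)
    fix b k assume vb: "valid b k"
    show "snd (r5, ?m) (b * M + k) = snd (fst s, (snd s)(a := (snd s a)(?i := ?v))) b k"
      using valid_inj[OF vb v] r2(4) vb by (auto simp: represents_def)
  qed (use r2(4) va bnd in \<open>auto simp: represents_def r3_def r4_def r5_def\<close>)
  ultimately show "\<exists>n' q' s'. exec W (compile (Put a e e')) q n' q' \<and> n' \<le> time_cmd (Put a e e') \<and> represents s' q' \<and> Q s'"
    using wp by (intro exI[of _ "time_expr e + (time_expr e' + (1 + (1 + (1 + 1))))"] exI[of _ "(r5, ?m)"]
      exI[of _ "(fst s, (snd s)(a := (snd s a)(?i := ?v)))"]) simp
qed

lemma hoare_Cnd:
  assumes "ok e s" "ok e' s"
    "eval e s < eval e' s \<Longrightarrow> hoare c s n Q" "\<not> eval e s < eval e' s \<Longrightarrow> hoare c' s n' Q"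
  shows "hoare (Cnd e e' c c') s (time_expr e + time_expr e' + 1 + max n n') Q"
  unfolding hoare_def
proof (intro allI impI)
  fix q assume rep: "represents s q"
  obtain r m where q: "q = (r, m)" by (cases q)
  let ?i = "eval e s" and ?v = "eval e' s"
  obtain r1 where r1: "exec W (compile_expr e 40) (r, m) (time_expr e) (r1, m)" "r1 40 = ?i"
    "represents s (r1, m)"
    using exec_compile_expr[of s r m e 40] assms rep q by auto
  obtain r2 where r2: "exec W (compile_expr e' 41) (r1, m) (time_expr e') (r2, m)" "r2 41 = ?v"
    "\<forall>x<41. r2 x = r1 x" "represents s (r2, m)"
    using exec_compile_expr[OF r1(3), of e' 41] assms by auto
  have r40: "r2 40 = ?i" using r2(3) r1(2) by simp
  have "\<exists>k q' s'. exec W (IfLess 40 41 (compile c) (compile c')) (r2, m) (1 + k) q' \<and> k \<le> max n n' \<and>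
      represents s' q' \<and> Q s'"
  proof (cases "?i < ?v")
    case True
    then obtain k q' s' where "exec W (compile c) (r2, m) k q'" "k \<le> n" "represents s' q'" "Q s'"
      using assms(3) r2(4) unfolding hoare_def by blast
    moreover have "r2 40 < r2 41" using True r40 r2(2) by simp
    ultimately show ?thesis by (blast intro: exec.IfTrue max.coboundedI1)
  next
    case False
    then obtain k q' s' where "exec W (compile c') (r2, m) k q'" "k \<le> n'" "represents s' q'" "Q s'"
      using assms(4) r2(4) unfolding hoare_def by blast
    moreover have "\<not> r2 40 < r2 41" using False r40 r2(2) by simp
    ultimately show ?thesis by (blast intro: exec.IfFalse max.coboundedI2)
  qed
  then obtain k q' s' where k: "exec W (IfLess 40 41 (compile c) (compile c')) (r2, m) (1 + k) q'"
    "k \<le> max n n'" "represents s' q'" "Q s'" by blast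
  have "exec W (compile (Cnd e e' c c')) q (time_expr e + (time_expr e' + (1 + k))) q'"
    unfolding compile.simps q by (intro exec.Seq[OF r1(1)] exec.Seq[OF r2(1)] k(1))
  then show "\<exists>k q' s'. exec W (compile (Cnd e e' c c')) q k q' \<and>
      k \<le> time_expr e + time_expr e' + 1 + max n n' \<and> represents s' q' \<and> Q s'"
    using k by (intro exI[of _ "time_expr e + (time_expr e' + (1 + k))"] exI[of _ q'] exI[of _ s']) simp
qed

text \<open>Reduces the verification of loop bodies to symbolic evaluation by the
  simplifier.\<close>

lemma hoare_wp: "wp c s Q \<Longrightarrow> hoare c s (time_cmd c) Q"
proof (induction c arbitrary: s Q)
  case (Asg x e)
  then show ?case by (rule hoare_Asg)
next
  case (Put a e e')
  then show ?case by (rule hoare_Put)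
next
  case (Sq c c')
  have "hoare c s (time_cmd c) (\<lambda>s'. wp c' s' Q)" using Sq by simp
  then show ?case using hoare_seq[OF _ Sq.IH(2)] by simp
next
  case (Cnd e e' c c')
  then show ?case
    unfolding time_cmd.simps by (intro hoare_Cnd) (auto split: if_splits)
next
  case Nop
  then show ?case
    unfolding hoare_def compile.simps time_cmd.simps wp.simps using exec.Skip by blast
qed simp

text \<open>The invariant carries the number of completed iterations, which the guard keeps below
  \<open>K\<close>. Each iteration pays its body and one test; the last 1 is the failing test.
  Inside, \<open>d\<close> is the supply of remaining iterations.\<close>

lemma hoare_while:
  assumes "I 0 s"
    and step: "\<And>k s. I k s \<Longrightarrow> fst s x < fst s y \<Longrightarrow> k < K \<and> hoare c s b (I (Suc k))"
    and exit: "\<And>k s. I k s \<Longrightarrow> \<not> fst s x < fst s y \<Longrightarrow> Q s"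
    and xy: "x < 40" "y < 40"
  shows "hoare (Whl x y c) s (K * (b + 1) + 1) Q"
proof -
  have "\<exists>n' q' s'. exec W (compile (Whl x y c)) q n' q' \<and> n' \<le> d * (b + 1) + 1 \<and> represents s' q' \<and> Q s'"
    if "I k s" "represents s q" "K \<le> k + d" for d k s q
    using that
  proof (induction d arbitrary: k s q)
    case 0
    have "\<not> fst s x < fst s y" using step[OF 0(1)] 0(3) by auto
    moreover obtain r m where q: "q = (r, m)" by (cases q)
    ultimately have "\<not> r x < r y" using 0 xy by (simp add: represents_def)
    then have "exec W (compile (Whl x y c)) q 1 q" unfolding q compile.simps by (rule exec.WhileFalse)
    then show ?case using exit[OF 0(1) \<open>\<not> fst s x < fst s y\<close>] 0 by fastforce
  next
    case (Suc d)
    obtain r m where q: "q = (r, m)" by (cases q)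
    show ?case
    proof (cases "fst s x < fst s y")
      case False
      then have "\<not> r x < r y" using Suc.prems xy q by (simp add: represents_def)
      then have "exec W (compile (Whl x y c)) q 1 q" unfolding q compile.simps by (rule exec.WhileFalse)
      then show ?thesis using exit[OF Suc.prems(1) False] Suc.prems by fastforce
    next
      case True
      then have less: "r x < r y" using Suc.prems xy q by (simp add: represents_def)
      obtain n1 q1 s1 where 1: "exec W (compile c) q n1 q1" "n1 \<le> b" "represents s1 q1" "I (Suc k) s1"
        using step[OF Suc.prems(1) True] Suc.prems unfolding hoare_def by blast
      obtain n2 q2 s2 where 2: "exec W (compile (Whl x y c)) q1 n2 q2" "n2 \<le> d * (b + 1) + 1"
        "represents s2 q2" "Q s2"
        using Suc.IH[OF 1(4,3)] Suc.prems by auto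
      have "exec W (compile (Whl x y c)) q (1 + n1 + n2) q2"
        using 1(1) 2(1) unfolding q compile.simps by (intro exec.WhileTrue[where r = r and m = m, OF less])
      moreover have "1 + n1 + n2 \<le> Suc d * (b + 1) + 1" using 1(2) 2(2) by simp
      ultimately show ?thesis using 2 by blast
    qed
  qed
  from this[OF assms(1), of _ K] show ?thesis unfolding hoare_def by simp
qed

lemma hoare_for:
  assumes "I 0 s"
    and "\<And>k s. I k s \<Longrightarrow> k \<le> K \<and> (fst s x < fst s y \<longleftrightarrow> k < K)"
    and "\<And>k s. I k s \<Longrightarrow> k < K \<Longrightarrow> wp c s (I (Suc k))"
    and "x < 40" "y < 40"
  shows "hoare (Whl x y c) s (K * (time_cmd c + 1) + 1) (I K)"
proof (rule hoare_while[where I = I])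
  show "k < K \<and> hoare c s (time_cmd c) (I (Suc k))" if "I k s" "fst s x < fst s y" for k s
    using that assms(2,3) hoare_wp by blast
  show "I K s" if "I k s" "\<not> fst s x < fst s y" for k s
    using that assms(2)[OF that(1)] by (cases "k = K") auto
qed (use assms in auto)

end

subsection \<open>The preprocessing program\<close>

text \<open>
  Registers: 0 number of nodes, 3 loop counter, 4 end of the queue, 7 height, 8 scale.
  Arrays: 2 breadth-first order, 3 parents, 4 depths, 5 subtree sizes, 6 binary logarithms,
  7 powers of two, 8 potentials, 9 regions, 10 chunk roots, 11 current layout, 12 next layout,
  13 counters of the counting sort.
\<close>

abbreviation "inc x \<equiv> Asg x (Op Add (V x) (C 1))"

text \<open>Register 5 holds the node being expanded. Register 6 first holds the raw pointer, with 0
  for null, and then the node itself.\<close>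

definition visit :: "expr \<Rightarrow> cmd" where
  "visit e = Asg 6 e ;; Cnd (C 0) (V 6)
     (Asg 6 (Op Sub (V 6) (C 1)) ;; Put 2 (V 4) (V 6) ;; Put 3 (V 6) (V 5) ;;
      Put 4 (V 6) (Op Add (Get 4 (V 5)) (C 1)) ;; inc 4) Nop"

definition bfs_body :: cmd where
  "bfs_body = Asg 5 (Get 2 (V 3)) ;; visit (Get 0 (Op Add (V 5) (V 5))) ;;
     visit (Get 0 (Op Add (Op Add (V 5) (V 5)) (C 1))) ;; inc 3"

definition bfs :: cmd where
  "bfs = (Put 2 (C 0) (Op Sub (V 1) (C 1)) ;; Asg 4 (C 1) ;; Asg 3 (C 0)) ;; Whl 3 4 bfs_body"

text \<open>Runs backwards through the breadth-first order, so that a node is complete when its size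
  is added to its parent. The conditional spares the root, at queue position 0.\<close>

definition sizes_body :: cmd where
  "sizes_body = Asg 3 (Op Sub (V 3) (C 1)) ;; Asg 5 (Get 2 (V 3)) ;;
     Put 5 (V 5) (Op Add (Get 5 (V 5)) (C 1)) ;;
     Cnd (C 0) (V 3) (Asg 14 (Get 3 (V 5)) ;; Put 5 (V 14) (Op Add (Get 5 (V 14)) (Get 5 (V 5)))) Nop"

definition sizes :: cmd where
  "sizes = (Asg 13 (C 0) ;; Asg 3 (V 0)) ;; Whl 13 3 sizes_body"

text \<open>Halving: lg n is one more than lg (n div 2). The loop starts at 2 because the zeroed
  memory is already right for 0 and 1.\<close>

definition logs_body :: cmd where
  "logs_body = Put 6 (V 3) (Op Add (Get 6 (Op Div (V 3) (C 2))) (C 1)) ;; inc 3"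

definition logs :: cmd where
  "logs = (Asg 3 (C 2) ;; Asg 9 (Op Add (V 0) (C 1))) ;; Whl 3 9 logs_body ;; Asg 7 (Get 6 (V 0))"

definition powers_body :: cmd where
  "powers_body = Put 7 (Op Add (V 3) (C 1)) (Op Add (Get 7 (V 3)) (Get 7 (V 3))) ;; inc 3"

definition powers :: cmd where
  "powers = (Put 7 (C 0) (C 1) ;; Asg 3 (C 0) ;; Asg 9 (Op Add (V 7) (C 2))) ;; Whl 3 9 powers_body"

definition potentials_body :: cmd where
  "potentials_body = Asg 5 (Get 4 (V 3)) ;; Asg 10 (Get 6 (Op Div (V 5) (Op Add (V 7) (C 1)))) ;;
     Put 9 (V 3) (V 10) ;;
     Cnd (V 7) (V 5)
       (Put 8 (V 3) (Op Add (Op Sub (Op Add (Op Add (V 7) (V 7)) (C 1)) (Get 6 (Get 5 (V 3)))) (V 10)))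
       (Put 8 (V 3) (V 5)) ;;
     Put 11 (V 3) (V 3) ;; inc 3"

definition potentials :: cmd where
  "potentials = Asg 3 (C 0) ;; Whl 3 0 potentials_body"

text \<open>Stride N + 2 leaves room for tables indexed up to N + 1. The factor 256 gives slack for
  all intermediate values, which stay below a small multiple of N plus a constant.\<close>

locale layout_program = numbered_tree t root + ram W M
  for t root W M +
  assumes M_eq: "M = size t + 2" and W_big: "256 * M \<le> W"
begin

abbreviation "N \<equiv> size t"

lemma N_pos: "0 < N" using rt_less by simp

lemma less_W: "n \<le> 256 * N + 511 \<Longrightarrow> n < W"
  using W_big M_eq by linarith

lemma less_M: "n \<le> N + 1 \<Longrightarrow> n < M"
  using M_eq by linarith

lemma less_W_simps [simp]: "0 < W" "Suc 0 < W" "2 < W"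
  by (simp_all add: less_W)

lemma valid_0 [simp]: "valid 0 i \<longleftrightarrow> i < 2 * M" by (simp add: valid_def)
lemma valid_other [simp]: "2 \<le> a \<Longrightarrow> a < 38 \<Longrightarrow> valid a i \<longleftrightarrow> i < M" by (simp add: valid_def)

text \<open>The property of the breadth-first order on which the later passes rely: forwards,
  parents come before their children; backwards, children come first.\<close>

definition parents_first :: "nat list \<Rightarrow> bool" where
  "parents_first qs \<longleftrightarrow> (\<forall>i<length qs. qs ! i \<noteq> root \<longrightarrow> (\<exists>k<i. qs ! k = parent_at t (qs ! i)))"

section \<open>Breadth-first search\<close>

definition stage0 :: "mach \<Rightarrow> bool" where
  "stage0 s \<longleftrightarrow> fst s 0 = N \<and> fst s 1 = Suc root \<and>
     (\<forall>v<N. snd s 0 (2 * v) = left_ptr t v \<and> snd s 0 (Suc (2 * v)) = right_ptr t v) \<and>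
     (\<forall>a\<ge>2. snd s a = (\<lambda>_. 0))"

definition queue :: "nat list \<Rightarrow> mach \<Rightarrow> bool" where
  "queue qs s \<longleftrightarrow> distinct qs \<and> set qs \<subseteq> {..<N} \<and> parents_first qs \<and>
     fst s 0 = N \<and> fst s 4 = length qs \<and> (\<forall>i<length qs. snd s 2 i = qs ! i) \<and>
     (\<forall>v\<in>set qs. snd s 4 v = depth_at t v \<and> (v \<noteq> root \<longrightarrow> snd s 3 v = parent_at t v)) \<and>
     (\<forall>v<N. snd s 0 (2 * v) = left_ptr t v \<and> snd s 0 (Suc (2 * v)) = right_ptr t v) \<and>
     (\<forall>a\<ge>5. snd s a = (\<lambda>_. 0))"

lemma length_less:
  assumes "distinct qs" "set qs \<subseteq> {..<N}" "c < N" "c \<notin> set qs"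
  shows "length qs < N"
proof -
  have "card (insert c (set qs)) \<le> card {..<N}" using assms by (intro card_mono) auto
  then show ?thesis using assms distinct_card[of qs] by simp
qed

definition push :: "nat \<Rightarrow> nat list \<Rightarrow> nat list" where
  "push p qs = (if p = 0 then qs else qs @ [p - 1])"

text \<open>The postcondition \<open>Q\<close> is an arbitrary continuation, so the visits to both
  children can be chained inside one \<open>wp\<close>.\<close>

lemma visit_correct:
  assumes q: "queue qs s" and v: "fst s 5 \<in> set qs" "eval e s = p" "ok e s"
    and c: "\<And>c. p = Suc c \<Longrightarrow> c < N \<and> c \<noteq> root \<and> c \<notin> set qs \<and> parent_at t c = fst s 5"
    and Q: "\<And>s'. queue (push p qs) s' \<Longrightarrow> fst s' 3 = fst s 3 \<Longrightarrow> fst s' 5 = fst s 5 \<Longrightarrow> Q s'"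
  shows "wp (visit e) s Q"
proof (cases p)
  case 0
  have "queue (push p qs) ((fst s)(6 := 0), snd s)"
    using q 0 by (simp add: queue_def push_def)
  then show ?thesis using v 0 Q by (simp add: visit_def)
next
  case (Suc c)
  note c = c[OF Suc]
  have len: "length qs < N" using length_less[of qs c] q c by (auto simp: queue_def)
  have v5: "fst s 5 < N" "snd s 4 (fst s 5) = depth_at t (fst s 5)" using q v(1) by (auto simp: queue_def)
  have dep: "depth_at t c = Suc (depth_at t (fst s 5))" "depth_at t c < N"
    using dep_par[of c] dep_less[of c] c by auto
  let ?s' = "((fst s)(6 := c, 4 := Suc (length qs)),
    (snd s)(2 := (snd s 2)(length qs := c), 3 := (snd s 3)(c := fst s 5), 4 := (snd s 4)(c := depth_at t c)))"
  have pf: "parents_first (qs @ [c])"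
    using q v(1) c unfolding queue_def parents_first_def
    by (auto simp: nth_append less_Suc_eq in_set_conv_nth) (metis less_trans)
  have "queue (push p qs) ?s'"
    using q c Suc pf unfolding queue_def push_def
    by (auto simp: nth_append less_Suc_eq)
  then have "Q ?s'" by (rule Q) simp_all
  moreover have "(4::nat) < W" "Suc N < W" "N < M" using W_big M_eq N_pos by linarith+
  ultimately show ?thesis
    using v Suc c len v5 dep q by (simp add: visit_def queue_def fun_upd_twist)
qed

text \<open>An equation for the set of queued nodes replaces any account of levels. When all entries
  have been expanded, it says that the queue is closed under taking children.\<close>

definition bfs_inv :: "nat \<Rightarrow> mach \<Rightarrow> bool" where
  "bfs_inv k s \<longleftrightarrow> (\<exists>qs. queue qs s \<and> fst s 3 = k \<and> k \<le> length qs \<and> 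
     set qs = insert root {v. v < N \<and> v \<noteq> root \<and> parent_at t v \<in> set (take k qs)})"

definition stage1 :: "nat list \<Rightarrow> mach \<Rightarrow> bool" where
  "stage1 qs s \<longleftrightarrow> queue qs s \<and> set qs = {..<N}"

lemma queue_length: "queue qs s \<Longrightarrow> length qs \<le> N"
  using card_mono[of "{..<N}" "set qs"] distinct_card[of qs] by (simp add: queue_def)

lemma bfs_step:
  assumes inv: "bfs_inv k s" and less: "fst s 3 < fst s 4"
  shows "wp bfs_body s (bfs_inv (Suc k))"
proof -
  from inv obtain qs where q: "queue qs s" and k: "fst s 3 = k"
    and set: "set qs = insert root {v. v < N \<and> v \<noteq> root \<and> parent_at t v \<in> set (take k qs)}"
    unfolding bfs_inv_def by blast
  have kl: "k < length qs" using less q k by (simp add: queue_def)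
  define u where "u = qs ! k"
  have u: "u \<in> set qs" using kl unfolding u_def by (rule nth_mem)
  then have "u < N" using q by (auto simp: queue_def)
  note u = u this
  have dist: "distinct qs" using q by (simp add: queue_def)
  have unot: "u \<notin> set (take k qs)"
    using distinct_take[OF dist, of "Suc k"] kl by (simp add: take_Suc_conv_app_nth u_def)
  have child: "c < N \<and> c \<noteq> root \<and> parent_at t c = u \<and> c \<notin> set qs"
    if "left_ptr t u = Suc c \<or> right_ptr t u = Suc c" for c
  proof -
    have "c < N \<and> c \<noteq> root \<and> parent_at t c = u" using children_set[OF u(2)] that by blast
    then show ?thesis using set unot by auto
  qed
  have neq: "right_ptr t u \<noteq> Suc c" if "left_ptr t u = Suc c" for c
    using subtree_at_child[OF numbered_tree.dist[OF numbered_tree_axioms], of u c] u node_iff that by blast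
  let ?s1 = "((fst s)(5 := u), snd s)"
  have q1: "queue qs ?s1" using q by (simp add: queue_def)
  have W': "2 * N + 4 \<le> 2 * M" "2 * M < W" using W_big M_eq N_pos by linarith+
  have get: "snd s 2 k = u" using q kl by (simp add: queue_def u_def)
  let ?post = "(\<lambda>s'. (3::nat) < 40 \<and> (3::nat) \<noteq> 2 \<and> ok (Op Add (V 3) (C 1)) s' \<and>
           bfs_inv (Suc k) ((fst s')(3 := eval (Op Add (V 3) (C 1)) s'), snd s'))"
  have fetch: "eval (Get 2 (V 3)) s = u" using get k by simp
  show ?thesis
    unfolding bfs_body_def wp.simps fetch
  proof (intro conjI)
    show "ok (Get 2 (V 3)) s" using queue_length[OF q] kl k by (simp add: less_M)
    show "wp (visit (Get 0 (Op Add (V 5) (V 5)))) ?s1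
       (\<lambda>s'. wp (visit (Get 0 (Op Add (Op Add (V 5) (V 5)) (C 1)))) s'
         ?post)"
    proof (rule visit_correct[where qs = qs and p = "left_ptr t u"])
      show "queue qs ?s1" using q1 get k by simp
    next
      show "fst ?s1 5 \<in> set qs" using get k u by simp
    next
      show "eval (Get 0 (Op Add (V 5) (V 5))) ?s1 = left_ptr t u"
        using get k q u by (simp add: queue_def flip: mult_2)
    next
      show "ok (Get 0 (Op Add (V 5) (V 5))) ?s1"
        using get k u W' by simp
    next
      show "c < N \<and> c \<noteq> root \<and> c \<notin> set qs \<and> parent_at t c = fst ?s1 5"
        if "left_ptr t u = Suc c" for c
        using child[of c] that get k by simp
    next
      fix s2 assume q2: "queue (push (left_ptr t u) qs) s2"
        and r2: "fst s2 3 = fst ?s1 3"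
          "fst s2 5 = fst ?s1 5"
      let ?qs2 = "push (left_ptr t u) qs"
      have r: "fst s2 3 = k" "fst s2 5 = u" using r2 get k by simp_all
      show "wp (visit (Get 0 (Op Add (Op Add (V 5) (V 5)) (C 1)))) s2
         ?post"
      proof (rule visit_correct[where qs = ?qs2 and p = "right_ptr t u"])
        show "queue ?qs2 s2" by (rule q2)
      next
        show "fst s2 5 \<in> set ?qs2" using r u by (simp add: push_def)
      next
        show "eval (Get 0 (Op Add (Op Add (V 5) (V 5)) (C 1))) s2 = right_ptr t u"
          using r q2 u by (simp add: queue_def flip: mult_2)
      next
        show "ok (Get 0 (Op Add (Op Add (V 5) (V 5)) (C 1))) s2" using r u W' by simp
      next
        show "c < N \<and> c \<noteq> root \<and> c \<notin> set ?qs2 \<and> parent_at t c = fst s2 5"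
          if "right_ptr t u = Suc c" for c
        proof -
          have "c \<noteq> left_ptr t u - 1 \<or> left_ptr t u = 0" using neq[of c] that by (cases "left_ptr t u") auto
          then show ?thesis using child[of c] that r by (auto simp: push_def)
        qed
      next
        fix s3 assume q3: "queue (push (right_ptr t u) ?qs2) s3"
          and r3: "fst s3 3 = fst s2 3" "fst s3 5 = fst s2 5"
        let ?qs3 = "push (right_ptr t u) ?qs2"
        have ext: "take (Suc k) ?qs3 = take (Suc k) qs" "length qs \<le> length ?qs3"
          using kl by (auto simp: push_def)
        have "set (take (Suc k) qs) = insert u (set (take k qs))"
          using kl by (simp add: take_Suc_conv_app_nth u_def)
        moreover have "set ?qs3 = set qs \<union> {c. c < N \<and> c \<noteq> root \<and> parent_at t c = u}"
          unfolding children_set[OF u(2)]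
          by (cases "left_ptr t u"; cases "right_ptr t u") (auto simp: push_def)
        ultimately have "set ?qs3 = insert root {v. v < N \<and> v \<noteq> root \<and> parent_at t v \<in> set (take (Suc k) ?qs3)}"
          unfolding ext(1) set by auto
        moreover have "queue ?qs3 ((fst s3)(3 := Suc k), snd s3)" using q3 by (simp add: queue_def)
        ultimately have "bfs_inv (Suc k) ((fst s3)(3 := Suc k), snd s3)"
          unfolding bfs_inv_def using ext(2) kl by (intro exI[of _ ?qs3]) simp
        moreover have "Suc k < W" using kl queue_length[OF q] W' by simp
        ultimately show "(3::nat) < 40 \<and> (3::nat) \<noteq> 2 \<and> ok (Op Add (V 3) (C 1)) s3 \<and>
           bfs_inv (Suc k) ((fst s3)(3 := eval (Op Add (V 3) (C 1)) s3), snd s3)"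
          using r3 r W' by simp
      qed
    qed
  qed simp_all
qed

lemma bfs_exit:
  assumes "bfs_inv k s" "\<not> fst s 3 < fst s 4"
  shows "\<exists>qs. stage1 qs s"
proof -
  from assms obtain qs where q: "queue qs s" and k: "fst s 3 = k" "k \<le> length qs"
    and set: "set qs = insert root {v. v < N \<and> v \<noteq> root \<and> parent_at t v \<in> set (take k qs)}"
    unfolding bfs_inv_def by blast
  have "take k qs = qs" using assms(2) k q by (simp add: queue_def)
  with set have closed: "set qs = insert root {v. v < N \<and> v \<noteq> root \<and> parent_at t v \<in> set qs}" by simp
  have "v \<in> set qs" if "v < N" for v
    using that
  proof (induction v rule: node_induct)
    case root
    then show ?case using closed by blast
  next
    case (step v)
    then show ?case using closed by blast
  qed
  then have "set qs = {..<N}" using q by (auto simp: queue_def)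
  with q show ?thesis by (auto simp: stage1_def)
qed

lemma bfs_correct:
  assumes "stage0 s"
  shows "hoare bfs s (time_cmd (Put 2 (C 0) (Op Sub (V 1) (C 1)) ;; Asg 4 (C 1) ;; Asg 3 (C 0)) +
    (N * (time_cmd bfs_body + 1) + 1)) (\<lambda>s. \<exists>qs. stage1 qs s)"
  unfolding bfs_def
proof (rule hoare_seq[where P = "bfs_inv 0"], rule hoare_wp)
  let ?s = "((fst s)(4 := 1, 3 := 0), (snd s)(2 := (snd s 2)(0 := root)))"
  have "queue [root] ?s"
    using assms rt_less dep_rt by (auto simp: queue_def stage0_def parents_first_def)
  then have "bfs_inv 0 ?s" unfolding bfs_inv_def by (intro exI[of _ "[root]"]) simp
  moreover have "root < W" "1 < W" "0 < W" "0 < M" using rt_less W_big M_eq by linarith+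
  ultimately show "wp (Put 2 (C 0) (Op Sub (V 1) (C 1)) ;; Asg 4 (C 1) ;; Asg 3 (C 0)) s (bfs_inv 0)"
    using assms by (simp add: stage0_def)
next
  fix s assume "bfs_inv 0 s"
  then show "hoare (Whl 3 4 bfs_body) s (N * (time_cmd bfs_body + 1) + 1) (\<lambda>s. \<exists>qs. stage1 qs s)"
  proof (rule hoare_while[where I = bfs_inv])
    fix k s assume inv: "bfs_inv k s" "fst s 3 < fst s 4"
    obtain qs where "queue qs s" "fst s 3 = k" using inv(1) unfolding bfs_inv_def by blast
    then have "k < N" using inv(2) queue_length[of qs s] by (simp add: queue_def)
    then show "k < N \<and> hoare bfs_body s (time_cmd bfs_body) (bfs_inv (Suc k))"
      using bfs_step[OF inv] hoare_wp by blast
  qed (use bfs_exit in auto)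
qed

section \<open>Subtree sizes in reverse breadth-first order\<close>

definition ordered :: "nat list \<Rightarrow> mach \<Rightarrow> bool" where
  "ordered qs s \<longleftrightarrow> distinct qs \<and> set qs = {..<N} \<and> parents_first qs \<and> fst s 0 = N \<and>
     (\<forall>i<N. snd s 2 i = qs ! i) \<and>
     (\<forall>v<N. snd s 4 v = depth_at t v \<and> (v \<noteq> root \<longrightarrow> snd s 3 v = parent_at t v))"

lemma order_length: "distinct qs \<Longrightarrow> set qs = {..<N} \<Longrightarrow> length qs = N"
  using distinct_card[of qs] by simp

lemma stage1_ordered: "stage1 qs s \<Longrightarrow> ordered qs s \<and> (\<forall>a\<ge>5. snd s a = (\<lambda>_. 0))"
  using order_length[of qs] by (auto simp: stage1_def queue_def ordered_def)

lemma parents_first_0: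
  assumes "parents_first qs" "qs \<noteq> []"
  shows "qs ! 0 = root"
  using assms unfolding parents_first_def by auto

lemma parents_first_index:
  assumes "distinct qs" "parents_first qs" "m < length qs" "i < length qs"
    "qs ! m \<noteq> root" "parent_at t (qs ! m) = qs ! i"
  shows "i < m"
proof -
  obtain k where "k < m" "qs ! k = qs ! i" using assms unfolding parents_first_def by metis
  then show ?thesis using assms by (simp add: nth_eq_iff_index_eq)
qed

text \<open>The size counter of \<open>v\<close> when exactly the nodes in \<open>S\<close> have been processed.\<close>

definition partial_size :: "nat set \<Rightarrow> nat \<Rightarrow> nat" where
  "partial_size S v = (if v \<in> S then subtree_size t v else \<Sum>c\<in>children v \<inter> S. subtree_size t c)"

lemma partial_size_le: "v < N \<Longrightarrow> partial_size S v \<le> N"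
proof -
  assume v: "v < N"
  have "(\<Sum>c\<in>children v \<inter> S. subtree_size t c) \<le> (\<Sum>c\<in>children v. subtree_size t c)"
    by (intro sum_mono2) auto
  also have "\<dots> < subtree_size t v" using sz_children[OF v] .
  finally show ?thesis using sz_le[OF v] unfolding partial_size_def by auto
qed

text \<open>Once all children are processed, only the node itself is missing from its
  counter.\<close>

lemma partial_size_node:
  assumes "v < N" "v \<notin> S" "children v \<subseteq> S"
  shows "Suc (partial_size S v) = subtree_size t v"
  using children_size[OF assms(1)] assms(2,3) by (simp add: partial_size_def Int_absorb2)

lemma partial_size_insert_par:
  assumes "v < N" "v \<noteq> root" "v \<notin> S" "parent_at t v \<notin> insert v S"
  shows "partial_size (insert v S) (parent_at t v) = partial_size S (parent_at t v) + subtree_size t v"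
proof -
  have "children (parent_at t v) \<inter> insert v S = insert v (children (parent_at t v) \<inter> S)"
    using assms by auto
  then show ?thesis using assms by (simp add: partial_size_def)
qed

lemma partial_size_insert_other:
  assumes "u \<noteq> v" "v = root \<or> u \<noteq> parent_at t v"
  shows "partial_size (insert v S) u = partial_size S u"
proof -
  have "children u \<inter> insert v S = children u \<inter> S" using assms by auto
  then show ?thesis using assms by (simp add: partial_size_def)
qed

definition sizes_inv :: "nat list \<Rightarrow> nat \<Rightarrow> mach \<Rightarrow> bool" where
  "sizes_inv qs k s \<longleftrightarrow> ordered qs s \<and> k \<le> N \<and> fst s 13 = 0 \<and> fst s 3 = N - k \<and>
     (\<forall>v<N. snd s 5 v = partial_size (set (drop (N - k) qs)) v) \<and> (\<forall>a\<ge>6. snd s a = (\<lambda>_. 0))"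

lemma sizes_step:
  assumes inv: "sizes_inv qs k s" and k: "k < N"
  shows "wp sizes_body s (sizes_inv qs (Suc k))"
proof -
  have ord: "ordered qs s" using inv by (simp add: sizes_inv_def)
  then have d: "distinct qs" and set: "set qs = {..<N}" and pf: "parents_first qs"
    by (auto simp: ordered_def)
  note len = order_length[OF d set]
  have "qs \<noteq> []" using len N_pos by auto
  note root0 = parents_first_0[OF pf this]
  define i where "i = N - Suc k"
  define v where "v = qs ! i"
  define S where "S = set (drop (Suc i) qs)"
  have i: "i < N" "N - k = Suc i" using k by (auto simp: i_def)
  have v: "v < N" using set nth_mem[of i qs] i len by (auto simp: v_def)
  have drop: "drop i qs = v # drop (Suc i) qs"
    using i len by (simp add: v_def Cons_nth_drop_Suc)
  have S': "set (drop i qs) = insert v S" by (simp add: drop S_def)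
  have vS: "v \<notin> S" using distinct_drop[OF d, of i] by (simp add: drop S_def)
  \<comment> \<open>Children come later in the queue than their parent and have thus been processed
    by the backward loop.\<close>
  have ch: "children v \<subseteq> S"
  proof
    fix c assume c: "c \<in> children v"
    then have "c \<in> set qs" by (simp add: set)
    then obtain m where m: "m < length qs" "qs ! m = c" unfolding in_set_conv_nth by blast
    have "i < m"
      using parents_first_index[OF d pf m(1), of i] c m i len by (auto simp: v_def)
    then have "drop (Suc i) qs ! (m - Suc i) = c" "m - Suc i < length (drop (Suc i) qs)"
      using m by auto
    then show "c \<in> S" unfolding S_def by (metis nth_mem)
  qed
  have mem: "snd s 5 u = partial_size S u" if "u < N" for u
    using inv that i by (simp add: sizes_inv_def S_def)
  have node: "Suc (partial_size S v) = subtree_size t v" by (rule partial_size_node[OF v vS ch])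
  have sN: "subtree_size t v \<le> N" by (rule sz_le[OF v])
  have reg: "fst s 3 = Suc i" "fst s 13 = 0" "fst s 0 = N" "snd s 2 i = v"
    using inv i ord by (auto simp: sizes_inv_def ordered_def v_def)
  have W': "Suc i < W" "subtree_size t v < W" "v < M" "i < M"
    using i sN v by (simp_all add: less_W less_M)
  show ?thesis
  proof (cases "i = 0")
    case True
    then have "v = root" using root0 by (simp add: v_def)
    then have oth: "partial_size (insert v S) u = partial_size S u" if "u \<noteq> v" for u
      using that by (intro partial_size_insert_other) auto
    let ?m = "(snd s 5)(v := subtree_size t v)"
    have m: "?m u = partial_size (insert v S) u" if "u < N" for u
    proof (cases "u = v")
      case True
      then show ?thesis by (simp add: partial_size_def)
    next
      case False
      then show ?thesis using oth mem[OF that] by simp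
    qed
    have "sizes_inv qs (Suc k) ((fst s)(3 := i, 5 := v), (snd s)(5 := ?m))"
      using inv ord k m S' unfolding sizes_inv_def i_def[symmetric]
      by (simp add: ordered_def)
    then show ?thesis using reg W' True mem[OF v] node by (simp add: sizes_body_def)
  next
    case False
    have nr: "v \<noteq> root"
      using nth_eq_iff_index_eq[OF d, of i 0] root0 False i len N_pos by (simp add: v_def)
    let ?p = "parent_at t v"
    have p: "?p < N" by (rule par_less[OF v nr])
    \<comment> \<open>The parent comes earlier in the queue, so its counter is still
      collecting.\<close>
    have pS: "?p \<notin> insert v S"
    proof
      assume "?p \<in> insert v S"
      then have "?p \<in> set (drop i qs)" by (simp add: S')
      then obtain m where m: "m < length (drop i qs)" "drop i qs ! m = ?p" by (auto simp: in_set_conv_nth)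
      then have "qs ! (i + m) = ?p" "i + m < length qs" by auto
      then have "i + m < i"
        using parents_first_index[OF d pf, of i "i + m"] i len nr by (simp add: v_def)
      then show False by simp
    qed
    have oth: "partial_size (insert v S) u = partial_size S u" if "u \<noteq> v" "u \<noteq> ?p" for u
      using that by (intro partial_size_insert_other) auto
    note par = partial_size_insert_par[OF v nr vS pS]
    have pN: "partial_size S ?p + subtree_size t v \<le> N"
      using partial_size_le[OF p, of "insert v S"] par by simp
    let ?m = "(snd s 5)(v := subtree_size t v, ?p := partial_size S ?p + subtree_size t v)"
    have m: "?m u = partial_size (insert v S) u" if "u < N" for u
    proof -
      consider "u = ?p" | "u = v" "u \<noteq> ?p" | "u \<noteq> v" "u \<noteq> ?p" by blast
      then show ?thesis
      proof cases
        case 1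
        then show ?thesis using par by simp
      next
        case 2
        then show ?thesis by (simp add: partial_size_def)
      next
        case 3
        then show ?thesis using oth mem[OF that] by simp
      qed
    qed
    have "sizes_inv qs (Suc k) ((fst s)(3 := i, 5 := v, 14 := ?p), (snd s)(5 := ?m))"
      using inv ord k m S' unfolding sizes_inv_def i_def[symmetric]
      by (simp add: ordered_def)
    moreover have "snd s 3 v = ?p" using ord v nr by (simp add: ordered_def)
    moreover have "partial_size S ?p + subtree_size t v < W" "?p < M" "?p \<noteq> v"
      using pN p pS by (simp_all add: less_W less_M)
    ultimately show ?thesis using reg W' False mem[OF v] mem[OF p] node by (simp add: sizes_body_def)
  qed
qed

definition sized :: "nat list \<Rightarrow> mach \<Rightarrow> bool" where
  "sized qs s \<longleftrightarrow> ordered qs s \<and> (\<forall>v<N. snd s 5 v = subtree_size t v)"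

lemma sizes_correct:
  assumes "ordered qs s" "\<forall>a\<ge>5. snd s a = (\<lambda>_. 0)"
  shows "hoare sizes s (time_cmd (Asg 13 (C 0) ;; Asg 3 (V 0)) + (N * (time_cmd sizes_body + 1) + 1))
    (\<lambda>s. sized qs s \<and> (\<forall>a\<ge>6. snd s a = (\<lambda>_. 0)))"
  unfolding sizes_def
proof (rule hoare_seq[where P = "sizes_inv qs 0"], rule hoare_wp)
  have d: "distinct qs" "set qs = {..<N}" using assms(1) by (auto simp: ordered_def)
  have "snd s 5 v = partial_size (set (drop (N - 0) qs)) v" for v
    using assms(2) order_length[OF d] by (simp add: partial_size_def)
  then have "sizes_inv qs 0 ((fst s)(13 := 0, 3 := N), snd s)"
    using assms unfolding sizes_inv_def by (simp add: ordered_def)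
  then show "wp (Asg 13 (C 0) ;; Asg 3 (V 0)) s (sizes_inv qs 0)"
    using assms(1) by (simp add: ordered_def)
next
  fix s assume "sizes_inv qs 0 s"
  then have "hoare (Whl 13 3 sizes_body) s (N * (time_cmd sizes_body + 1) + 1) (sizes_inv qs N)"
  proof (rule hoare_for)
    show "k \<le> N \<and> (fst s 13 < fst s 3 \<longleftrightarrow> k < N)" if "sizes_inv qs k s" for k s
      using that by (auto simp: sizes_inv_def)
  qed (simp_all add: sizes_step)
  then show "hoare (Whl 13 3 sizes_body) s (N * (time_cmd sizes_body + 1) + 1)
    (\<lambda>s. sized qs s \<and> (\<forall>a\<ge>6. snd s a = (\<lambda>_. 0)))"
    by (rule hoare_conseq) (auto simp: sizes_inv_def sized_def ordered_def partial_size_def)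
qed

section \<open>Tables of logarithms, powers of two and potentials\<close>

definition logged :: "nat list \<Rightarrow> mach \<Rightarrow> bool" where
  "logged qs s \<longleftrightarrow> sized qs s \<and> fst s 7 = height \<and> (\<forall>i\<le>N. snd s 6 i = floor_log i)"

lemma logs_correct:
  assumes "sized qs s" "\<forall>a\<ge>6. snd s a = (\<lambda>_. 0)"
  shows "hoare logs s (time_cmd (Asg 3 (C 2) ;; Asg 9 (Op Add (V 0) (C 1))) +
      ((N - 1) * (time_cmd logs_body + 1) + 1 + time_cmd (Asg 7 (Get 6 (V 0)))))
    (logged qs)"
proof -
  define I where "I = (\<lambda>k s. sized qs s \<and> k \<le> N - 1 \<and> fst s 3 = k + 2 \<and> fst s 9 = N + 1 \<and>
    (\<forall>i<k + 2. snd s 6 i = floor_log i))"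
  show ?thesis
    unfolding logs_def
  proof (rule hoare_seq[where P = "I 0"], rule hoare_wp)
    have "snd s 6 i = floor_log i" if "i < 2" for i
      using that assms(2) by (cases "i = 0") (auto simp: less_2_cases_iff)
    then have "I 0 ((fst s)(3 := 2, 9 := N + 1), snd s)"
      using assms(1) by (simp add: I_def sized_def ordered_def)
    moreover have "fst s 0 = N" using assms(1) by (simp add: sized_def ordered_def)
    moreover have "Suc N < W" by (rule less_W) simp
    ultimately show "wp (Asg 3 (C 2) ;; Asg 9 (Op Add (V 0) (C 1))) s (I 0)" by simp
  next
    fix s assume "I 0 s"
    show "hoare (Whl 3 9 logs_body ;; Asg 7 (Get 6 (V 0))) s
      ((N - 1) * (time_cmd logs_body + 1) + 1 + time_cmd (Asg 7 (Get 6 (V 0))))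
      (logged qs)"
    proof (rule hoare_seq)
      show "hoare (Whl 3 9 logs_body) s ((N - 1) * (time_cmd logs_body + 1) + 1) (I (N - 1))"
      proof (rule hoare_for[where I = I, OF \<open>I 0 s\<close>])
        fix k s assume inv: "I k s" and k: "k < N - 1"
        have half: "snd s 6 (Suc (k div 2)) = floor_log (Suc (k div 2))" using inv by (simp add: I_def)
        have fl: "floor_log (k + 2) = Suc (floor_log (Suc (k div 2)))"
          using floor_log_rec[of "k + 2"] by simp
        have "floor_log (k + 2) < k + 2" by (rule floor_log_less_self) simp
        then have "floor_log (k + 2) < W" using k by (intro less_W) linarith
        moreover have "k + 3 < W" "k + 2 < M" "Suc (k div 2) < M" using k by (simp_all add: less_W less_M)
        moreover have "I (Suc k) ((fst s)(3 := k + 3), (snd s)(6 := (snd s 6)(k + 2 := floor_log (k + 2))))"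
          using inv k by (auto simp: I_def sized_def ordered_def less_Suc_eq)
        ultimately show "wp logs_body s (I (Suc k))"
          using inv half fl by (simp add: logs_body_def I_def numeral_3_eq_3)
      qed (auto simp: I_def)
    next
      fix s assume inv: "I (N - 1) s"
      show "hoare (Asg 7 (Get 6 (V 0))) s (time_cmd (Asg 7 (Get 6 (V 0))))
        (logged qs)"
        using inv N_pos by (intro hoare_wp) (auto simp: I_def logged_def sized_def ordered_def height_def less_M)
    qed
  qed
qed

lemma height_less: "height < N"
  unfolding height_def by (rule floor_log_less_self[OF N_pos])

text \<open>Every entry of the table of powers is O(N) and hence fits into a word.\<close>

lemma power_height: "e \<le> height + 2 \<Longrightarrow> 2 ^ e \<le> 4 * N"
proof -
  assume "e \<le> height + 2"
  then have "(2::nat) ^ e \<le> 2 ^ (height + 2)" by (intro power_increasing) simp_all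
  also have "\<dots> = 4 * 2 ^ height" by simp
  finally show ?thesis using N_ge by linarith
qed

lemma powers_correct:
  assumes "logged qs s"
  shows "hoare powers s (time_cmd (Put 7 (C 0) (C 1) ;; Asg 3 (C 0) ;; Asg 9 (Op Add (V 7) (C 2))) +
      ((height + 2) * (time_cmd powers_body + 1) + 1))
    (\<lambda>s. logged qs s \<and> (\<forall>e\<le>height + 2. snd s 7 e = 2 ^ e))"
proof -
  define I where "I = (\<lambda>k s. logged qs s \<and> k \<le> height + 2 \<and> fst s 3 = k \<and> fst s 9 = height + 2 \<and>
    (\<forall>e\<le>k. snd s 7 e = 2 ^ e))"
  show ?thesis
    unfolding powers_def
  proof (rule hoare_seq[where P = "I 0"], rule hoare_wp)
    have "I 0 ((fst s)(3 := 0, 9 := height + 2), (snd s)(7 := (snd s 7)(0 := 1)))"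
      using assms(1) by (simp add: I_def logged_def sized_def ordered_def)
    moreover have "fst s 7 = height" using assms(1) by (simp add: logged_def)
    moreover have "height + 2 < W" "0 < M" using height_less by (simp_all add: less_W less_M)
    ultimately show "wp (Put 7 (C 0) (C 1) ;; Asg 3 (C 0) ;; Asg 9 (Op Add (V 7) (C 2))) s (I 0)" by simp
  next
    fix s assume "I 0 s"
    then have "hoare (Whl 3 9 powers_body) s ((height + 2) * (time_cmd powers_body + 1) + 1) (I (height + 2))"
    proof (rule hoare_for)
      fix k s assume inv: "I k s" and k: "k < height + 2"
      have "2 ^ Suc k < W" using power_height[of "Suc k"] k by (intro less_W) simp
      then have "2 ^ k + 2 ^ k < W" by (simp only: power_Suc mult_2)
      moreover have "Suc k < W" "Suc k < M" "k < M" using k height_less by (simp_all add: less_W less_M)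
      moreover have "I (Suc k) ((fst s)(3 := Suc k), (snd s)(7 := (snd s 7)(Suc k := 2 ^ k + 2 ^ k)))"
        using inv k by (auto simp: I_def logged_def sized_def ordered_def le_Suc_eq)
      ultimately show "wp powers_body s (I (Suc k))"
        using inv by (simp add: powers_body_def I_def)
    qed (auto simp: I_def)
    then show "hoare (Whl 3 9 powers_body) s ((height + 2) * (time_cmd powers_body + 1) + 1)
      (\<lambda>s. logged qs s \<and> (\<forall>e\<le>height + 2. snd s 7 e = 2 ^ e))"
      by (rule hoare_conseq) (auto simp: I_def)
  qed
qed

definition tabled :: "nat list \<Rightarrow> mach \<Rightarrow> bool" where
  "tabled qs s \<longleftrightarrow> distinct qs \<and> set qs = {..<N} \<and> parents_first qs \<and> fst s 0 = N \<and> fst s 7 = height \<and>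
     (\<forall>i<N. snd s 2 i = qs ! i) \<and>
     (\<forall>v<N. snd s 4 v = depth_at t v \<and> (v \<noteq> root \<longrightarrow> snd s 3 v = parent_at t v)) \<and>
     (\<forall>i\<le>N. snd s 6 i = floor_log i) \<and> (\<forall>e\<le>height + 2. snd s 7 e = 2 ^ e) \<and>
     (\<forall>v<N. snd s 8 v = potential v \<and> snd s 9 v = region (depth_at t v))"

lemma potentials_correct:
  assumes "logged qs s" "\<forall>e\<le>height + 2. snd s 7 e = 2 ^ e"
  shows "hoare potentials s (time_cmd (Asg 3 (C 0)) + (N * (time_cmd potentials_body + 1) + 1))
    (\<lambda>s. tabled qs s \<and> (\<forall>i<N. snd s 11 i = i))"
proof -
  define I where "I = (\<lambda>k s. logged qs s \<and> (\<forall>e\<le>height + 2. snd s 7 e = 2 ^ e) \<and> k \<le> N \<and> fst s 3 = k \<and>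
    (\<forall>v<k. snd s 8 v = potential v \<and> snd s 9 v = region (depth_at t v) \<and> snd s 11 v = v))"
  show ?thesis
    unfolding potentials_def
  proof (rule hoare_seq[where P = "I 0"], rule hoare_wp)
    have "I 0 ((fst s)(3 := 0), snd s)"
      using assms by (simp add: I_def logged_def sized_def ordered_def)
    then show "wp (Asg 3 (C 0)) s (I 0)" by simp
  next
    fix s assume "I 0 s"
    then have "hoare (Whl 3 0 potentials_body) s (N * (time_cmd potentials_body + 1) + 1) (I N)"
    proof (rule hoare_for)
      fix k s assume inv: "I k s" and k: "k < N"
      let ?d = "depth_at t k" and ?z = "subtree_size t k"
      have mem: "snd s 4 k = ?d" "snd s 5 k = ?z" "fst s 7 = height" "fst s 3 = k"
        using inv k by (auto simp: I_def logged_def sized_def ordered_def)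
      have dN: "?d < N" "?z \<le> N" using dep_less[OF k] sz_le[OF k] by auto
      have dq: "?d div Suc height \<le> N" by (rule le_trans[OF div_le_dividend less_imp_le[OF dN(1)]])
      then have q: "snd s 6 (?d div Suc height) = region ?d"
        using inv by (simp add: I_def logged_def region_def)
      have qh: "region ?d \<le> height" using dN(1) by (intro region_le_height) simp
      have z: "snd s 6 ?z = floor_log ?z" using inv dN(2) by (simp add: I_def logged_def)
      define P where "P = potential k"
      have P: "P = (if height < ?d then Suc (height + height) - floor_log ?z + region ?d else ?d)"
        using potential_shallow[of k] potential_deep[of k] by (simp add: P_def mult_2)
      have I': "I (Suc k) ((fst s)(5 := ?d, 10 := region ?d, 3 := Suc k),
        (snd s)(9 := (snd s 9)(k := region ?d), 8 := (snd s 8)(k := P), 11 := (snd s 11)(k := k)))"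
        using inv k by (auto simp: I_def logged_def sized_def ordered_def P_def less_Suc_eq)
      have bounds: "Suc height < W" "Suc (height + height) < W" "height + height < W" "Suc k < W"
        "Suc (height + height) - floor_log ?z < W" "Suc (height + height) - floor_log ?z + region ?d < W"
        "?d div Suc height < W"
        using qh dN height_less k dq by (simp_all add: less_W)
      have bM: "k < M" "?d div Suc height < M" "?z < M"
        using k dN dq by (simp_all add: less_M)
      show "wp potentials_body s (I (Suc k))"
        using I' mem q z bounds bM P
        by (cases "height < ?d") (simp_all add: potentials_body_def fun_upd_twist)
    qed (auto simp: I_def logged_def sized_def ordered_def)
    then show "hoare (Whl 3 0 potentials_body) s (N * (time_cmd potentials_body + 1) + 1)
      (\<lambda>s. tabled qs s \<and> (\<forall>i<N. snd s 11 i = i))"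
      by (rule hoare_conseq) (auto simp: I_def logged_def sized_def ordered_def tabled_def)
  qed
qed

end

subsection \<open>The sorting passes\<close>

lemma bucket_sort_Suc: "bucket_sort (Suc n) key xs = bucket_sort n key xs @ filter (\<lambda>v. key v = n) xs"
  by (simp add: bucket_sort_def)

definition bucket_start :: "('a \<Rightarrow> nat) \<Rightarrow> 'a list \<Rightarrow> nat \<Rightarrow> nat" where
  "bucket_start key xs k = length (bucket_sort k key xs)"

text \<open>The part of bucket \<open>k\<close> placed after reading \<open>i\<close> elements. Its
  length, added to \<open>bucket_start\<close>, is the running counter of a counting sort.\<close>

definition bucket_fill :: "('a \<Rightarrow> nat) \<Rightarrow> 'a list \<Rightarrow> nat \<Rightarrow> nat \<Rightarrow> 'a list" where
  "bucket_fill key xs i k = filter (\<lambda>v. key v = k) (take i xs)"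

lemma bucket_start_0: "bucket_start key xs 0 = 0"
  by (simp add: bucket_start_def bucket_sort_def)

lemma bucket_start_Suc:
  "bucket_start key xs (Suc k) = bucket_start key xs k + length (bucket_fill key xs (length xs) k)"
  by (simp add: bucket_start_def bucket_sort_Suc bucket_fill_def)

lemma bucket_start_mono: "k \<le> n \<Longrightarrow> bucket_start key xs k \<le> bucket_start key xs n"
  by (induction n rule: dec_induct) (simp_all add: bucket_start_Suc)

lemma bucket_fill_0: "bucket_fill key xs 0 k = []"
  by (simp add: bucket_fill_def)

lemma bucket_fill_Suc:
  "i < length xs \<Longrightarrow> bucket_fill key xs (Suc i) k =
     (if key (xs ! i) = k then bucket_fill key xs i k @ [xs ! i] else bucket_fill key xs i k)"
  by (simp add: bucket_fill_def take_Suc_conv_app_nth)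

lemma bucket_fill_le: "length (bucket_fill key xs i k) \<le> length (bucket_fill key xs (length xs) k)"
proof -
  have "length (filter (\<lambda>v. key v = k) xs) =
      length (filter (\<lambda>v. key v = k) (take i xs @ drop i xs))" by simp
  then show ?thesis unfolding bucket_fill_def filter_append by simp
qed

lemma bucket_fill_less:
  assumes "i < length xs"
  shows "length (bucket_fill key xs i (key (xs ! i))) < length (bucket_fill key xs (length xs) (key (xs ! i)))"
  using bucket_fill_le[of key xs "Suc i" "key (xs ! i)"] assms by (simp add: bucket_fill_Suc)

text \<open>Buckets occupy disjoint intervals, so placing an element does not overwrite another
  bucket.\<close>

lemma bucket_positions_distinct:
  assumes "m < length (bucket_fill key xs (length xs) k)" "m' < length (bucket_fill key xs (length xs) k')"
    "k \<noteq> k'"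
  shows "bucket_start key xs k + m \<noteq> bucket_start key xs k' + m'"
proof (cases "k < k'")
  case True
  then show ?thesis
    using bucket_start_mono[of "Suc k" k' key xs] assms by (simp add: bucket_start_Suc)
next
  case False
  then show ?thesis
    using bucket_start_mono[of "Suc k'" k key xs] assms by (simp add: bucket_start_Suc)
qed

lemma bucket_sort_nth:
  assumes "\<And>k m. k < n \<Longrightarrow> m < length (bucket_fill key xs (length xs) k) \<Longrightarrow>
      f (bucket_start key xs k + m) = bucket_fill key xs (length xs) k ! m"
    and "p < length (bucket_sort n key xs)"
  shows "f p = bucket_sort n key xs ! p"
  using assms
proof (induction n arbitrary: p)
  case (Suc n)
  show ?case
  proof (cases "p < length (bucket_sort n key xs)")
    case True
    then show ?thesis using Suc by (simp add: bucket_sort_Suc nth_append)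
  next
    case False
    define m where "m = p - length (bucket_sort n key xs)"
    have p: "p = bucket_start key xs n + m" using False by (simp add: m_def bucket_start_def)
    have m: "m < length (bucket_fill key xs (length xs) n)"
      using Suc.prems(2) False by (simp add: m_def bucket_sort_Suc bucket_fill_def)
    have "f p = bucket_fill key xs (length xs) n ! m" using Suc.prems(1)[of n m] m p by simp
    also have "\<dots> = bucket_sort (Suc n) key xs ! p"
      using p by (simp add: bucket_sort_Suc bucket_start_def bucket_fill_def nth_append)
    finally show ?thesis .
  qed
qed (simp add: bucket_sort_def)

text \<open>Registers 11 and 12 receive the cell width and the depth width. The cap in the latter is
  computed by truncated subtraction, as j - (j - q) is the minimum of j and q. Each node starts as
  its own chunk root and inherits that of its parent when neither cut test fires.\<close>

definition roots_body :: cmd where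
  "roots_body = Asg 5 (Get 2 (V 3)) ;; Asg 10 (Get 9 (V 5)) ;;
     Asg 11 (Get 7 (Get 6 (Op Div (Op Sub (V 8) (V 10)) (C 4)))) ;;
     Asg 12 (Get 7 (Op Add (Op Sub (V 8) (Op Sub (V 8) (V 10))) (V 11))) ;;
     Put 10 (V 5) (V 5) ;;
     Cnd (C 0) (V 3)
       (Asg 14 (Get 3 (V 5)) ;;
        Cnd (Op Div (Get 8 (V 14)) (V 11)) (Op Div (Get 8 (V 5)) (V 11)) Nop
          (Cnd (Op Div (Op Sub (Get 4 (V 5)) (C 1)) (V 12)) (Op Div (Get 4 (V 5)) (V 12)) Nop
             (Put 10 (V 5) (Get 10 (V 14)))))
       Nop ;;
     inc 3"

definition clear_body :: cmd where "clear_body = Put 13 (V 3) (C 0) ;; inc 3"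

text \<open>Counts are stored one place higher than their key, so that prefix sums directly yield
  the starts of the buckets.\<close>

definition count_body :: cmd where
  "count_body = Asg 5 (Op Add (Get 10 (Get 11 (V 3))) (C 1)) ;;
     Put 13 (V 5) (Op Add (Get 13 (V 5)) (C 1)) ;; inc 3"

definition prefix_body :: cmd where
  "prefix_body = Asg 5 (Op Add (V 3) (C 1)) ;;
     Put 13 (V 5) (Op Add (Get 13 (V 5)) (Get 13 (V 3))) ;; inc 3"

definition place_body :: cmd where
  "place_body = Asg 5 (Get 11 (V 3)) ;; Asg 6 (Get 10 (V 5)) ;; Put 12 (Get 13 (V 6)) (V 5) ;;
     Put 13 (V 6) (Op Add (Get 13 (V 6)) (C 1)) ;; inc 3"

definition copy_body :: "nat \<Rightarrow> nat \<Rightarrow> cmd" where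
  "copy_body a b = Put a (V 3) (Get b (V 3)) ;; inc 3"

definition for_nodes :: "cmd \<Rightarrow> cmd" where
  "for_nodes c = Asg 3 (C 0) ;; Whl 3 0 c"

text \<open>The bound of the outer loop in register 15 is assigned again, because the invariants of
  the inner loops do not carry it.\<close>

definition pass :: cmd where
  "pass = for_nodes roots_body ;; ((Asg 3 (C 0) ;; Asg 9 (Op Add (V 0) (C 1))) ;; Whl 3 9 clear_body) ;;
     for_nodes count_body ;; for_nodes prefix_body ;; for_nodes place_body ;;
     for_nodes (copy_body 11 12) ;; (inc 8 ;; Asg 15 (Op Add (V 7) (C 1)))"

definition passes :: cmd where
  "passes = (Asg 8 (C 0) ;; Asg 15 (Op Add (V 7) (C 1))) ;; Whl 8 15 pass"

context layout_program
begin

section \<open>Correctness of the sorting passes\<close>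

lemma hoare_for_nodes:
  assumes "I 0 ((fst s)(3 := 0), snd s)"
    and "\<And>k s. I k s \<Longrightarrow> k \<le> N \<and> fst s 3 = k \<and> fst s 0 = N"
    and "\<And>k s. I k s \<Longrightarrow> k < N \<Longrightarrow> wp c s (I (Suc k))"
  shows "hoare (for_nodes c) s (3 + (N * (time_cmd c + 1) + 1)) (I N)"
  unfolding for_nodes_def
proof (rule hoare_seq[where P = "I 0"])
  have "wp (Asg 3 (C 0)) s (I 0)" using assms(1) by simp
  then show "hoare (Asg 3 (C 0)) s 3 (I 0)"
    by (rule hoare_conseq[OF hoare_wp]) simp_all
next
  fix s assume "I 0 s"
  then show "hoare (Whl 3 0 c) s (N * (time_cmd c + 1) + 1) (I N)"
  proof (rule hoare_for)
    show "k \<le> N \<and> (fst s 3 < fst s 0 \<longleftrightarrow> k < N)" if "I k s" for k s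
      using assms(2)[OF that] by simp
  qed (simp_all add: assms(3))
qed

definition pass_state :: "nat list \<Rightarrow> nat \<Rightarrow> mach \<Rightarrow> bool" where
  "pass_state qs j s \<longleftrightarrow> tabled qs s \<and> fst s 8 = j \<and> (\<forall>i<N. snd s 11 i = layout_pass j ! i)"

lemma layout_pass_length: "length (layout_pass j) = N"
  using layout_pass_permutes[of j] distinct_card[of "layout_pass j"] by simp

lemma layout_pass_nth: "i < N \<Longrightarrow> layout_pass j ! i < N"
  using layout_pass_permutes[of j] nth_mem[of i "layout_pass j"] layout_pass_length[of j] by auto

lemma is_cut_iff:
  assumes "v < N" "v \<noteq> root"
  defines "q \<equiv> region (depth_at t v)"
  shows "is_cut j v \<longleftrightarrow>
    potential (parent_at t v) div cell_width j q < potential v div cell_width j q \<or>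
    (depth_at t v - 1) div depth_width j q < depth_at t v div depth_width j q"
proof -
  have "0 < depth_at t v" using dep_par[OF assms(1,2)] by simp
  moreover have "0 < depth_width j q" by (simp add: depth_width_def)
  ultimately show ?thesis
    using assms by (simp add: is_cut_def Let_def div_pred_less_iff del: One_nat_def)
qed

text \<open>Keeps the lookup of the depth width inside the table, which ends at
  \<open>height + 2\<close>.\<close>

lemma power_index:
  assumes "j \<le> height"
  shows "min j q + cell_width j q \<le> height + 2"
  using cell_width_upper[of j q] assms by (cases "q \<le> j") auto

definition roots_inv :: "nat list \<Rightarrow> nat \<Rightarrow> nat \<Rightarrow> mach \<Rightarrow> bool" where
  "roots_inv qs j k s \<longleftrightarrow> pass_state qs j s \<and> k \<le> N \<and> fst s 3 = k \<and>
     (\<forall>i<k. snd s 10 (qs ! i) = chunk_root j (qs ! i))"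

lemma roots_step:
  assumes inv: "roots_inv qs j k s" and k: "k < N" and j: "j \<le> height"
  shows "wp roots_body s (roots_inv qs j (Suc k))"
proof -
  have tab: "tabled qs s" using inv by (simp add: roots_inv_def pass_state_def)
  then have d: "distinct qs" and set: "set qs = {..<N}" and pf: "parents_first qs"
    by (auto simp: tabled_def)
  note len = order_length[OF d set]
  have "qs \<noteq> []" using len N_pos by auto
  note root0 = parents_first_0[OF pf this]
  define v where "v = qs ! k"
  have v: "v < N" using set nth_mem[of k qs] k len by (auto simp: v_def)
  define q where "q = region (depth_at t v)"
  let ?s = "cell_width j q" and ?t = "depth_width j q"
  have mem: "snd s 2 k = v" "snd s 9 v = q" "snd s 8 v = potential v" "snd s 4 v = depth_at t v"
    using tab v k by (auto simp: tabled_def v_def q_def)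
  have reg: "fst s 3 = k" "fst s 8 = j" using inv by (auto simp: roots_inv_def pass_state_def)
  have jN: "j < N" using j height_less by simp
  have lg_le: "(j - q) div 4 \<le> N" using jN by linarith
  then have lg: "snd s 6 ((j - q) div 4) = floor_log ((j - q) div 4)" using tab by (simp add: tabled_def)
  have fl: "floor_log ((j - q) div 4) \<le> j"
  proof (cases "j = 0")
    case False
    have "floor_log ((j - q) div 4) \<le> floor_log j"
      by (intro floor_log_le_iff le_trans[OF div_le_dividend diff_le_self])
    with floor_log_less_self[of j] False show ?thesis by simp
  qed simp
  have pw: "snd s 7 (floor_log ((j - q) div 4)) = ?s" using tab j fl by (simp add: tabled_def cell_width_def)
  have min: "j - (j - q) = min j q" "j + ?s - (j - q) = min j q + ?s"
    by (auto simp: min_def)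
  note pi = power_index[OF j, of q]
  then have pt: "snd s 7 (min j q + ?s) = ?t" using tab by (simp add: tabled_def depth_width_def)
  have bM: "k < M" "v < M" "(j - q) div 4 < M" "floor_log ((j - q) div 4) < M" "min j q + ?s < M"
    using k v lg_le fl jN pi height_less by (simp_all add: less_M)
  have bW: "(j - q) div 4 < W" "j - q < W" "min j q + ?s < W" "min j q < W" "Suc k < W" "4 < W"
    using lg_le jN pi height_less k by (simp_all add: less_W)
  let ?r = "(fst s)(5 := v, 10 := q, 11 := ?s, 12 := ?t)"
  have upd: "roots_inv qs j (Suc k) (\<sigma>, (snd s)(10 := (snd s 10)(v := chunk_root j v)))"
    if "\<sigma> 0 = fst s 0" "\<sigma> 7 = fst s 7" "\<sigma> 8 = fst s 8" "\<sigma> 3 = Suc k" for \<sigma>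
  proof -
    have "qs ! i \<noteq> v" if "i < k" for i
      using that k len nth_eq_iff_index_eq[OF d, of i k] by (simp add: v_def)
    then show ?thesis
      using inv k that by (auto simp: roots_inv_def pass_state_def tabled_def less_Suc_eq v_def)
  qed
  show ?thesis
  proof (cases "k = 0")
    case True
    then have "v = root" using root0 by (simp add: v_def)
    then have "chunk_root j v = v" using chunk_root_rt by simp
    then have "roots_inv qs j (Suc k) (?r(3 := Suc k), (snd s)(10 := (snd s 10)(v := v)))"
      using upd[of "?r(3 := Suc k)"] by simp
    then show ?thesis
      using mem reg lg pw pt bM bW True by (simp add: roots_body_def min)
  next
    case False
    have nr: "v \<noteq> root"
      using nth_eq_iff_index_eq[OF d, of k 0] root0 False k len N_pos by (simp add: v_def)
    let ?p = "parent_at t v"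
    have p: "?p < N" by (rule par_less[OF v nr])
    \<comment> \<open>The loop follows the breadth-first order, so the chunk root of the parent is
      already known.\<close>
    obtain m where m: "m < k" "qs ! m = ?p" using pf k len nr unfolding parents_first_def v_def by auto
    then have pr: "snd s 10 ?p = chunk_root j ?p" using inv by (auto simp: roots_inv_def)
    have pv: "?p \<noteq> v" using dep_par[OF v nr] by auto
    have memp: "snd s 3 v = ?p" "snd s 8 ?p = potential ?p" using tab v nr p by (auto simp: tabled_def)
    have dN: "depth_at t v < N" using dep_less[OF v] by simp
    have pot: "potential u div n < W" if "u < N" for u n
    proof -
      have "potential u div n \<le> potential u" by simp
      also have "\<dots> \<le> 3 * min (depth_at t u) (height + 1)" by (rule potential_le[OF that])
      also have "\<dots> \<le> 3 * (height + 1)" by (intro mult_le_mono2) simp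
      finally show ?thesis using height_less by (intro less_W) simp
    qed
    have dd: "(depth_at t v - Suc 0) div n < W" "depth_at t v div n < W" "depth_at t v - Suc 0 < W" for n
      by (rule less_W[OF le_trans[OF div_le_dividend]], use dN in linarith)+
        (rule less_W, use dN in linarith)
    have root_v: "chunk_root j v = (if is_cut j v then v else chunk_root j ?p)"
      using chunk_root_rec[OF v, of j] nr by simp
    note cut = is_cut_iff[OF v nr, of j, folded q_def]
    have bp: "?p < M" using p by (simp add: less_M)
    let ?A = "potential ?p div ?s < potential v div ?s"
    let ?B = "(depth_at t v - 1) div ?t < depth_at t v div ?t"
    have "roots_inv qs j (Suc k) (?r(14 := ?p, 3 := Suc k), (snd s)(10 := (snd s 10)(v := chunk_root j v)))"
      using upd[of "?r(14 := ?p, 3 := Suc k)"] by simp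
    then have I': "roots_inv qs j (Suc k) (?r(14 := ?p, 3 := Suc k),
        (snd s)(10 := (snd s 10)(v := if ?A \<or> ?B then v else chunk_root j ?p)))"
      using root_v cut by simp
    define a b d e where "a = potential ?p div ?s" and "b = potential v div ?s"
      and "d = (depth_at t v - Suc 0) div ?t" and "e = depth_at t v div ?t"
    note divs = a_def[symmetric] b_def[symmetric] d_def[symmetric] e_def[symmetric]
    have divW: "a < W" "b < W" "d < W" "e < W" "depth_at t v - Suc 0 < W"
      unfolding a_def b_def d_def e_def using pot[OF v] pot[OF p] dd by blast+
    note I' = I'[unfolded One_nat_def divs]
    consider "a < b" | "\<not> a < b" "d < e" | "\<not> a < b" "\<not> d < e" by blast
    then show ?thesis
    proof cases
      case 1
      have "roots_inv qs j (Suc k) (?r(14 := ?p, 3 := Suc k), (snd s)(10 := (snd s 10)(v := v)))"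
        using I' 1 by simp
      then show ?thesis
        by (simp add: 1 roots_body_def min divs mem memp reg lg pw pt bM bW bp False divW pr pv)
    next
      case 2
      have "roots_inv qs j (Suc k) (?r(14 := ?p, 3 := Suc k), (snd s)(10 := (snd s 10)(v := v)))"
        using I' 2 by simp
      then show ?thesis
        by (simp add: 2 roots_body_def min divs mem memp reg lg pw pt bM bW bp False divW pr pv)
    next
      case 3
      have "roots_inv qs j (Suc k) (?r(14 := ?p, 3 := Suc k), (snd s)(10 := (snd s 10)(v := chunk_root j ?p)))"
        using I' 3 by simp
      then show ?thesis
        by (simp add: 3 roots_body_def min divs mem memp reg lg pw pt bM bW bp False divW pr pv)
    qed
  qed
qed

definition keyed :: "nat list \<Rightarrow> nat \<Rightarrow> mach \<Rightarrow> bool" where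
  "keyed qs j s \<longleftrightarrow> pass_state qs j s \<and> (\<forall>v<N. snd s 10 v = chunk_root j v)"

lemma roots_correct:
  assumes "pass_state qs j s" "j \<le> height"
  shows "hoare (for_nodes roots_body) s (3 + (N * (time_cmd roots_body + 1) + 1)) (keyed qs j)"
proof -
  have "hoare (for_nodes roots_body) s (3 + (N * (time_cmd roots_body + 1) + 1)) (roots_inv qs j N)"
  proof (rule hoare_for_nodes)
    show "roots_inv qs j 0 ((fst s)(3 := 0), snd s)"
      using assms(1) by (simp add: roots_inv_def pass_state_def tabled_def)
    show "k \<le> N \<and> fst s 3 = k \<and> fst s 0 = N" if "roots_inv qs j k s" for k s
      using that by (simp add: roots_inv_def pass_state_def tabled_def)
  qed (use roots_step assms(2) in blast)
  then show ?thesis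
  proof (rule hoare_conseq)
    fix s assume inv: "roots_inv qs j N s"
    then have qs: "distinct qs" "set qs = {..<N}" by (auto simp: roots_inv_def pass_state_def tabled_def)
    have "snd s 10 v = chunk_root j v" if "v < N" for v
    proof -
      have "v \<in> set qs" using qs(2) that by simp
      then obtain i where "i < N" "qs ! i = v" using order_length[OF qs] by (auto simp: in_set_conv_nth)
      then show ?thesis using inv by (auto simp: roots_inv_def)
    qed
    then show "keyed qs j s" using inv by (simp add: keyed_def roots_inv_def)
  qed simp
qed

text \<open>A frame rule: the counting sort works in arrays 12 and 13 and in scratch registers, none
  of which \<open>keyed\<close> mentions.\<close>

lemma keyed_update:
  assumes "keyed qs j s" "\<sigma> 0 = fst s 0" "\<sigma> 7 = fst s 7" "\<sigma> 8 = fst s 8"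
    and "\<And>a. a \<le> 11 \<Longrightarrow> A a = snd s a"
  shows "keyed qs j (\<sigma>, A)"
  using assms by (simp add: keyed_def pass_state_def tabled_def)

lemma keyed_reg: "keyed qs j s \<Longrightarrow> fst s 0 = N"
  by (simp add: keyed_def pass_state_def tabled_def)

lemma clear_correct:
  assumes "keyed qs j s"
  shows "hoare ((Asg 3 (C 0) ;; Asg 9 (Op Add (V 0) (C 1))) ;; Whl 3 9 clear_body) s
    (time_cmd (Asg 3 (C 0) ;; Asg 9 (Op Add (V 0) (C 1))) + ((N + 1) * (time_cmd clear_body + 1) + 1))
    (\<lambda>s. keyed qs j s \<and> (\<forall>i\<le>N. snd s 13 i = 0))"
proof -
  define I where "I = (\<lambda>k s. keyed qs j s \<and> k \<le> N + 1 \<and> fst s 3 = k \<and> fst s 9 = N + 1 \<and>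
    (\<forall>i<k. snd s 13 i = 0))"
  show ?thesis
  proof (rule hoare_seq[where P = "I 0"], rule hoare_wp)
    have "keyed qs j ((fst s)(3 := 0, 9 := N + 1), snd s)" using assms by (rule keyed_update) simp_all
    then show "wp (Asg 3 (C 0) ;; Asg 9 (Op Add (V 0) (C 1))) s (I 0)"
      using keyed_reg[OF assms] by (simp add: I_def less_W)
  next
    fix s assume "I 0 s"
    then have "hoare (Whl 3 9 clear_body) s ((N + 1) * (time_cmd clear_body + 1) + 1) (I (N + 1))"
    proof (rule hoare_for)
      fix k s assume inv: "I k s" and k: "k < N + 1"
      have "keyed qs j ((fst s)(3 := Suc k), (snd s)(13 := (snd s 13)(k := 0)))"
        using inv by (intro keyed_update[where s = s]) (simp_all add: I_def)
      then have "I (Suc k) ((fst s)(3 := Suc k), (snd s)(13 := (snd s 13)(k := 0)))"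
        using inv k by (auto simp: I_def less_Suc_eq)
      then show "wp clear_body s (I (Suc k))"
        using inv k by (simp add: clear_body_def I_def less_M less_W)
    qed (auto simp: I_def)
    then show "hoare (Whl 3 9 clear_body) s ((N + 1) * (time_cmd clear_body + 1) + 1)
      (\<lambda>s. keyed qs j s \<and> (\<forall>i\<le>N. snd s 13 i = 0))"
      by (rule hoare_conseq) (auto simp: I_def)
  qed
qed

abbreviation "start j \<equiv> bucket_start (chunk_root j) (layout_pass j)"
abbreviation "fill j \<equiv> bucket_fill (chunk_root j) (layout_pass j)"

lemma start_le: "k \<le> N \<Longrightarrow> start j k \<le> N"
  using bucket_start_mono[of k N "chunk_root j" "layout_pass j"] layout_pass_length[of "Suc j"]
  by (simp add: bucket_start_def)

lemma fill_le: "length (fill j i k) \<le> N"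
  using length_filter_le[of "\<lambda>v. chunk_root j v = k" "take i (layout_pass j)"] layout_pass_length[of j]
  unfolding bucket_fill_def by simp

lemma count_correct:
  assumes "keyed qs j s" "\<forall>i\<le>N. snd s 13 i = 0"
  shows "hoare (for_nodes count_body) s (3 + (N * (time_cmd count_body + 1) + 1))
    (\<lambda>s. keyed qs j s \<and> snd s 13 0 = 0 \<and> (\<forall>i<N. snd s 13 (Suc i) = length (fill j N i)))"
proof -
  define I where "I = (\<lambda>k s. keyed qs j s \<and> k \<le> N \<and> fst s 3 = k \<and> snd s 13 0 = 0 \<and>
    (\<forall>i<N. snd s 13 (Suc i) = length (fill j k i)))"
  have "hoare (for_nodes count_body) s (3 + (N * (time_cmd count_body + 1) + 1)) (I N)"
  proof (rule hoare_for_nodes)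
    have "keyed qs j ((fst s)(3 := 0), snd s)" using assms(1) by (rule keyed_update) simp_all
    then show "I 0 ((fst s)(3 := 0), snd s)" using assms(2) by (simp add: I_def bucket_fill_0)
    show "k \<le> N \<and> fst s 3 = k \<and> fst s 0 = N" if "I k s" for k s
      using that keyed_reg[of qs j s] by (simp add: I_def)
  next
    fix k s assume inv: "I k s" and k: "k < N"
    let ?v = "layout_pass j ! k"
    let ?c = "chunk_root j ?v"
    have v: "?v < N" "?c < N" using layout_pass_nth[OF k] chunk_root_less by auto
    have mem: "snd s 11 k = ?v" "snd s 10 ?v = ?c"
      using inv k v by (auto simp: I_def keyed_def pass_state_def)
    have cnt: "snd s 13 (Suc ?c) = length (fill j k ?c)" "fst s 3 = k" using inv v by (simp_all add: I_def)
    let ?A = "(snd s)(13 := (snd s 13)(Suc ?c := Suc (length (fill j k ?c))))"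
    have "keyed qs j ((fst s)(5 := Suc ?c, 3 := Suc k), ?A)"
      using inv by (intro keyed_update[where s = s]) (simp_all add: I_def)
    then have "I (Suc k) ((fst s)(5 := Suc ?c, 3 := Suc k), ?A)"
      using inv k by (simp add: I_def bucket_fill_Suc layout_pass_length)
    moreover have "Suc (length (fill j k ?c)) < W" using fill_le[of j k ?c] by (simp add: less_W)
    ultimately show "wp count_body s (I (Suc k))"
      using cnt k v mem by (simp add: count_body_def less_M less_W)
  qed
  then show ?thesis by (rule hoare_conseq) (auto simp: I_def)
qed

lemma prefix_correct:
  assumes "keyed qs j s" "snd s 13 0 = 0" "\<forall>i<N. snd s 13 (Suc i) = length (fill j N i)"
  shows "hoare (for_nodes prefix_body) s (3 + (N * (time_cmd prefix_body + 1) + 1))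
    (\<lambda>s. keyed qs j s \<and> (\<forall>i\<le>N. snd s 13 i = start j i))"
proof -
  define I where "I = (\<lambda>k s. keyed qs j s \<and> k \<le> N \<and> fst s 3 = k \<and> (\<forall>i\<le>k. snd s 13 i = start j i) \<and>
    (\<forall>i<N. k \<le> i \<longrightarrow> snd s 13 (Suc i) = length (fill j N i)))"
  have "hoare (for_nodes prefix_body) s (3 + (N * (time_cmd prefix_body + 1) + 1)) (I N)"
  proof (rule hoare_for_nodes)
    have "keyed qs j ((fst s)(3 := 0), snd s)" using assms(1) by (rule keyed_update) simp_all
    then show "I 0 ((fst s)(3 := 0), snd s)" using assms by (simp add: I_def bucket_start_0)
    show "k \<le> N \<and> fst s 3 = k \<and> fst s 0 = N" if "I k s" for k s
      using that keyed_reg[of qs j s] by (simp add: I_def)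
  next
    fix k s assume inv: "I k s" and k: "k < N"
    have start: "length (fill j N k) + start j k = start j (Suc k)"
      by (simp add: bucket_start_Suc layout_pass_length)
    let ?A = "(snd s)(13 := (snd s 13)(Suc k := start j (Suc k)))"
    have "keyed qs j ((fst s)(5 := Suc k, 3 := Suc k), ?A)"
      using inv by (intro keyed_update[where s = s]) (simp_all add: I_def)
    then have "I (Suc k) ((fst s)(5 := Suc k, 3 := Suc k), ?A)"
      using inv k by (simp add: I_def le_Suc_eq)
    moreover have "start j (Suc k) < W" using start_le[of "Suc k" j] k by (simp add: less_W)
    moreover have "fst s 3 = k" "snd s 13 k = start j k" "snd s 13 (Suc k) = length (fill j N k)"
      using inv k by (simp_all add: I_def)
    ultimately show "wp prefix_body s (I (Suc k))"
      using k start by (simp add: prefix_body_def less_M less_W)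
  qed
  then show ?thesis by (rule hoare_conseq) (auto simp: I_def)
qed

text \<open>After \<open>k\<close> elements the counter of each bucket points just behind its filled
  part. The old order is read from left to right, which yields stability.\<close>

lemma place_correct:
  assumes "keyed qs j s" "\<forall>i\<le>N. snd s 13 i = start j i"
  shows "hoare (for_nodes place_body) s (3 + (N * (time_cmd place_body + 1) + 1))
    (\<lambda>s. keyed qs j s \<and> (\<forall>i<N. snd s 12 i = layout_pass (Suc j) ! i))"
proof -
  define I where "I = (\<lambda>k s. keyed qs j s \<and> k \<le> N \<and> fst s 3 = k \<and>
    (\<forall>c<N. snd s 13 c = start j c + length (fill j k c)) \<and>
    (\<forall>c<N. \<forall>m<length (fill j k c). snd s 12 (start j c + m) = fill j k c ! m))"
  have "hoare (for_nodes place_body) s (3 + (N * (time_cmd place_body + 1) + 1)) (I N)"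
  proof (rule hoare_for_nodes)
    have "keyed qs j ((fst s)(3 := 0), snd s)" using assms(1) by (rule keyed_update) simp_all
    then show "I 0 ((fst s)(3 := 0), snd s)" using assms by (simp add: I_def bucket_fill_0)
    show "k \<le> N \<and> fst s 3 = k \<and> fst s 0 = N" if "I k s" for k s
      using that keyed_reg[of qs j s] by (simp add: I_def)
  next
    fix k s assume inv: "I k s" and k: "k < N"
    let ?v = "layout_pass j ! k"
    let ?c = "chunk_root j ?v"
    have v: "?v < N" "?c < N" using layout_pass_nth[OF k] chunk_root_less by auto
    have mem: "snd s 11 k = ?v" "snd s 10 ?v = ?c"
      using inv k v by (auto simp: I_def keyed_def pass_state_def)
    let ?l = "length (fill j k ?c)"
    let ?pos = "start j ?c + ?l"
    have cnt: "snd s 13 ?c = ?pos" using inv v by (simp add: I_def)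
    have less: "?l < length (fill j N ?c)"
      using bucket_fill_less[of k "layout_pass j" "chunk_root j"] k by (simp add: layout_pass_length)
    have "?pos < start j (Suc ?c)" using less by (simp add: bucket_start_Suc layout_pass_length)
    also have "\<dots> \<le> N" using v by (intro start_le) simp
    finally have pos: "?pos < N" .
    let ?A = "(snd s)(12 := (snd s 12)(?pos := ?v), 13 := (snd s 13)(?c := Suc ?pos))"
    have fillS: "fill j (Suc k) c = (if ?c = c then fill j k c @ [?v] else fill j k c)" for c
      using k by (simp add: bucket_fill_Suc layout_pass_length)
    have other: "start j c + m \<noteq> ?pos" if "m < length (fill j k c)" "c \<noteq> ?c" for c m
    proof (rule bucket_positions_distinct)
      show "m < length (fill j (length (layout_pass j)) c)"
        using that(1) bucket_fill_le[of "chunk_root j" "layout_pass j" k c] by linarith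
      show "?l < length (fill j (length (layout_pass j)) ?c)" using less by (simp add: layout_pass_length)
    qed (rule that(2))
    have "keyed qs j ((fst s)(5 := ?v, 6 := ?c, 3 := Suc k), ?A)"
      using inv by (intro keyed_update[where s = s]) (simp_all add: I_def)
    moreover have "?A 13 c = start j c + length (fill j (Suc k) c)" if "c < N" for c
      using inv that unfolding fillS by (simp add: I_def)
    moreover have "?A 12 (start j c + m) = fill j (Suc k) c ! m"
      if "c < N" "m < length (fill j (Suc k) c)" for c m
    proof (cases "c = ?c")
      case True
      show ?thesis
      proof (cases "m = ?l")
        case False
        then have "m < ?l" using that True unfolding fillS by simp
        then show ?thesis using inv v True unfolding fillS by (simp add: I_def nth_append)
      qed (use True fillS in simp)
    next
      case False
      then have m: "m < length (fill j k c)" using that(2) unfolding fillS by simp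
      have "?A 12 (start j c + m) = snd s 12 (start j c + m)" using other[OF m False] by simp
      also have "\<dots> = fill j k c ! m" using inv that(1) m unfolding I_def by blast
      finally show ?thesis using False unfolding fillS by simp
    qed
    ultimately have "I (Suc k) ((fst s)(5 := ?v, 6 := ?c, 3 := Suc k), ?A)"
      using k by (simp only: I_def fst_conv snd_conv) simp
    moreover have "Suc ?pos < W" using pos by (simp add: less_W)
    moreover have "fst s 3 = k" using inv by (simp add: I_def)
    ultimately show "wp place_body s (I (Suc k))"
      using k v mem cnt pos by (simp add: place_body_def less_M less_W)
  qed
  then show ?thesis
  proof (rule hoare_conseq)
    fix s assume inv: "I N s"
    have "snd s 12 i = layout_pass (Suc j) ! i" if "i < N" for i
      unfolding layout_pass.simps
    proof (rule bucket_sort_nth)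
      show "snd s 12 (start j c + m) = fill j (length (layout_pass j)) c ! m"
        if "c < N" "m < length (fill j (length (layout_pass j)) c)" for c m
        using inv that by (simp add: I_def layout_pass_length)
      show "i < length (bucket_sort N (chunk_root j) (layout_pass j))"
        using layout_pass_length[of "Suc j"] that by simp
    qed
    then show "keyed qs j s \<and> (\<forall>i<N. snd s 12 i = layout_pass (Suc j) ! i)"
      using inv by (simp add: I_def)
  qed simp
qed

lemma copy_correct:
  assumes "keyed qs j s" "\<forall>i<N. snd s 12 i = layout_pass (Suc j) ! i"
  shows "hoare (for_nodes (copy_body 11 12)) s (3 + (N * (time_cmd (copy_body 11 12) + 1) + 1))
    (\<lambda>s. tabled qs s \<and> fst s 8 = j \<and> (\<forall>i<N. snd s 11 i = layout_pass (Suc j) ! i))"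
proof -
  define I where "I = (\<lambda>k s. tabled qs s \<and> fst s 8 = j \<and> k \<le> N \<and> fst s 3 = k \<and>
    (\<forall>i<N. snd s 12 i = layout_pass (Suc j) ! i) \<and> (\<forall>i<k. snd s 11 i = layout_pass (Suc j) ! i))"
  have "hoare (for_nodes (copy_body 11 12)) s (3 + (N * (time_cmd (copy_body 11 12) + 1) + 1)) (I N)"
  proof (rule hoare_for_nodes)
    show "I 0 ((fst s)(3 := 0), snd s)"
      using assms by (simp add: I_def keyed_def pass_state_def tabled_def)
    show "k \<le> N \<and> fst s 3 = k \<and> fst s 0 = N" if "I k s" for k s
      using that by (auto simp: I_def tabled_def)
  next
    fix k s assume inv: "I k s" and k: "k < N"
    have "I (Suc k) ((fst s)(3 := Suc k), (snd s)(11 := (snd s 11)(k := layout_pass (Suc j) ! k)))"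
      using inv k by (simp add: I_def tabled_def less_Suc_eq)
    then show "wp (copy_body 11 12) s (I (Suc k))"
      using inv k by (simp add: copy_body_def I_def less_M less_W)
  qed
  then show ?thesis by (rule hoare_conseq) (auto simp: I_def)
qed

lemma pass_correct:
  assumes "pass_state qs j s" "j \<le> height"
  shows "hoare pass s (300 * (N + 1)) (\<lambda>s. pass_state qs (Suc j) s \<and> fst s 15 = height + 1)"
proof -
  have jN: "j < N" using assms(2) height_less by simp
  have "hoare pass s
    ((3 + (N * (time_cmd roots_body + 1) + 1)) +
     ((time_cmd (Asg 3 (C 0) ;; Asg 9 (Op Add (V 0) (C 1))) + ((N + 1) * (time_cmd clear_body + 1) + 1)) +
     ((3 + (N * (time_cmd count_body + 1) + 1)) + ((3 + (N * (time_cmd prefix_body + 1) + 1)) +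
     ((3 + (N * (time_cmd place_body + 1) + 1)) + ((3 + (N * (time_cmd (copy_body 11 12) + 1) + 1)) +
       time_cmd (inc 8 ;; Asg 15 (Op Add (V 7) (C 1))))))))) (\<lambda>s. pass_state qs (Suc j) s \<and> fst s 15 = height + 1)"
    unfolding pass_def
  proof (rule hoare_seq[OF roots_correct[OF assms]], rule hoare_seq[OF clear_correct], assumption,
      elim conjE, rule hoare_seq[OF count_correct], assumption, assumption,
      elim conjE, rule hoare_seq[OF prefix_correct], assumption, assumption, assumption,
      elim conjE, rule hoare_seq[OF place_correct], assumption, assumption,
      elim conjE, rule hoare_seq[OF copy_correct], assumption, assumption, elim conjE)
    fix s assume "tabled qs s" "fst s 8 = j" "\<forall>i<N. snd s 11 i = layout_pass (Suc j) ! i"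
    then show "hoare (inc 8 ;; Asg 15 (Op Add (V 7) (C 1))) s (time_cmd (inc 8 ;; Asg 15 (Op Add (V 7) (C 1))))
        (\<lambda>s. pass_state qs (Suc j) s \<and> fst s 15 = height + 1)"
      using jN height_less by (intro hoare_wp) (simp add: pass_state_def tabled_def less_W)
  qed
  then show ?thesis
    by (rule hoare_conseq) (simp_all add: roots_body_def clear_body_def count_body_def prefix_body_def
      place_body_def copy_body_def)
qed

lemma passes_correct:
  assumes "tabled qs s" "\<forall>i<N. snd s 11 i = i"
  shows "hoare passes s (9 + ((height + 1) * (300 * (N + 1) + 1) + 1))
    (\<lambda>s. fst s 0 = N \<and> (\<forall>i<N. snd s 11 i = layout ! i))"
proof -
  define I where "I = (\<lambda>j s. pass_state qs j s \<and> j \<le> height + 1 \<and> fst s 15 = height + 1)"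
  show ?thesis
    unfolding passes_def
  proof (rule hoare_seq[where P = "I 0"])
    have "I 0 ((fst s)(8 := 0, 15 := height + 1), snd s)"
      using assms by (simp add: I_def pass_state_def tabled_def)
    then have "wp (Asg 8 (C 0) ;; Asg 15 (Op Add (V 7) (C 1))) s (I 0)"
      using assms height_less by (simp add: tabled_def less_W)
    then show "hoare (Asg 8 (C 0) ;; Asg 15 (Op Add (V 7) (C 1))) s 9 (I 0)"
      by (rule hoare_conseq[OF hoare_wp]) simp_all
  next
    fix s assume "I 0 s"
    then show "hoare (Whl 8 15 pass) s ((height + 1) * (300 * (N + 1) + 1) + 1)
      (\<lambda>s. fst s 0 = N \<and> (\<forall>i<N. snd s 11 i = layout ! i))"
    proof (rule hoare_while[where I = I])
      fix j s assume "I j s" "fst s 8 < fst s 15"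
      then have j: "pass_state qs j s" "j \<le> height" by (simp_all add: I_def pass_state_def)
      have "hoare pass s (300 * (N + 1)) (I (Suc j))"
        by (rule hoare_conseq[OF pass_correct[OF j]]) (use j in \<open>simp_all add: I_def\<close>)
      with j(2) show "j < height + 1 \<and> hoare pass s (300 * (N + 1)) (I (Suc j))" by simp
    next
      fix j s assume "I j s" "\<not> fst s 8 < fst s 15"
      then show "fst s 0 = N \<and> (\<forall>i<N. snd s 11 i = layout ! i)"
        by (auto simp: I_def pass_state_def tabled_def layout_def)
    qed simp_all
  qed
qed

end

subsection \<open>The complete program\<close>

definition layout_body :: cmd where
  "layout_body = bfs ;; sizes ;; logs ;; powers ;; potentials ;; passes ;; for_nodes (copy_body 0 11)"

text \<open>The two leading instructions put the stride N + 2 into register 2. The conditional skips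
  the empty tree, which has no root.\<close>

definition layout_ram :: ram_prog where
  "layout_ram = Seq (Const 2 2) (Seq (Arith Add 2 2 0) (compile (Cnd (C 0) (V 0) layout_body Nop)))"

definition layout_time :: "nat \<Rightarrow> nat" where
  "layout_time n = 2000 * ((floor_log n + 1) * (n + 1)) + 20"

definition tree_layout :: "nat tree \<Rightarrow> nat list" where
  "tree_layout t = (if t = Leaf then [] else
     rooted_tree.layout (size t) (tree_ptr t - 1) (parent_at t) (depth_at t) (subtree_size t))"

context layout_program
begin

lemma output_correct:
  assumes "fst s 0 = N" "\<forall>i<N. snd s 11 i = layout ! i"
  shows "hoare (for_nodes (copy_body 0 11)) s (3 + (N * (time_cmd (copy_body 0 11) + 1) + 1))
    (\<lambda>s. \<forall>i<N. snd s 0 i = layout ! i)"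
proof -
  define I :: "nat \<Rightarrow> mach \<Rightarrow> bool" where "I = (\<lambda>k s. fst s 0 = N \<and> k \<le> N \<and> fst s 3 = k \<and>
    (\<forall>i<N. snd s 11 i = layout ! i) \<and> (\<forall>i<k. snd s 0 i = layout ! i))"
  have "hoare (for_nodes (copy_body 0 11)) s (3 + (N * (time_cmd (copy_body 0 11) + 1) + 1)) (I N)"
  proof (rule hoare_for_nodes)
    show "I 0 ((fst s)(3 := 0), snd s)" using assms by (simp add: I_def)
    show "k \<le> N \<and> fst s 3 = k \<and> fst s 0 = N" if "I k s" for k s
      using that by (simp add: I_def)
  next
    fix k s assume inv: "I k s" and k: "k < N"
    have "I (Suc k) ((fst s)(3 := Suc k), (snd s)(0 := (snd s 0)(k := layout ! k)))"
      using inv k by (simp add: I_def less_Suc_eq)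
    moreover have "fst s 3 = k" "snd s 11 k = layout ! k" using inv k by (simp_all add: I_def)
    moreover have "k < 2 * M" "k < M" "Suc k < W" using k less_M[of k] by (simp_all add: less_W)
    ultimately show "wp (copy_body 0 11) s (I (Suc k))"
      by (simp add: copy_body_def)
  qed
  then show ?thesis by (rule hoare_conseq) (auto simp: I_def)
qed

lemma layout_body_correct:
  assumes "stage0 s"
  shows "hoare layout_body s (2000 * ((height + 1) * (N + 1))) (\<lambda>s. \<forall>i<N. snd s 0 i = layout ! i)"
proof -
  have bfs: "hoare bfs s (300 * (N + 1)) (\<lambda>s. \<exists>qs. stage1 qs s)"
    by (rule hoare_conseq[OF bfs_correct[OF assms]]) (simp_all add: bfs_body_def visit_def)
  have sizes: "hoare sizes s (100 * (N + 1))
      (\<lambda>s. sized qs s \<and> (\<forall>a\<ge>6. snd s a = (\<lambda>_. 0)))"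
    if "stage1 qs s" for qs s
    by (rule hoare_conseq[OF sizes_correct]) (use stage1_ordered[OF that] in \<open>simp_all add: sizes_body_def\<close>)
  have logs: "hoare logs s (100 * (N + 1)) (logged qs)"
    if "sized qs s \<and> (\<forall>a\<ge>6. snd s a = (\<lambda>_. 0))" for qs s
    by (rule hoare_conseq[OF logs_correct]) (use that in \<open>simp_all add: logs_body_def\<close>)
  have powers: "hoare powers s (100 * (N + 1)) (\<lambda>s. logged qs s \<and> (\<forall>e\<le>height + 2. snd s 7 e = 2 ^ e))"
    if "logged qs s" for qs s
    by (rule hoare_conseq[OF powers_correct[OF that]]) (use height_less in \<open>simp_all add: powers_body_def\<close>)
  have potentials: "hoare potentials s (100 * (N + 1)) (\<lambda>s. tabled qs s \<and> (\<forall>i<N. snd s 11 i = i))"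
    if "logged qs s \<and> (\<forall>e\<le>height + 2. snd s 7 e = 2 ^ e)" for qs s
    by (rule hoare_conseq[OF potentials_correct]) (use that in \<open>simp_all add: potentials_body_def\<close>)
  have passes: "hoare passes s (9 + ((height + 1) * (300 * (N + 1) + 1) + 1))
      (\<lambda>s. fst s 0 = N \<and> (\<forall>i<N. snd s 11 i = layout ! i))"
    if "tabled qs s \<and> (\<forall>i<N. snd s 11 i = i)" for qs s
    using passes_correct that by blast
  have out: "hoare (for_nodes (copy_body 0 11)) s (100 * (N + 1)) (\<lambda>s. \<forall>i<N. snd s 0 i = layout ! i)"
    if "fst s 0 = N \<and> (\<forall>i<N. snd s 11 i = layout ! i)" for s
    by (rule hoare_conseq[OF output_correct]) (use that in \<open>simp_all add: copy_body_def\<close>)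
  let ?n = "100 * (N + 1)"
  let ?T = "?n + (?n + (?n + (?n + ((9 + ((height + 1) * (300 * (N + 1) + 1) + 1)) + ?n))))"
  have "hoare layout_body s (300 * (N + 1) + ?T) (\<lambda>s. \<forall>i<N. snd s 0 i = layout ! i)"
    unfolding layout_body_def
  proof (rule hoare_seq[OF bfs], elim exE)
    fix s qs assume "stage1 qs s"
    then show "hoare (sizes ;; logs ;; powers ;; potentials ;; passes ;; for_nodes (copy_body 0 11)) s
      ?T (\<lambda>s. \<forall>i<N. snd s 0 i = layout ! i)"
      by (intro hoare_seq[OF sizes] hoare_seq[OF logs] hoare_seq[OF powers] hoare_seq[OF potentials]
        hoare_seq[OF passes] out) assumption+
  qed
  moreover have "N + 1 \<le> (height + 1) * (N + 1)" by simp
  then have "300 * (N + 1) + ?T \<le> 2000 * ((height + 1) * (N + 1))"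
    by (simp add: algebra_simps)
  ultimately show ?thesis by (rule hoare_conseq) simp
qed

end

section \<open>Initial memory and word size\<close>

lemma store_tree_cell:
  assumes "node_numbered t"
  shows "store_tree t (\<lambda>_. 0) (2 * v) \<le> size t \<and> store_tree t (\<lambda>_. 0) (Suc (2 * v)) \<le> size t \<and>
    (size t \<le> v \<longrightarrow> store_tree t (\<lambda>_. 0) (2 * v) = 0 \<and> store_tree t (\<lambda>_. 0) (Suc (2 * v)) = 0)"
proof (cases "v \<in> set_tree t")
  case True
  have d: "distinct (inorder t)" and nodes: "set_tree t = {..<size t}"
    using assms by (auto simp: node_numbered_def)
  have "left_ptr t v \<le> size t"
    using left_ptr_in[of t v "left_ptr t v - 1"] nodes by (cases "left_ptr t v = 0") auto
  moreover have "right_ptr t v \<le> size t"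
    using right_ptr_in[of t v "right_ptr t v - 1"] nodes by (cases "right_ptr t v = 0") auto
  moreover have "v < size t" using True nodes by simp
  ultimately show ?thesis using store_tree_children[OF d True, of "\<lambda>_. 0"] by simp
next
  case False
  then show ?thesis by (simp add: store_tree_outside)
qed

lemma store_tree_value:
  assumes "node_numbered t"
  shows "store_tree t (\<lambda>_. 0) x \<le> size t" and "2 * size t \<le> x \<Longrightarrow> store_tree t (\<lambda>_. 0) x = 0"
proof -
  obtain v where "x = 2 * v \<or> x = Suc (2 * v)" by (metis evenE oddE Suc_eq_plus1)
  then show "store_tree t (\<lambda>_. 0) x \<le> size t" and "2 * size t \<le> x \<Longrightarrow> store_tree t (\<lambda>_. 0) x = 0"
    using store_tree_cell[OF assms, of v] by (elim disjE; simp)+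
qed

lemma tree_ptr_le: "node_numbered t \<Longrightarrow> tree_ptr t \<le> size t"
  by (cases t) (auto simp: node_numbered_def)

text \<open>The origin of the exponent 9: eight factors of at least 2 give 256, and the ninth is the
  stride.\<close>

lemma word_size: "256 * (n + 2) \<le> ((n::nat) + 2) ^ 9"
proof -
  have "(2::nat) ^ 8 \<le> (n + 2) ^ 8" by (intro power_mono) simp_all
  then have "2 ^ 8 * (n + 2) \<le> (n + 2) ^ 8 * (n + 2)" by (rule mult_le_mono1)
  moreover have "(n + 2) ^ (8 + 1) = (n + 2) ^ 8 * (n + 2)" by (simp only: power_add power_one_right)
  ultimately show ?thesis by simp
qed

lemma layout_ram_computes: "ram_computes layout_ram 9 tree_layout layout_time"
  unfolding ram_computes_def
proof (intro allI impI)
  fix t :: "nat tree" assume t: "node_numbered t"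
  define W where "W = (size t + 2) ^ 9"
  define M where "M = size t + 2"
  have big: "256 * M \<le> W" using word_size[of "size t"] by (simp add: W_def M_def)
  interpret ram W M using big by unfold_locales (simp_all add: M_def)
  let ?m = "store_tree t (\<lambda>_. 0)"
  define r where "r = (((\<lambda>_. 0)(0 := size t, 1 := tree_ptr t))(2 := 2) :: nat \<Rightarrow> nat)"
  define r' where "r' = r(2 := M)"
  have start: "exec W (Const 2 2) (input_state t) 1 (r, ?m)"
    "exec W (Arith Add 2 2 0) (r, ?m) 1 (r', ?m)"
  proof -
    show "exec W (Const 2 2) (input_state t) 1 (r, ?m)"
      unfolding input_state_def r_def using big M_def by (intro exec.Const) linarith
    show "exec W (Arith Add 2 2 0) (r, ?m) 1 (r', ?m)"
      using exec.Arith[of Add r 2 0 W 2 ?m] big by (simp add: r_def r'_def M_def add.commute)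
  qed
  \<comment> \<open>The abstract arrays are views of the flat memory at multiples of the stride. The
    child pointers occupy cells below \<open>2 * M\<close> and so become array 0, while all other
    arrays read as zero.\<close>
  define s where "s = (r', \<lambda>a i. ?m (a * M + i))"
  have rep: "represents s (r', ?m)"
    unfolding represents_def
  proof (intro conjI allI impI)
    show "fst (r', ?m) x < W" for x
      using big tree_ptr_le[OF t] by (auto simp: r'_def r_def M_def)
    show "snd (r', ?m) x < W" for x
      using big store_tree_value(1)[OF t, of x] by (simp add: M_def)
  qed (simp_all add: s_def r'_def)
  have s0: "fst s 0 = size t" by (simp add: s_def r'_def r_def)
  have "hoare (Cnd (C 0) (V 0) layout_body Nop) s (layout_time (size t) - 2)
    (\<lambda>s. \<forall>i<size t. snd s 0 i = tree_layout t ! i)"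
  proof (cases t)
    case Leaf
    have "hoare (Cnd (C 0) (V 0) layout_body Nop) s
        (time_expr (C 0) + time_expr (V 0) + 1 + max 0 (time_cmd Nop)) (\<lambda>s. True)"
      using s0 Leaf W by (intro hoare_Cnd hoare_wp) simp_all
    then show ?thesis by (rule hoare_conseq) (simp_all add: layout_time_def Leaf)
  next
    case (Node l x u)
    interpret layout_program t x W M
      using t big Node by unfold_locales (simp_all add: M_def)
    have eq: "tree_layout t = layout" using Node by (simp add: tree_layout_def)
    have "stage0 s"
      unfolding stage0_def
    proof (intro conjI allI impI)
      show "fst s 0 = size t" by (rule s0)
      show "fst s 1 = Suc x" using Node by (simp add: s_def r'_def r_def)
      show "snd s 0 (2 * v) = left_ptr t v" "snd s 0 (Suc (2 * v)) = right_ptr t v" if "v < size t" for v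
        using store_tree_children[OF dist, of v "\<lambda>_. 0"] node_iff that by (simp_all add: s_def)
      show "snd s a = (\<lambda>_. 0)" if "2 \<le> a" for a
      proof
        fix i
        have "2 * M \<le> a * M" using that by simp
        then have "2 * size t \<le> a * M + i" by (simp add: M_def)
        then show "snd s a i = 0" using store_tree_value(2)[OF t] by (simp add: s_def)
      qed
    qed
    then have body: "hoare layout_body s (2000 * ((height + 1) * (N + 1))) (\<lambda>s. \<forall>i<N. snd s 0 i = layout ! i)"
      by (rule layout_body_correct)
    have "hoare (Cnd (C 0) (V 0) layout_body Nop) s
        (time_expr (C 0) + time_expr (V 0) + 1 + max (2000 * ((height + 1) * (N + 1))) (time_cmd Nop))
        (\<lambda>s. \<forall>i<N. snd s 0 i = layout ! i)"
      using s0 N_pos by (intro hoare_Cnd body) simp_all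
    then show ?thesis
      by (rule hoare_conseq) (simp_all add: layout_time_def height_def eq)
  qed
  then obtain n q' s' where run: "exec W (compile (Cnd (C 0) (V 0) layout_body Nop)) (r', ?m) n q'"
    "n \<le> layout_time (size t) - 2" "represents s' q'" "\<forall>i<size t. snd s' 0 i = tree_layout t ! i"
    using rep unfolding hoare_def by blast
  obtain rf mf where q': "q' = (rf, mf)" by (cases q')
  have "exec W layout_ram (input_state t) (1 + (1 + n)) (rf, mf)"
    unfolding layout_ram_def using start run(1) q' by (blast intro: exec.Seq)
  moreover have "1 + (1 + n) \<le> layout_time (size t)" using run(2) by (simp add: layout_time_def)
  moreover have "map mf [0..<size t] = tree_layout t"
  proof (rule nth_equalityI)
    show "length (map mf [0..<size t]) = length (tree_layout t)"
    proof (cases t)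
      case (Node l x u)
      interpret numbered_tree t x using t Node by unfold_locales simp_all
      show ?thesis using Node length_layout by (simp add: tree_layout_def)
    qed (simp add: tree_layout_def)
    fix i assume "i < length (map mf [0..<size t])"
    then have i: "i < size t" by simp
    have "valid 0 i" unfolding valid_def using i by (simp add: M_def)
    moreover have "\<forall>a i. valid a i \<longrightarrow> mf (a * M + i) = snd s' a i"
      using run(3) unfolding q' represents_def by simp
    ultimately have "mf (0 * M + i) = snd s' 0 i" by blast
    then show "map mf [0..<size t] ! i = tree_layout t ! i" using i run(4) by simp
  qed
  ultimately show "\<exists>n r m. exec ((size t + 2) ^ 9) layout_ram (input_state t) n (r, m) \<and>
      n \<le> layout_time (size t) \<and> map m [0..<size t] = tree_layout t"
    unfolding W_def by (intro exI conjI)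
qed

text \<open>For N at least 2 both \<open>floor_log N + 1\<close> and \<open>N + 1\<close> at most
  double lg N and N, so the constant is 2000 * 4 plus the additive 20.\<close>

lemma layout_time_bigo: "(\<lambda>N. real (layout_time N)) \<in> O(\<lambda>N. real N * log 2 (real N))"
proof (rule bigoI[where c = 8020], rule eventually_at_top_linorderI[of 2])
  fix N :: nat assume N: "2 \<le> N"
  have l: "1 \<le> log 2 (real N)" using N by (simp add: le_log_iff)
  have "2 ^ floor_log N \<le> N" using N by (intro floor_log_exp2_le) simp
  then have "real (2 ^ floor_log N) \<le> real N" by (rule of_nat_mono)
  then have "real (floor_log N) \<le> log 2 (real N)" using N by (simp add: le_log_iff powr_realpow)
  then have "real (floor_log N + 1) \<le> 2 * log 2 (real N)" using l by simp
  moreover have "real (N + 1) \<le> 2 * real N" using N by simp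
  ultimately have "real (floor_log N + 1) * real (N + 1) \<le> (2 * log 2 (real N)) * (2 * real N)"
    using l by (intro mult_mono) simp_all
  moreover have "1 * 1 \<le> real N * log 2 (real N)" using N l by (intro mult_mono) simp_all
  moreover have "(2 * log 2 (real N)) * (2 * real N) = 4 * (real N * log 2 (real N))" by simp
  ultimately have "2000 * (real (floor_log N + 1) * real (N + 1)) + 20 \<le> 8020 * (real N * log 2 (real N))"
    by linarith
  then have "real (layout_time N) \<le> 8020 * (real N * log 2 (real N))"
    unfolding layout_time_def by (simp add: algebra_simps)
  then show "norm (real (layout_time N)) \<le> 8020 * norm (real N * log 2 (real N))"
    using l by simp
qed

section \<open>Transfer of the bounds to datatype trees\<close>

lemma tree_layout_is_layout:
  assumes "node_numbered t"
  shows "is_layout t (tree_layout t)"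
proof (cases t)
  case (Node l x r)
  interpret numbered_tree t x using assms Node by unfold_locales simp_all
  have "tree_layout t = layout" using Node by (simp add: tree_layout_def)
  then show ?thesis
    using layout_pass_permutes[of "Suc height"] nodes by (simp add: is_layout_def layout_def)
qed (simp add: is_layout_def tree_layout_def)

lemma root_paths_numbered_tree:
  assumes "node_numbered t" "p \<in> root_paths t"
  obtains root where "numbered_tree t root" "tree_layout t =
    rooted_tree.layout (size t) root (parent_at t) (depth_at t) (subtree_size t)"
proof (cases t)
  case Leaf
  then show ?thesis using assms by simp
next
  case (Node l x r)
  then have "numbered_tree t x" using assms by unfold_locales simp_all
  then show ?thesis using that Node by (simp add: tree_layout_def)
qed

lemma tree_layout_short_paths:
  assumes a: "0 < a"
  shows "\<exists>c > 0. \<forall>t B p. node_numbered t \<longrightarrow> 1 \<le> B \<longrightarrow> p \<in> root_paths t \<longrightarrow>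
    (let N = real (size t); D = real (path_length p) in
      D \<le> a * log 2 N \<longrightarrow>
      real (transfers B (tree_layout t) p) \<le> c * max 1 (D / log 2 (1 + real B)))"
proof (intro exI[of _ "12 + 1872 * real (nat \<lceil>a\<rceil> + 1)"] conjI allI impI, goal_cases)
  case 1
  show ?case by simp
next
  case (2 t B p)
  obtain root where nt: "numbered_tree t root" and L: "tree_layout t =
      rooted_tree.layout (size t) root (parent_at t) (depth_at t) (subtree_size t)"
    using root_paths_numbered_tree[OF 2(1,3)] .
  interpret numbered_tree t root by (rule nt)
  show ?case
    unfolding L Let_def using transfers_short[OF root_path_node_path[OF 2(3)] 2(2) a] by blast
qed

lemma tree_layout_medium_paths:
  assumes a: "0 < a"
  shows "\<exists>c > 0. \<forall>t B p. node_numbered t \<longrightarrow> 1 \<le> B \<longrightarrow> p \<in> root_paths t \<longrightarrow>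
    (let N = real (size t); D = real (path_length p) in
      a * log 2 N \<le> D \<longrightarrow> D \<le> b * (real B * log 2 N) \<longrightarrow>
      real (transfers B (tree_layout t) p)
        \<le> c * max 1 (log 2 N / log 2 (1 + real B * log 2 N / D)))"
proof (intro exI[of _ "30 + 3744 * (2 + log 2 (1 + 1 / a))"] conjI allI impI, goal_cases)
  case 1
  show ?case using log_one_plus_inverse_nonneg[OF a] by simp
next
  case (2 t B p)
  obtain root where nt: "numbered_tree t root" and L: "tree_layout t =
      rooted_tree.layout (size t) root (parent_at t) (depth_at t) (subtree_size t)"
    using root_paths_numbered_tree[OF 2(1,3)] .
  interpret numbered_tree t root by (rule nt)
  show ?case
    unfolding L Let_def using transfers_medium[OF root_path_node_path[OF 2(3)] 2(2) a] by blast
qed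

lemma tree_layout_long_paths:
  assumes a: "0 < a"
  shows "\<exists>c > 0. \<forall>t B p. node_numbered t \<longrightarrow> 1 \<le> B \<longrightarrow> p \<in> root_paths t \<longrightarrow>
    (let N = real (size t); D = real (path_length p) in
      a * (real B * log 2 N) \<le> D \<longrightarrow>
      real (transfers B (tree_layout t) p) \<le> c * max 1 (D / real B))"
proof (intro exI[of _ "18 + 3744 / a"] conjI allI impI, goal_cases)
  case 1
  show ?case using a by (simp add: add_pos_pos)
next
  case (2 t B p)
  obtain root where nt: "numbered_tree t root" and L: "tree_layout t =
      rooted_tree.layout (size t) root (parent_at t) (depth_at t) (subtree_size t)"
    using root_paths_numbered_tree[OF 2(1,3)] .
  interpret numbered_tree t root by (rule nt)
  show ?case
    unfolding L Let_def using transfers_long[OF root_path_node_path[OF 2(3)] 2(2) a] by blast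
qed

theorem theorem2:
  "\<exists>(P :: ram_prog) (k :: nat) (L :: nat tree \<Rightarrow> nat list) (T :: nat \<Rightarrow> nat).
     (\<lambda>N. real (T N)) \<in> O(\<lambda>N. real N * log 2 (real N)) \<and>
     ram_computes P k L T \<and>
     (\<forall>t. node_numbered t \<longrightarrow> is_layout t (L t)) \<and>
     (\<forall>a > 0. \<exists>c > 0. \<forall>t B p. node_numbered t \<longrightarrow> 1 \<le> B \<longrightarrow> p \<in> root_paths t \<longrightarrow>
        (let N = real (size t); D = real (path_length p) in
          D \<le> a * log 2 N \<longrightarrow>
          real (transfers B (L t) p) \<le> c * max 1 (D / log 2 (1 + real B)))) \<and>
     (\<forall>a > 0. \<forall>b > 0. \<exists>c > 0. \<forall>t B p. node_numbered t \<longrightarrow> 1 \<le> B \<longrightarrow> p \<in> root_paths t \<longrightarrow>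
        (let N = real (size t); D = real (path_length p) in
          a * log 2 N \<le> D \<longrightarrow> D \<le> b * (real B * log 2 N) \<longrightarrow>
          real (transfers B (L t) p)
            \<le> c * max 1 (log 2 N / log 2 (1 + real B * log 2 N / D)))) \<and>
     (\<forall>a > 0. \<exists>c > 0. \<forall>t B p. node_numbered t \<longrightarrow> 1 \<le> B \<longrightarrow> p \<in> root_paths t \<longrightarrow>
        (let N = real (size t); D = real (path_length p) in
          a * (real B * log 2 N) \<le> D \<longrightarrow>
          real (transfers B (L t) p) \<le> c * max 1 (D / real B)))"
proof (rule exI[of _ layout_ram], rule exI[of _ 9], rule exI[of _ tree_layout],
    rule exI[of _ layout_time], intro conjI allI impI)
qed (rule layout_time_bigo layout_ram_computes tree_layout_is_layout tree_layout_short_paths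
  tree_layout_medium_paths tree_layout_long_paths; assumption?)+

end
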